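(* Let $p\ge 11$ be a prime number with $p\equiv 2\pmod 3$ and let $n\ge1$. If $A\subseteq\mathbb{F}_p^n$ is a sum-free set with $|A|\ge\frac13(p-2)p^{n-1}$, then either $A$ is isomorphic to a subset of $\bigl[\frac{p+1}{3},\frac{2p-1}{3}\bigr]\times\mathbb{F}_p^{n-1}$, or $A$ is structured.
   Context: A subset $A$ of an abelian group is sum-free if there are no $x,y,z\in A$ with $x+y=z$. Two subsets of an abelian group $G$ are isomorphic if some group automorphism of $G$ maps one onto the other. Elements of $\mathbb{F}_p$ are identified with residues of integers mod $p$, and for integers $a\le b$, $[a,b]$ denotes $\{a,a+1,\dots,b\}$ reduced mod $p$; $\mathbb{F}_p^n$ is identified with $\mathbb{F}_p\times\mathbb{F}_p^{n-1}$ (with $\mathbb{F}_p^0=\{0\}$). Write $p=6m-1$. A set $A\subseteq\mathbb{F}_p^n$ is very structured if there is a (possibly empty) set $P\subseteq\mathbb{F}_p^{n-1}$ with $0\notin P+P$ such that $A$ is isomorphic to \[ \{(2m-1,0)\}\cup \{2m\}\times(\mathbb{F}_p^{n-1}\setminus P)\cup[2m+1,4m-3]\times\mathbb{F}_p^{n-1}\cup\{4m-2\}\times(\mathbb{F}_p^{n-1}\setminus\{0\})\cup\{4m-1\}\times P . \] A set $A\subseteq\mathbb{F}_p^n$ is structured if there exist $\ell\in\{1,\dots,n\}$ and a very structured set $B\subseteq\mathbb{F}_p^\ell$ such that $A$ is isomorphic to $B\times\mathbb{F}_p^{n-\ell}$. *)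

theory Defs
  imports
    "Berlekamp_Zassenhaus.Finite_Field"
    "Jordan_Normal_Form.Matrix"
    "HOL-Algebra.Coset"
begin

definition sum_free :: "('a, 'b) monoid_scheme \<Rightarrow> 'a set \<Rightarrow> bool" where
  "sum_free G A \<longleftrightarrow> A \<subseteq> carrier G \<and> \<not> (\<exists>x\<in>A. \<exists>y\<in>A. \<exists>z\<in>A. x \<otimes>\<^bsub>G\<^esub> y = z)"

definition isomorphic_subsets :: "('a, 'b) monoid_scheme \<Rightarrow> 'a set \<Rightarrow> 'a set \<Rightarrow> bool" where
  "isomorphic_subsets G A B \<longleftrightarrow>
     A \<subseteq> carrier G \<and> B \<subseteq> carrier G \<and> (\<exists>\<phi>\<in>iso G G. \<phi> ` A = B)"

(* F_p is the type 'p mod_ring with p = CARD('p) prime; the group F_p^n has as its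
   carrier the vectors of dimension n, and it is written multiplicatively only in
   the record notation of HOL-Algebra. *)
abbreviation FV :: "nat \<Rightarrow> ('p :: prime_card) mod_ring vec monoid" where
  "FV n \<equiv> monoid_vec TYPE('p mod_ring) n"

definition residue_interval :: "int \<Rightarrow> int \<Rightarrow> ('p :: prime_card) mod_ring set" where
  "residue_interval a b = of_int ` {a..b}"

(* C x V as a subset of F_p x F_p^k = F_p^(k+1) *)
definition cons_times :: "'a set \<Rightarrow> 'a vec set \<Rightarrow> 'a vec set"  (infixr \<open>\<times>\<^sub>c\<close> 80) where
  "C \<times>\<^sub>c V = {vCons c v | c v. c \<in> C \<and> v \<in> V}"

(* B x C as a subset of F_p^k x F_p^l = F_p^(k+l) *)
definition append_times :: "'a vec set \<Rightarrow> 'a vec set \<Rightarrow> 'a vec set"  (infixr \<open>\<times>\<^sub>v\<close> 80) where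
  "B \<times>\<^sub>v C = {b @\<^sub>v c | b c. b \<in> B \<and> c \<in> C}"

(* k is the dimension of the second factor, so the set lives in F_p^(k+1). *)
definition model_set :: "int \<Rightarrow> nat \<Rightarrow> ('p :: prime_card) mod_ring vec set \<Rightarrow> 'p mod_ring vec set" where
  "model_set m k P =
     {vCons (of_int (2*m - 1)) (0\<^sub>v k)}
     \<union> {of_int (2*m)} \<times>\<^sub>c (carrier_vec k - P)
     \<union> residue_interval (2*m + 1) (4*m - 3) \<times>\<^sub>c carrier_vec k
     \<union> {of_int (4*m - 2)} \<times>\<^sub>c (carrier_vec k - {0\<^sub>v k})
     \<union> {of_int (4*m - 1)} \<times>\<^sub>c P"

(* There is a suitable m only if p = 5 (mod 6), and then it is unique.  For n = 0 the
   model set is not contained in F_p^0, so the predicate is false. *)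
definition very_structured :: "nat \<Rightarrow> ('p :: prime_card) mod_ring vec set \<Rightarrow> bool" where
  "very_structured n A \<longleftrightarrow>
     (\<exists>m P. int CARD('p) = 6*m - 1 \<and> P \<subseteq> carrier_vec (n - 1)
        \<and> 0\<^sub>v (n - 1) \<notin> P <#>\<^bsub>FV (n - 1)\<^esub> P
        \<and> isomorphic_subsets (FV n) A (model_set m (n - 1) P))"

definition structured :: "nat \<Rightarrow> ('p :: prime_card) mod_ring vec set \<Rightarrow> bool" where
  "structured n A \<longleftrightarrow>
     (\<exists>l\<in>{1..n}. \<exists>B. very_structured l B
        \<and> isomorphic_subsets (FV n) A (B \<times>\<^sub>v carrier_vec (n - l)))"

end

theory Submission
  imports Defs "HOL-Library.Function_Algebras" "HOL-Number_Theory.Number_Theory"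
begin

text \<open>Write \<open>p = 6m - 1\<close>. Since \<open>A\<close> is sum-free, the sum of \<open>|h v|\<^sup>2 Re (h v)\<close> over its Fourier
  coefficients \<open>h v\<close> vanishes, so the trivial one is balanced by some \<open>v \<noteq> 0\<close> with a large negative
  \<open>Re (h v)\<close>. Cut \<open>A\<close> into slices along the cosets of the hyperplane \<open>V\<close> orthogonal to \<open>v\<close>. The
  normalised slice sizes \<open>F x\<close> lie in \<open>[0, p]\<close> and satisfy weak Kneser bounds on additive triples,
  and together with the Fourier bias this forces \<open>F x > 2m + 2\<close> for some \<open>x\<close>. Ordering the residues
  by \<open>F\<close>, the Cauchy-Davenport theorem then shows that at most \<open>2m + 2\<close> slices are nonempty, and
  Vosper's theorem that after a dilation they have indices in \<open>[2m - 1, 4m]\<close>. If neither end of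
  this window is used, \<open>A\<close> is of the first kind. Otherwise translation by a point \<open>a\<close> of the end
  coset \<open>2m - 1\<close> pairs up the slices and all estimates are sharp: with \<open>a\<close> as origin of its
  coset, the slice there is a subgroup, whose linear complement in \<open>V\<close> carries the set \<open>P\<close>.\<close>

text \<open>The obstacle is the constant profile 2m - 1. It has the right total and violates none of
  the inequalities in \<open>slice_profile\<close>, so sumset estimates alone cannot locate
  \<open>A\<close>. The Fourier bias excludes it and everything close to it: for a suitable
  \<open>v\<close> the mean of \<open>Re (chr (dotp n v a))\<close> over \<open>A\<close> is at most
  -(2m - 1)/(4m), roughly -1/2, whereas values between 0 and 2m + 2 with mean 2m - 1 lie so near
  their maximum that for large m they cannot be that biased. The threshold 2m + 2 is where the
  combinatorial argument takes over: if all slices are nonempty and the largest value is f, pairing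
  the slices bounds the total by p(p + 1 - f)/2, and hence f by 2m + 2. The crude form of the bias
  argument works from m = 4 on, which leaves p = 11 and p = 17 to a finer computation. That p is odd
  enters repeatedly: no slice fills exactly half of its coset, a symmetric set without 0 has even
  size, and \<open>card V\<close> is odd.\<close>

section \<open>Numerical bounds for small primes\<close>

text \<open>The coefficients in \<open>corr\<close> are \<open>- 200\<close> times lower bounds for \<open>cos (2 * i * pi / 11)\<close>, and
  \<open>111/10\<close> exceeds \<open>11 + 1/11\<close>. The additive triples and the case distinctions were found by
  linear programming.\<close>

lemma no_flat_profile_11:
  fixes f :: "nat \<Rightarrow> real"
  assumes lo: "\<And>i. i < 11 \<Longrightarrow> 0 \<le> f i" and hi: "\<And>i. i < 11 \<Longrightarrow> f i \<le> 6"
    and tot: "(\<Sum>i<11. f i) = 33"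
    and corr: "2475 \<le> 192 * (f 5 + f 6) + 132 * (f 4 + f 7) + 30 * (f 3 + f 8)
      - 82 * (f 2 + f 9) - 168 * (f 1 + f 10) - 200 * f 0"
    and K: "\<And>i j. i < 11 \<Longrightarrow> j < 11 \<Longrightarrow> f i + f j + f ((i + j) mod 11) \<le> 12"
    and R1: "f 2 + f 4 + f 6 \<le> 111/10 \<or> (\<exists>k::nat. f 2 + f 4 \<le> real k + 1 \<and> f 6 \<le> 11 - real k)"
    and R2: "f 3 + f 3 + f 6 \<le> 111/10 \<or> (\<exists>k::nat. f 3 + f 3 \<le> real k + 1 \<and> f 6 \<le> 11 - real k)"
    and R3: "f 7 + f 3 + f 7 \<le> 111/10 \<or> (\<exists>k::nat. f 7 + f 3 \<le> real k + 1 \<and> f 7 \<le> 11 - real k)"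
    and R4: "f 2 + f 5 + f 7 \<le> 111/10 \<or> (\<exists>k::nat. f 2 + f 5 \<le> real k + 1 \<and> f 7 \<le> 11 - real k)"
  shows False
proof -
  have t: "f 0 + f 1 + f 2 + f 3 + f 4 + f 5 + f 6 + f 7 + f 8 + f 9 + f 10 = 33"
    using tot by (simp add: numeral_eq_Suc)
  have "2475 \<le> 192 * f 5 + 192 * f 6 + 132 * f 4 + 132 * f 7 + 30 * f 3 + 30 * f 8
      - 82 * f 2 - 82 * f 9 - 168 * f 1 - 168 * f 10 - 200 * f 0"
    using corr by simp
  note c = t this
  have K05: "f 0 + f 5 + f 5 \<le> 12" using K[of 0 5] by simp
  have K15: "f 1 + f 5 + f 6 \<le> 12" using K[of 1 5] by simp
  have K24: "f 2 + f 4 + f 6 \<le> 12" using K[of 2 4] by simp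
  have K25: "f 2 + f 5 + f 7 \<le> 12" using K[of 2 5] by simp
  have K33: "f 3 + f 3 + f 6 \<le> 12" using K[of 3 3] by simp
  have K34: "f 3 + f 4 + f 7 \<le> 12" using K[of 3 4] by simp
  have K44: "f 4 + f 4 + f 8 \<le> 12" using K[of 4 4] by simp
  have K45: "f 4 + f 5 + f 9 \<le> 12" using K[of 4 5] by simp
  have K55: "f 5 + f 5 + f 10 \<le> 12" using K[of 5 5] by simp
  have K58: "f 5 + f 8 + f 2 \<le> 12" using K[of 5 8] by simp
  have K59: "f 5 + f 9 + f 3 \<le> 12" using K[of 5 9] by simp
  have K66: "f 6 + f 6 + f 1 \<le> 12" using K[of 6 6] by simp
  have K68: "f 6 + f 8 + f 3 \<le> 12" using K[of 6 8] by simp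
  have K69: "f 6 + f 9 + f 4 \<le> 12" using K[of 6 9] by simp
  have K610: "f 6 + f 10 + f 5 \<le> 12" using K[of 6 10] by simp
  have K77: "f 7 + f 7 + f 3 \<le> 12" using K[of 7 7] by simp
  have K78: "f 7 + f 8 + f 4 \<le> 12" using K[of 7 8] by simp
  have K79: "f 7 + f 9 + f 5 \<le> 12" using K[of 7 9] by simp
  have K88: "f 8 + f 8 + f 5 \<le> 12" using K[of 8 8] by simp
  \<comment> \<open>\<open>f 6 > 4\<close> and \<open>f 7 > 3\<close> bound the number
    \<open>k\<close> in the second alternatives of \<open>R1\<close> to \<open>R4\<close>, so that
    each of these hypotheses becomes a disjunction of three or four linear cases.\<close>
  have f6: "f 6 > 4"
    using c K05 K34 K44 K45 K58 K59 K77 lo[of 0] by linarith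
  have f7: "f 7 > 3"
    using c K05 K24 K33 K44 K45 K68 lo[of 0] hi[of 6] by linarith
  have red6: "x + y + f 6 \<le> 111/10 \<or> x + y \<le> 6 \<or> (x + y \<le> 7 \<and> f 6 \<le> 5)"
    if "x + y + f 6 \<le> 111/10 \<or> (\<exists>k::nat. x + y \<le> real k + 1 \<and> f 6 \<le> 11 - real k)" for x y :: real
    using that
  proof (elim disjE exE conjE)
    fix k :: nat assume k: "x + y \<le> real k + 1" "f 6 \<le> 11 - real k"
    then have "real k < 7" using f6 by linarith
    then have "k \<le> 5 \<or> k = 6" by linarith
    then show ?thesis using k by auto
  qed simp
  have red7: "x + y + f 7 \<le> 111/10 \<or> x + y \<le> 6 \<or> (x + y \<le> 7 \<and> f 7 \<le> 5) \<or> (x + y \<le> 8 \<and> f 7 \<le> 4)"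
    if "x + y + f 7 \<le> 111/10 \<or> (\<exists>k::nat. x + y \<le> real k + 1 \<and> f 7 \<le> 11 - real k)" for x y :: real
    using that
  proof (elim disjE exE conjE)
    fix k :: nat assume k: "x + y \<le> real k + 1" "f 7 \<le> 11 - real k"
    then have "real k < 8" using f7 by linarith
    then have "k \<le> 5 \<or> k = 6 \<or> k = 7" by linarith
    then show ?thesis using k by auto
  qed simp
  from red6[OF R1] consider (a) "f 2 + f 4 + f 6 \<le> 111/10" | (b) "f 2 + f 4 \<le> 6"
    | (c) "f 2 + f 4 \<le> 7" "f 6 \<le> 5" by blast
  then show False
  proof cases
    case a
    from red6[OF R2] show False
    proof (elim disjE conjE)
      assume "f 3 + f 3 + f 6 \<le> 111/10"
      with a c K05 K15 K34 K610 K78 K79 K88 show False by linarith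
    next
      assume "f 3 + f 3 \<le> 6"
      with a c K05 K15 K66 K610 K78 K79 K88 show False by linarith
    next
      assume "f 6 \<le> 5"
      with a c K05 K15 K33 K34 K55 K79 K88 show False by linarith
    qed
  next
    case b
    from red7[OF R3] show False
    proof (elim disjE conjE)
      assume "f 7 + f 3 + f 7 \<le> 111/10"
      with b c K05 K15 K33 K34 K66 K69 K610 K88 show False by linarith
    next
      assume "f 7 + f 3 \<le> 6"
      with c K05 K24 K33 K34 K44 K66 K610 K79 K88 show False by linarith
    next
      assume "f 7 + f 3 \<le> 7"
      with b c K05 K44 K66 K69 K610 K79 K88 hi[of 6] show False by linarith
    next
      assume "f 7 \<le> 4"
      with b c K05 K33 K44 K45 K66 K68 K610 K88 show False by linarith
    qed
  next
    case d: c
    from red7[OF R4] show False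
    proof (elim disjE conjE)
      assume "f 2 + f 5 + f 7 \<le> 111/10"
      with d c K15 K33 K34 K45 K66 K610 K88 show False by linarith
    next
      assume "f 2 + f 5 \<le> 6"
      with c K05 K33 K34 K66 K69 K610 K78 K79 K88 show False by linarith
    next
      assume "f 2 + f 5 \<le> 7" "f 7 \<le> 5"
      with d c K15 K34 K44 K55 K59 K66 K79 K88 show False by linarith
    next
      assume "f 2 + f 5 \<le> 8" "f 7 \<le> 4"
      with d c K15 K25 K33 K44 K45 K55 K88 lo[of 0] show False by linarith
    qed
  qed
qed

section \<open>Taylor bounds for cosines of rational multiples of pi\<close>

lemma sum_upto_Taylor:
  fixes g :: "nat \<Rightarrow> real"
  shows "(\<Sum>k<4. g k) = g 0 + g 1 + g 2 + g 3" "(\<Sum>k<5. g k) = g 0 + g 1 + g 2 + g 3 + g 4"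
    "(\<Sum>k<6. g k) = g 0 + g 1 + g 2 + g 3 + g 4 + g 5"
    "(\<Sum>k<7. g k) = g 0 + g 1 + g 2 + g 3 + g 4 + g 5 + g 6"
  by (simp_all add: numeral_eq_Suc)

lemma cos_le_taylor: "cos x \<le> 1 - x\<^sup>2 / 2 + x ^ 4 / 24" for x :: real
proof -
  obtain t where t: "cos x = (\<Sum>k<4. cos_coeff k * x ^ k) + cos (t + 1/2 * real 4 * pi) / fact 4 * x ^ 4"
    using Maclaurin_cos_expansion[of x 4] by blast
  have "cos (t + 1/2 * real 4 * pi) \<le> 1" by simp
  then have "cos (t + 1/2 * real 4 * pi) / fact 4 * x ^ 4 \<le> 1 / fact 4 * x ^ 4"
    by (intro mult_right_mono divide_right_mono) auto
  moreover have "(\<Sum>k<4. cos_coeff k * x ^ k) = 1 - x\<^sup>2 / 2"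
    by (simp add: sum_upto_Taylor cos_coeff_def fact_numeral)
  ultimately show ?thesis using t by (simp add: fact_numeral)
qed

lemma cos_ge_taylor: "1 - x\<^sup>2 / 2 + x ^ 4 / 24 - x ^ 6 / 720 \<le> cos x" for x :: real
proof -
  obtain t where t: "cos x = (\<Sum>k<6. cos_coeff k * x ^ k) + cos (t + 1/2 * real 6 * pi) / fact 6 * x ^ 6"
    using Maclaurin_cos_expansion[of x 6] by blast
  have "- 1 \<le> cos (t + 1/2 * real 6 * pi)" by simp
  then have "- 1 / fact 6 * x ^ 6 \<le> cos (t + 1/2 * real 6 * pi) / fact 6 * x ^ 6"
    by (intro mult_right_mono divide_right_mono) auto
  moreover have "(\<Sum>k<6. cos_coeff k * x ^ k) = 1 - x\<^sup>2 / 2 + x ^ 4 / 24"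
    by (simp add: sum_upto_Taylor cos_coeff_def fact_numeral)
  ultimately show ?thesis using t by (simp add: fact_numeral)
qed

lemma sin_le_taylor: "sin x \<le> x - x ^ 3 / 6 + x ^ 5 / 120" if "0 \<le> x" for x :: real
proof -
  obtain t where t: "sin x = (\<Sum>k<5. sin_coeff k * x ^ k) + sin (t + 1/2 * real 5 * pi) / fact 5 * x ^ 5"
    using Maclaurin_sin_expansion[of x 5] by blast
  have "sin (t + 1/2 * real 5 * pi) \<le> 1" by simp
  then have "sin (t + 1/2 * real 5 * pi) / fact 5 * x ^ 5 \<le> 1 / fact 5 * x ^ 5"
    using that by (intro mult_right_mono divide_right_mono) auto
  moreover have "(\<Sum>k<5. sin_coeff k * x ^ k) = x - x ^ 3 / 6"
    by (simp add: sum_upto_Taylor sin_coeff_def fact_numeral)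
  ultimately show ?thesis using t by (simp add: fact_numeral)
qed

lemma sin_ge_taylor: "x - x ^ 3 / 6 + x ^ 5 / 120 - x ^ 7 / 5040 \<le> sin x" if "0 \<le> x" for x :: real
proof -
  obtain t where t: "sin x = (\<Sum>k<7. sin_coeff k * x ^ k) + sin (t + 1/2 * real 7 * pi) / fact 7 * x ^ 7"
    using Maclaurin_sin_expansion[of x 7] by blast
  have "- 1 \<le> sin (t + 1/2 * real 7 * pi)" by simp
  then have "- 1 / fact 7 * x ^ 7 \<le> sin (t + 1/2 * real 7 * pi) / fact 7 * x ^ 7"
    using that by (intro mult_right_mono divide_right_mono) auto
  moreover have "(\<Sum>k<7. sin_coeff k * x ^ k) = x - x ^ 3 / 6 + x ^ 5 / 120"
    by (simp add: sum_upto_Taylor sin_coeff_def fact_numeral)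
  ultimately show ?thesis using t by (simp add: fact_numeral)
qed

text \<open>Since sin (pi / 6) = 1/2, it suffices that the Taylor bound for the sine at 3.141 / 6 =
  1047/2000 stays below 1/2. The upper bound for pi uses 3.142 / 6 = 1571/3000 in the same
  way.\<close>

lemma pi_gt_3141: "3141 / 1000 < pi"
proof (rule ccontr)
  assume "\<not> 3141 / 1000 < pi"
  then have "sin (pi / 6) \<le> sin (1047 / 2000)"
    using pi_ge_two by (intro sin_monotone_2pi_le) auto
  also have "\<dots> < 1 / 2"
    using sin_le_taylor[of "1047 / 2000"] by (simp add: power_divide)
  finally show False by (simp add: sin_30)
qed

lemma pi_lt_3142: "pi < 3142 / 1000"
proof (rule ccontr)
  assume "\<not> pi < 3142 / 1000"
  then have "sin (1571 / 3000) \<le> sin (pi / 6)"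
    by (intro sin_monotone_2pi_le) auto
  moreover have "1 / 2 < sin (1571 / 3000 :: real)"
    using sin_ge_taylor[of "1571 / 3000"] by (simp add: power_divide)
  ultimately show False by (simp add: sin_30)
qed

lemma cos_le_rational:
  fixes a b x :: real
  assumes "0 \<le> a" "a \<le> x" "x \<le> pi" "1 - a\<^sup>2 / 2 + a ^ 4 / 24 \<le> b"
  shows "cos x \<le> b"
proof -
  have "cos x \<le> cos a" using assms by (intro cos_monotone_0_pi_le) auto
  then show ?thesis using cos_le_taylor[of a] assms(4) by linarith
qed

lemma cos_ge_rational:
  fixes a b x :: real
  assumes "0 \<le> x" "x \<le> a" "a \<le> 3" "b \<le> 1 - a\<^sup>2 / 2 + a ^ 4 / 24 - a ^ 6 / 720"
  shows "b \<le> cos x"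
proof -
  have "cos a \<le> cos x" using assms pi_gt_3141 by (intro cos_monotone_0_pi_le) auto
  then show ?thesis using cos_ge_taylor[of a] assms(4) by linarith
qed

lemma cos_half_period:
  assumes "a + b = 1"
  shows "cos (a * pi) = - cos (b * pi)"
proof -
  have "a = 1 - b" using assms by simp
  then have "a * pi = pi - b * pi" by (simp only: left_diff_distrib mult_1)
  then show ?thesis by simp
qed

lemma cos_full_period:
  assumes "a + b = 2"
  shows "cos (a * pi) = cos (b * pi)"
proof -
  have "a = 2 - b" using assms by simp
  then have "a * pi = 2 * pi - b * pi" by (simp only: left_diff_distrib)
  then show ?thesis by simp
qed

lemma cos_elevenths:
  "84/100 \<le> cos (2/11 * pi)" "41/100 \<le> cos (4/11 * pi)" "- 15/100 \<le> cos (6/11 * pi)"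
  "- 66/100 \<le> cos (8/11 * pi)" "- 96/100 \<le> cos (10/11 * pi)"
proof -
  show "84/100 \<le> cos (2/11 * pi)"
    using pi_lt_3142 by (intro cos_ge_rational[of _ "3142/5500"]) (simp_all add: power_divide)
  show "41/100 \<le> cos (4/11 * pi)"
    using pi_lt_3142 by (intro cos_ge_rational[of _ "3142/2750"]) (simp_all add: power_divide)
  \<comment> \<open>The quartic bound for this cosine slightly exceeds 15/100; the linear bound for
    the sine of the complementary angle does not.\<close>
  have "cos (5/11 * pi) = sin (1/22 * pi)"
    by (simp add: cos_sin_eq algebra_simps)
  also have "\<dots> \<le> 1/22 * pi" by (rule sin_x_le_x) simp
  finally show "- 15/100 \<le> cos (6/11 * pi)"
    using pi_lt_3142 cos_half_period[of "6/11" "5/11"] by simp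
  have "cos (3/11 * pi) \<le> 66/100"
    using pi_gt_3141 by (intro cos_le_rational[of "9423/11000"]) (simp_all add: power_divide)
  then show "- 66/100 \<le> cos (8/11 * pi)" using cos_half_period[of "8/11" "3/11"] by simp
  have "cos (1/11 * pi) \<le> 96/100"
    using pi_gt_3141 by (intro cos_le_rational[of "3141/11000"]) (simp_all add: power_divide)
  then show "- 96/100 \<le> cos (10/11 * pi)" using cos_half_period[of "10/11" "1/11"] by simp
qed

lemma cos_seventeenths:
  "9/10 \<le> cos (2/17 * pi)" "7/10 \<le> cos (4/17 * pi)" "4/10 \<le> cos (6/17 * pi)"
  "0 \<le> cos (8/17 * pi)" "- 3/10 \<le> cos (10/17 * pi)" "- 7/10 \<le> cos (12/17 * pi)"
  "- 9/10 \<le> cos (14/17 * pi)"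
proof -
  show "9/10 \<le> cos (2/17 * pi)"
    using pi_lt_3142 by (intro cos_ge_rational[of _ "3142/8500"]) (simp_all add: power_divide)
  show "7/10 \<le> cos (4/17 * pi)"
    using pi_lt_3142 by (intro cos_ge_rational[of _ "3142/4250"]) (simp_all add: power_divide)
  show "4/10 \<le> cos (6/17 * pi)"
    using pi_lt_3142 by (intro cos_ge_rational[of _ "18852/17000"]) (simp_all add: power_divide)
  show "0 \<le> cos (8/17 * pi)"
    using pi_lt_3142 by (intro cos_ge_rational[of _ "3142/2125"]) (simp_all add: power_divide)
  have "cos (7/17 * pi) = sin (3/34 * pi)"
    by (simp add: cos_sin_eq algebra_simps)
  also have "\<dots> \<le> 3/34 * pi" by (rule sin_x_le_x) simp
  finally show "- 3/10 \<le> cos (10/17 * pi)"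
    using pi_lt_3142 cos_half_period[of "10/17" "7/17"] by simp
  have "cos (5/17 * pi) \<le> 7/10"
    using pi_gt_3141 by (intro cos_le_rational[of "15705/17000"]) (simp_all add: power_divide)
  then show "- 7/10 \<le> cos (12/17 * pi)" using cos_half_period[of "12/17" "5/17"] by simp
  have "cos (3/17 * pi) \<le> 9/10"
    using pi_gt_3141 by (intro cos_le_rational[of "9423/17000"]) (simp_all add: power_divide)
  then show "- 9/10 \<le> cos (14/17 * pi)" using cos_half_period[of "14/17" "3/17"] by simp
qed

text \<open>The numbers are those of m = 3: 8 = 2m + 2, 85 = (2m - 1)p, 425/12 = p(2m - 1)^2/(4m).
  The coefficients in \<open>corr\<close> are negated lower bounds for cos (2 i pi / 17), with 0
  taken at i = 4 and i = 13.\<close>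

lemma no_flat_profile_17:
  fixes f :: "nat \<Rightarrow> real"
  assumes lo: "\<And>i. i < 17 \<Longrightarrow> 0 \<le> f i" and hi: "\<And>i. i < 17 \<Longrightarrow> f i \<le> 8"
    and tot: "(\<Sum>i<17. f i) = 85"
    and corr: "425/12 \<le> f 8 + f 9 + 9/10 * f 7 + 9/10 * f 10 + 7/10 * f 6 + 7/10 * f 11
      + 3/10 * f 5 + 3/10 * f 12 - 4/10 * f 3 - 4/10 * f 14 - 7/10 * f 2 - 7/10 * f 15
      - 9/10 * f 1 - 9/10 * f 16 - f 0"
    and K: "\<And>i j. i < 17 \<Longrightarrow> j < 17 \<Longrightarrow> f i + f j + f ((i + j) mod 17) \<le> 18"
  shows False
proof -
  have t: "f 0 + f 1 + f 2 + f 3 + f 4 + f 5 + f 6 + f 7 + f 8 + f 9 + f 10 + f 11 + f 12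
      + f 13 + f 14 + f 15 + f 16 = 85"
    using tot by (simp add: numeral_eq_Suc)
  have "f 2 + f 7 + f 9 \<le> 18" using K[of 2 7] by simp
  moreover have "f 3 + f 5 + f 8 \<le> 18" using K[of 3 5] by simp
  moreover have "f 4 + f 6 + f 10 \<le> 18" using K[of 4 6] by simp
  moreover have "f 4 + f 11 + f 15 \<le> 18" using K[of 4 11] by simp
  moreover have "f 6 + f 7 + f 13 \<le> 18" using K[of 6 7] by simp
  moreover have "f 10 + f 14 + f 7 \<le> 18" using K[of 10 14] by simp
  ultimately show False
    using t corr lo[of 0] hi[of 5] hi[of 7] hi[of 8] hi[of 9] hi[of 10] hi[of 11] hi[of 12]
    by linarith
qed

section \<open>Sumsets in abelian groups\<close>

definition add_subgroup :: "'a::ab_group_add set \<Rightarrow> bool" where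
  "add_subgroup H \<longleftrightarrow> 0 \<in> H \<and> (\<forall>x\<in>H. \<forall>y\<in>H. x - y \<in> H)"

lemma add_subgroupI: "0 \<in> H \<Longrightarrow> (\<And>x y. x \<in> H \<Longrightarrow> y \<in> H \<Longrightarrow> x - y \<in> H) \<Longrightarrow> add_subgroup H"
  by (auto simp: add_subgroup_def)

lemma add_subgroupD:
  assumes "add_subgroup H"
  shows "0 \<in> H" "\<And>x y. x \<in> H \<Longrightarrow> y \<in> H \<Longrightarrow> x - y \<in> H" "\<And>x. x \<in> H \<Longrightarrow> - x \<in> H"
    "\<And>x y. x \<in> H \<Longrightarrow> y \<in> H \<Longrightarrow> x + y \<in> H"
proof -
  show 0: "0 \<in> H" and d: "\<And>x y. x \<in> H \<Longrightarrow> y \<in> H \<Longrightarrow> x - y \<in> H"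
    using assms by (auto simp: add_subgroup_def)
  show m: "- x \<in> H" if "x \<in> H" for x using d[OF 0 that] by simp
  show "x + y \<in> H" if "x \<in> H" "y \<in> H" for x y using d[OF that(1) m[OF that(2)]] by simp
qed

text \<open>The translates \<open>a + H\<close> of the points of \<open>A\<close> partition
  \<open>A\<close> into parts of size \<open>card H\<close>.\<close>

lemma card_subgroup_dvd_invariant:
  assumes H: "add_subgroup H" and fin: "finite A"
    and inv: "\<And>a h. a \<in> A \<Longrightarrow> h \<in> H \<Longrightarrow> a + h \<in> A"
  shows "card H dvd card A"
proof -
  let ?C = "(\<lambda>a. (+) a ` H) ` A"
  have U: "\<Union> ?C = A"
    using inv add_subgroupD(1)[OF H] by (auto intro!: image_eqI[of _ _ 0])
  have "card H * card ?C = card (\<Union> ?C)"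
  proof (rule card_partition)
    show "finite ?C" "finite (\<Union> ?C)" using fin U by auto
    show "card c = card H" if "c \<in> ?C" for c
      using that by (auto simp: card_image)
    show "c1 \<inter> c2 = {}" if c12: "c1 \<in> ?C" "c2 \<in> ?C" "c1 \<noteq> c2" for c1 c2
    proof (rule ccontr)
      assume "c1 \<inter> c2 \<noteq> {}"
      obtain a b where ab: "c1 = (+) a ` H" "c2 = (+) b ` H" using c12(1,2) by blast
      then obtain h k where hk: "h \<in> H" "k \<in> H" "a + h = b + k"
        using \<open>c1 \<inter> c2 \<noteq> {}\<close> by auto
      have sub: "(+) a ` H \<subseteq> (+) b ` H" if "a + h = b + k" "h \<in> H" "k \<in> H" for a b h k
      proof
        fix x assume "x \<in> (+) a ` H"
        then obtain l where "l \<in> H" "x = a + l" by auto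
        moreover have "a = b + (k - h)" using that(1) by (metis add_diff_cancel_right' add_diff_eq)
        ultimately show "x \<in> (+) b ` H"
          using add_subgroupD[OF H] that by (auto intro!: image_eqI[of _ _ "k - h + l"] simp: add.assoc)
      qed
      from sub[OF hk(3,1,2)] sub[OF hk(3)[symmetric] hk(2,1)] ab c12(3) show False by auto
    qed
  qed
  then show ?thesis using U by (metis dvd_triv_left)
qed

text \<open>The reflection \<open>c - B\<close> has the size of \<open>B\<close> and is disjoint
  from \<open>A\<close>.\<close>

lemma pigeonhole_sum:
  assumes V: "add_subgroup V" "finite V" and "A \<subseteq> V" "B \<subseteq> V" "c \<in> V"
    and miss: "\<And>a b. a \<in> A \<Longrightarrow> b \<in> B \<Longrightarrow> a + b \<noteq> c"
  shows "card A + card B \<le> card V"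
proof -
  have "card ((\<lambda>b. c - b) ` B) = card B" by (rule card_image) (auto intro: inj_onI)
  moreover have "A \<inter> (\<lambda>b. c - b) ` B = {}"
    using miss by force
  moreover have "A \<union> (\<lambda>b. c - b) ` B \<subseteq> V"
    using assms add_subgroupD(2)[OF V(1)] by auto
  moreover have "finite A" "finite B" using assms finite_subset by blast+
  ultimately show ?thesis
    using V(2) by (metis card_Un_disjoint card_mono finite_imageI)
qed

text \<open>A weak form of Kneser's theorem. The Dyson transform shrinks \<open>B\<close> while keeping
  \<open>card A + card B\<close>, until \<open>B - B\<close> stabilises \<open>A\<close>; a proper stabiliser then bounds \<open>B\<close>.\<close>

lemma sum_missing_set:
  assumes V: "add_subgroup V" "finite V" and A: "A \<subseteq> V" "A \<noteq> {}" and B: "B \<subseteq> V" "B \<noteq> {}"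
    and C: "C \<subseteq> V" "C \<noteq> {}"
    and miss: "\<And>a b. a \<in> A \<Longrightarrow> b \<in> B \<Longrightarrow> a + b \<notin> C"
  shows "\<exists>H A'. add_subgroup H \<and> H \<subset> V \<and> A' \<subseteq> V \<and> (\<forall>a\<in>A'. \<forall>h\<in>H. a + h \<in> A')
    \<and> card A' + card C \<le> card V \<and> card A + card B \<le> card A' + card H"
  using A B miss
proof (induction "card B" arbitrary: A B rule: less_induct)
  case less
  have fin: "finite A" "finite B" "finite C" using less.prems(1,3) C(1) V(2) finite_subset by blast+
  obtain b0 where b0: "b0 \<in> B" using less.prems(4) by auto
  show ?case
  proof (cases "\<forall>a\<in>A. \<forall>b\<in>B. \<forall>b'\<in>B. a - b + b' \<in> A")
    case True
    \<comment> \<open>\<open>H\<close> is the stabiliser of \<open>A\<close> in \<open>V\<close>. It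
      contains \<open>B - b0\<close>, hence is at least as large as \<open>B\<close>; and
      \<open>H = V\<close> would put \<open>c - b0\<close> into \<open>A\<close> for a point
      \<open>c\<close> of \<open>C\<close>.\<close>
    define H where "H = {h \<in> V. \<forall>x\<in>A. x + h \<in> A}"
    have H: "add_subgroup H"
    proof (rule add_subgroupI)
      show "0 \<in> H" using add_subgroupD(1)[OF V(1)] by (auto simp: H_def)
      fix x y assume xy: "x \<in> H" "y \<in> H"
      have "(\<lambda>a. a + y) ` A = A"
        using xy(2) fin(1) by (intro endo_inj_surj) (auto simp: H_def inj_on_def)
      then have "a - y \<in> A" if "a \<in> A" for a
        using that by (metis (no_types, lifting) add_diff_cancel_right' image_iff)
      then show "x - y \<in> H"
        using xy add_subgroupD(2)[OF V(1)] by (auto simp: H_def add_diff_eq)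
    qed
    have "H \<noteq> V"
    proof
      assume "H = V"
      obtain a c where ac: "a \<in> A" "c \<in> C" using less.prems(2) C(2) by auto
      have "c - b0 - a \<in> H"
        using \<open>H = V\<close> ac b0 less.prems(1,3) C(1) add_subgroupD(2)[OF V(1)] by (meson subsetD)
      then have "c - b0 \<in> A" using ac(1) unfolding H_def by fastforce
      then show False using less.prems(5)[of "c - b0" b0] b0 ac(2) by simp
    qed
    moreover have "card B \<le> card H"
    proof -
      have "(\<lambda>b. b - b0) ` B \<subseteq> H"
      proof (safe, unfold H_def, intro CollectI conjI ballI)
        fix b x assume "b \<in> B" "x \<in> A"
        then have "x - b0 + b \<in> A" using True b0 by blast
        then show "x + (b - b0) \<in> A" by (simp add: algebra_simps)
      qed (use b0 less.prems(3) add_subgroupD(2)[OF V(1)] in blast)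
      moreover have "finite H" using V(2) by (simp add: H_def)
      ultimately show ?thesis by (metis card_image card_mono inj_on_diff_right)
    qed
    moreover have "card A + card C \<le> card V"
    proof -
      have "card ((\<lambda>a. a + b0) ` A) = card A" by (simp add: card_image)
      moreover have "(\<lambda>a. a + b0) ` A \<inter> C = {}" using less.prems(5) b0 by auto
      moreover have "(\<lambda>a. a + b0) ` A \<union> C \<subseteq> V"
        using less.prems(1,3) b0 C(1) add_subgroupD(4)[OF V(1)] by blast
      ultimately show ?thesis
        using V(2) fin by (metis card_Un_disjoint card_mono finite_imageI)
    qed
    ultimately show ?thesis
      using H less.prems(1) by (intro exI[of _ H] exI[of _ A]) (auto simp: H_def)
  next
    case False
    then obtain a b b' where ab: "a \<in> A" "b \<in> B" "b' \<in> B" "a - b + b' \<notin> A" by auto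
    \<comment> \<open>As \<open>b + e = a\<close> is in \<open>A\<close> and \<open>b' + e\<close>
      is not, the transform keeps \<open>b\<close> and loses \<open>b'\<close>: \<open>B1\<close> is
      nonempty and smaller than \<open>B\<close>.\<close>
    define e where "e = a - b"
    define A1 where "A1 = A \<union> (\<lambda>x. x + e) ` B"
    define B1 where "B1 = {x \<in> B. x + e \<in> A}"
    have "b \<in> B1" "b' \<notin> B1" using ab by (auto simp: B1_def e_def algebra_simps)
    have "B1 \<subset> B" using \<open>b' \<notin> B1\<close> ab(3) by (auto simp: B1_def)
    have A1: "A1 \<subseteq> V"
      using less.prems(1,3) ab(1,2) add_subgroupD(2,4)[OF V(1)] by (auto simp: A1_def e_def subset_iff)
    have "card A1 + card (A \<inter> (\<lambda>x. x + e) ` B) = card A + card ((\<lambda>x. x + e) ` B)"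
      unfolding A1_def using fin by (simp add: card_Un_Int[symmetric])
    moreover have "A \<inter> (\<lambda>x. x + e) ` B = (\<lambda>x. x + e) ` B1" by (auto simp: B1_def)
    ultimately have sum: "card A1 + card B1 = card A + card B" by (simp add: card_image)
    have "card B1 < card B" using \<open>B1 \<subset> B\<close> fin(2) by (simp add: psubset_card_mono)
    moreover have "x + y \<notin> C" if "x \<in> A1" "y \<in> B1" for x y
    proof (cases "x \<in> A")
      case True
      then show ?thesis using less.prems(5) that by (auto simp: B1_def)
    next
      case False
      then obtain z where "z \<in> B" "x = z + e" using \<open>x \<in> A1\<close> by (auto simp: A1_def)
      \<comment> \<open>\<open>(z + e) + y = (y + e) + z\<close> with \<open>y + e\<close> in
        \<open>A\<close> and \<open>z\<close> in \<open>B\<close>, so the transform creates no new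
        sums.\<close>
      then show ?thesis using less.prems(5)[of "y + e" z] that by (simp add: B1_def algebra_simps)
    qed
    ultimately have "\<exists>H A'. add_subgroup H \<and> H \<subset> V \<and> A' \<subseteq> V \<and> (\<forall>a\<in>A'. \<forall>h\<in>H. a + h \<in> A')
        \<and> card A' + card C \<le> card V \<and> card A1 + card B1 \<le> card A' + card H"
      using less.hyps[of B1 A1] A1 \<open>B1 \<subset> B\<close> \<open>b \<in> B1\<close> less.prems(2,3) by (auto simp: A1_def)
    then show ?thesis using sum by auto
  qed
qed

text \<open>Cardinalities are measured in units of \<open>card V / p\<close>, so that subgroups of index \<open>p\<close> have
  size 1.\<close>

lemma relative_sizes_missing_sum:
  assumes V: "add_subgroup V" "finite V" "card V = p ^ k" and p: "prime p"
    and A: "A \<subseteq> V" "A \<noteq> {}" and B: "B \<subseteq> V" "B \<noteq> {}" and C: "C \<subseteq> V" "C \<noteq> {}"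
    and miss: "\<And>a b. a \<in> A \<Longrightarrow> b \<in> B \<Longrightarrow> a + b \<notin> C"
  defines "u \<equiv> \<lambda>X. real p * real (card X) / real (card V)"
  shows "u A + u B + u C \<le> real p + 1 / real p
    \<or> (\<exists>c::nat. u A + u B \<le> real c + 1 \<and> u C \<le> real p - real c)"
proof -
  have p0: "p > 0" using p prime_gt_0_nat by simp
  then have N: "real (card V) > 0" by (simp add: V(3))
  obtain H A' where H: "add_subgroup H" "H \<subset> V" "A' \<subseteq> V" "\<forall>a\<in>A'. \<forall>h\<in>H. a + h \<in> A'"
    and le: "card A' + card C \<le> card V" "card A + card B \<le> card A' + card H"
    using sum_missing_set[OF V(1,2) A B C miss] by blast
  have mono: "u X + u Y \<le> u Z + u W" if "card X + card Y \<le> card Z + card W" for X Y Z W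
  proof -
    have "real p * (real (card X) + real (card Y)) \<le> real p * (real (card Z) + real (card W))"
      using that by (intro mult_left_mono) linarith+
    then show ?thesis using N by (simp add: u_def add_divide_distrib[symmetric] distrib_left divide_right_mono)
  qed
  have uV: "u V = p" using N by (simp add: u_def)
  have le': "u A + u B \<le> u A' + u H" "u A' + u C \<le> p"
    using mono[OF le(2)] mono[of A' C V "{}"] le(1) uV by (auto simp: u_def)
  have "card H dvd p ^ k"
    using card_subgroup_dvd_invariant[OF H(1) V(2)] H(2) add_subgroupD(4)[OF V(1)] V(3) by (metis psubsetE subsetD)
  then obtain d where d: "d \<le> k" "card H = p ^ d" using divides_primepow_nat[OF p] by blast
  have "d \<noteq> k"
    using d H(2) V(2,3) by (metis psubset_card_mono less_irrefl)
  then have dk: "d < k" using d by simp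
  \<comment> \<open>If \<open>H\<close> has index p in \<open>V\<close>, then \<open>u H = 1\<close>
    and the union \<open>A'\<close> of \<open>c\<close> cosets of \<open>H\<close> has
    \<open>u A' = c\<close>, which gives the second alternative. Otherwise the index is at least p^2
    and \<open>u H\<close> is at most 1/p, which gives the first.\<close>
  show ?thesis
  proof (cases "Suc d = k")
    case True
    have "card H dvd card A'"
      using H(4) finite_subset[OF H(3) V(2)] by (intro card_subgroup_dvd_invariant[OF H(1)]) auto
    then obtain c where c: "card A' = card H * c" by (auto simp: dvd_def)
    have "card V = p * card H" using True by (simp add: d V(3) flip: power_Suc)
    moreover have "card H > 0" using d(2) p0 by simp
    ultimately have "u H = 1" "u A' = c" using p0 by (simp_all add: u_def c)
    then show ?thesis using le' by auto
  next
    case False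
    then have "d + 2 \<le> k" using dk by simp
    then obtain j where j: "k = d + 2 + j" by (rule less_eqE)
    have "u H * real p ^ (j + 1) = 1"
      using p0 by (simp add: u_def d V(3) j power_add power2_eq_square)
    moreover have "real p ^ 1 \<le> real p ^ (j + 1)" using p0 by (intro power_increasing) auto
    moreover have "u H \<ge> 0" by (simp add: u_def)
    ultimately have "u H * real p ^ 1 \<le> 1" using mult_left_mono by fastforce
    then have "u H \<le> 1 / real p" using p0 by (simp add: field_simps)
    then show ?thesis using le' by auto
  qed
qed

text \<open>A proper subgroup of F_p has one element, so the loss \<open>card H\<close> in
  \<open>sum_missing_set\<close> is 1. \<open>C\<close> is any nonempty part of the complement of
  \<open>A + B\<close>, which keeps the case \<open>A + B = UNIV\<close> out of the
  statement.\<close>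

lemma cauchy_davenport_triple:
  fixes A B C :: "'p::prime_card mod_ring set"
  assumes "A \<noteq> {}" "B \<noteq> {}" "C \<noteq> {}" and miss: "\<And>a b. a \<in> A \<Longrightarrow> b \<in> B \<Longrightarrow> a + b \<notin> C"
  shows "card A + card B + card C \<le> CARD('p) + 1"
proof -
  have U: "add_subgroup (UNIV :: 'p mod_ring set)" by (simp add: add_subgroup_def)
  obtain H A' :: "'p mod_ring set" where H: "add_subgroup H" "H \<subset> UNIV"
    and le: "card A' + card C \<le> CARD('p)" "card A + card B \<le> card A' + card H"
    using sum_missing_set[OF U _ _ assms(1) _ assms(2) _ assms(3) miss] by auto
  have "card H dvd CARD('p)"
    using card_subgroup_dvd_invariant[OF H(1), of UNIV] by simp
  moreover have "card H < CARD('p)"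
    using psubset_card_mono[OF _ H(2)] by simp
  ultimately have "card H = 1" using prime_card[where 'a = 'p] by (metis less_irrefl prime_nat_iff)
  then show ?thesis using le by simp
qed

lemma cauchy_davenport:
  fixes A B C :: "'p::prime_card mod_ring set"
  assumes "A \<noteq> {}" "B \<noteq> {}" "C \<noteq> {}" "CARD('p) + 1 < card A + card B + card C"
  obtains a b where "a \<in> A" "b \<in> B" "a + b \<in> C"
  using cauchy_davenport_triple[OF assms(1-3)] assms(4) by (meson not_le)

lemma of_nat_mod_ring_eq_iff:
  assumes "i < CARD('p)" "j < CARD('p)"
  shows "(of_nat i :: 'p::prime_card mod_ring) = of_nat j \<longleftrightarrow> i = j"
proof
  assume "(of_nat i :: 'p mod_ring) = of_nat j"
  then have "(of_int_mod_ring (int i) :: 'p mod_ring) = of_int_mod_ring (int j)"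
    by (simp add: of_nat_of_int_mod_ring)
  then have "int i = int j"
    using assms by (metis of_nat_0_le_iff of_nat_less_iff to_int_mod_ring_of_int_mod_ring)
  then show "i = j" by simp
qed simp

lemma exists_of_nat_mod_ring: "\<exists>k < CARD('p). (x :: 'p::prime_card mod_ring) = of_nat k"
proof (intro exI conjI)
  have "to_int_mod_ring x \<in> {0..<int CARD('p)}" using range_to_int_mod_ring by blast
  then show "nat (to_int_mod_ring x) < CARD('p)" "x = of_nat (nat (to_int_mod_ring x))"
    by (auto simp: of_nat_of_int_mod_ring)
qed

lemma card_Compl_mod_ring:
  fixes A :: "'p::prime_card mod_ring set"
  shows "card A + card (- A) = CARD('p)"
  using card_Un_disjoint[of A "- A"] by simp

section \<open>Vosper's theorem\<close>

text \<open>Taking \<open>card A\<close> itself as the number of terms forces the terms to be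
  distinct.\<close>

definition progression :: "'p::prime_card mod_ring \<Rightarrow> 'p mod_ring set \<Rightarrow> bool" where
  "progression d A \<longleftrightarrow> d \<noteq> 0 \<and> (\<exists>a. A = (\<lambda>k. a + of_nat k * d) ` {..<card A})"

lemma invariant_imp_UNIV:
  fixes A :: "'p::prime_card mod_ring set"
  assumes "A \<noteq> {}" "d \<noteq> 0" "\<And>a. a \<in> A \<Longrightarrow> a + d \<in> A"
  shows "A = UNIV"
proof -
  obtain a where a: "a \<in> A" using assms(1) by auto
  have *: "a + of_nat k * d \<in> A" for k
  proof (induction k)
    case (Suc k)
    then show ?case using assms(3)[OF Suc] by (simp add: algebra_simps)
  qed (use a in simp)
  have "x \<in> A" for x
  proof -
    obtain k where "(x - a) / d = of_nat k" using exists_of_nat_mod_ring by blast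
    then have "x = a + of_nat k * d" using assms(2) by (simp add: field_simps)
    then show ?thesis using * by simp
  qed
  then show ?thesis by auto
qed

text \<open>Steps by \<open>d\<close> cannot leave \<open>A\<close> except from \<open>a\<close>.
  Seen backwards from \<open>a\<close>, the numbers \<open>k\<close> with \<open>a - k d\<close> in
  \<open>A\<close> therefore form an initial segment.\<close>

lemma progression_if_one_exit:
  fixes A :: "'p::prime_card mod_ring set"
  assumes d: "d \<noteq> 0" and a: "a \<in> A" and step: "\<And>x. x \<in> A \<Longrightarrow> x \<noteq> a \<Longrightarrow> x + d \<in> A"
  shows "progression d A"
proof -
  define K where "K = {k. k < CARD('p) \<and> a - of_nat k * d \<in> A}"
  have down: "k \<in> K" if "Suc k \<in> K" for k
  proof -
    have "(of_nat (Suc k) :: 'p mod_ring) \<noteq> of_nat 0"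
      using that of_nat_mod_ring_eq_iff[of "Suc k" 0] by (auto simp: K_def)
    then have "a - of_nat (Suc k) * d \<noteq> a" using d by auto
    then have "a - of_nat (Suc k) * d + d \<in> A" using step that by (auto simp: K_def)
    then show ?thesis using that by (auto simp: K_def algebra_simps)
  qed
  have finK: "finite K" by (simp add: K_def)
  have down': "j \<in> K" if "k \<in> K" "j \<le> k" for j k
    using that(2,1) by (induction rule: dec_induct) (auto intro: down)
  have K: "K = {..<card K}"
  proof -
    have "K = {..<Suc (Max K)}" if "K \<noteq> {}"
      using finK down'[OF Max_in[OF finK that]] by (auto simp: less_Suc_eq_le)
    moreover have "0 \<in> K" using a by (auto simp: K_def)
    ultimately show ?thesis by (metis card_lessThan emptyE)
  qed
  have A: "A = (\<lambda>k. a - of_nat k * d) ` K"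
  proof -
    have "x \<in> (\<lambda>k. a - of_nat k * d) ` K" if "x \<in> A" for x
    proof -
      obtain k where "k < CARD('p)" "(a - x) / d = of_nat k" using exists_of_nat_mod_ring by blast
      then have "x = a - of_nat k * d" "k < CARD('p)" using d by (auto simp: field_simps)
      then show ?thesis using that by (auto simp: K_def)
    qed
    then show ?thesis by (auto simp: K_def)
  qed
  have inj: "inj_on (\<lambda>k. a - of_nat k * d) K"
    using d of_nat_mod_ring_eq_iff by (auto simp: inj_on_def K_def)
  have card: "card A = card K" using A inj card_image by metis
  define n where "n = card A"
  have "A = (\<lambda>k. a - of_nat k * d) ` {..<n}" using A K card n_def by simp
  \<comment> \<open>The chain is read from its far end \<open>a - (n - 1) d\<close>, because
    \<open>progression\<close> runs in direction \<open>+ d\<close>.\<close>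
  also have "\<dots> = (\<lambda>k. (a - of_nat (n - 1) * d) + of_nat k * d) ` {..<n}"
  proof -
    have "a - of_nat k * d = (a - of_nat (n - 1) * d) + of_nat (n - 1 - k) * d" if "k < n" for k
      using that by (simp add: of_nat_diff algebra_simps)
    moreover have "(\<lambda>k. n - 1 - k) ` {..<n} = {..<n}"
    proof (intro equalityI subsetI)
      fix x assume "x \<in> {..<n}"
      then show "x \<in> (\<lambda>k. n - 1 - k) ` {..<n}" by (intro image_eqI[of _ _ "n - 1 - x"]) auto
    qed auto
    ultimately show ?thesis by (smt (verit) image_cong image_image lessThan_iff)
  qed
  finally show ?thesis using d by (auto simp: progression_def n_def)
qed

text \<open>Some point of \<open>A\<close> leaves \<open>A\<close> under translation by
  \<open>d\<close>, as \<open>A\<close> is not everything, and the growth bound leaves no room for a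
  second one.\<close>

lemma progression_if_small_growth:
  fixes A :: "'p::prime_card mod_ring set"
  assumes d: "d \<noteq> 0" and A: "A \<noteq> {}" "A \<noteq> UNIV" and le: "card (A \<union> (\<lambda>x. x + d) ` A) \<le> card A + 1"
  shows "progression d A"
proof -
  let ?E = "(\<lambda>x. x + d) ` A - A"
  have "card (A \<union> (\<lambda>x. x + d) ` A) = card A + card ?E"
    by (subst card_Un_disjoint[symmetric]) (auto intro: arg_cong[where f = card])
  then have E1: "card ?E \<le> 1" using le by simp
  obtain a where a: "a \<in> A" "a + d \<notin> A" using invariant_imp_UNIV[OF A(1) d] A(2) by blast
  have "x + d \<in> A" if "x \<in> A" "x \<noteq> a" for x
  proof (rule ccontr)
    assume "x + d \<notin> A"
    then have "{x + d, a + d} \<subseteq> ?E" using a that by auto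
    then have "card {x + d, a + d} \<le> 1" using E1 card_mono[of ?E] by (meson finite_code le_trans)
    then show False using that by simp
  qed
  with progression_if_one_exit[OF d a(1)] show ?thesis by blast
qed

text \<open>Vosper's theorem is stated for triples without a zero sum, a formulation that is symmetric
  in the three sets.\<close>

definition zero_free :: "'p::prime_card mod_ring set \<Rightarrow> 'p mod_ring set \<Rightarrow> 'p mod_ring set \<Rightarrow> bool" where
  "zero_free A B C \<longleftrightarrow> (\<forall>a\<in>A. \<forall>b\<in>B. \<forall>c\<in>C. a + b + c \<noteq> 0)"

lemma zero_free_sym: "zero_free A B C \<Longrightarrow> zero_free B A C" "zero_free A B C \<Longrightarrow> zero_free A C B"
  unfolding zero_free_def by (metis add.commute, metis add.assoc add.commute)

lemma zero_free_card:
  fixes A B C :: "'p::prime_card mod_ring set"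
  assumes "zero_free A B C" "A \<noteq> {}" "B \<noteq> {}" "C \<noteq> {}"
  shows "card A + card B + card C \<le> CARD('p) + 1"
proof -
  have "card A + card B + card (uminus ` C) \<le> CARD('p) + 1"
    using assms by (intro cauchy_davenport_triple) (force simp: zero_free_def)+
  then show ?thesis by (simp add: card_image)
qed

text \<open>Without its last term, \<open>C\<close> becomes a set \<open>C'\<close> with both
  \<open>C'\<close> and \<open>C' + d\<close> inside \<open>C\<close>. Shrinking \<open>C\<close> to
  \<open>C'\<close> thus allows enlarging \<open>A\<close> by its translate \<open>A + d\<close>,
  and Cauchy-Davenport grants this enlargement at most one new point.\<close>

lemma progression_transfer:
  fixes A B C :: "'p::prime_card mod_ring set"
  assumes zf: "zero_free A B C" and ne: "A \<noteq> {}" "B \<noteq> {}" and C: "progression d C" "2 \<le> card C"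
    and crit: "CARD('p) + 1 \<le> card A + card B + card C"
  shows "progression d A"
proof -
  obtain c where c: "C = (\<lambda>k. c + of_nat k * d) ` {..<card C}" and d: "d \<noteq> 0"
    using C(1) by (auto simp: progression_def)
  define C' where "C' = (\<lambda>k. c + of_nat k * d) ` {..<card C - 1}"
  have "card C' \<le> card C - 1" unfolding C'_def using card_image_le[of "{..<card C - 1}"] by simp
  have C'C: "x \<in> C" "x + d \<in> C" if "x \<in> C'" for x
  proof -
    obtain k where k: "k < card C - 1" "x = c + of_nat k * d" using \<open>x \<in> C'\<close> by (auto simp: C'_def)
    then show "x \<in> C" by (subst c) auto
    have "x + d = c + of_nat (Suc k) * d" using k by (simp add: algebra_simps)
    then show "x + d \<in> C" using k(1) by (subst c) (auto intro!: image_eqI[of _ _ "Suc k"])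
  qed
  have cC: "card C' = card C - 1"
  proof -
    have "C \<subseteq> insert (c + of_nat (card C - 1) * d) C'"
    proof
      fix x assume "x \<in> C"
      then obtain k where "k < card C" "x = c + of_nat k * d" using c by auto
      then show "x \<in> insert (c + of_nat (card C - 1) * d) C'"
        by (cases "k = card C - 1") (auto simp: C'_def)
    qed
    then have "card C \<le> card (insert (c + of_nat (card C - 1) * d) C')" by (intro card_mono) auto
    also have "\<dots> \<le> Suc (card C')" by (rule card_insert_le_m1) auto
    finally show ?thesis using \<open>card C' \<le> card C - 1\<close> C(2) by simp
  qed
  then have "C' \<noteq> {}" using C(2) by auto
  have "zero_free (A \<union> (\<lambda>x. x + d) ` A) B C'"
    unfolding zero_free_def
  proof (intro ballI)
    fix a b z assume az: "a \<in> A \<union> (\<lambda>x. x + d) ` A" "b \<in> B" "z \<in> C'"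
    show "a + b + z \<noteq> 0"
    proof (cases "a \<in> A")
      case True
      then show ?thesis using zf az C'C(1) by (auto simp: zero_free_def)
    next
      case False
      then obtain a' where "a' \<in> A" "a = a' + d" using az by auto
      then have "a' + b + (z + d) \<noteq> 0" using zf az C'C(2) by (auto simp: zero_free_def)
      then show ?thesis using \<open>a = a' + d\<close> by (simp add: algebra_simps)
    qed
  qed
  then have "card (A \<union> (\<lambda>x. x + d) ` A) + card B + card C' \<le> CARD('p) + 1"
    using ne \<open>C' \<noteq> {}\<close> by (intro zero_free_card) auto
  then have le: "card (A \<union> (\<lambda>x. x + d) ` A) \<le> card A + 1" using crit cC C(2) by simp
  have "A \<noteq> UNIV"
  proof
    assume "A = UNIV"
    obtain b z where "b \<in> B" "z \<in> C'" using ne \<open>C' \<noteq> {}\<close> by auto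
    then show False using zf C'C(1) \<open>A = UNIV\<close>
      unfolding zero_free_def by (metis UNIV_I add.assoc left_minus)
  qed
  then show ?thesis using progression_if_small_growth[OF d ne(1)] le by blast
qed

text \<open>If no Dyson transform of \<open>B\<close> has a size strictly between 1 and \<open>card B\<close>, then many of the
  transforms are singletons; two of them coincide, which makes \<open>B\<close> minus a point periodic.\<close>

lemma exists_proper_dyson_transform:
  fixes A B C :: "'p::prime_card mod_ring set"
  assumes zf: "zero_free A B C" and A: "2 \<le> card A" and B: "3 \<le> card B" and C: "2 \<le> card C"
    and crit: "CARD('p) + 1 \<le> card A + card B + card C"
  shows "\<exists>e. 2 \<le> card {x \<in> B. x + e \<in> A} \<and> card {x \<in> B. x + e \<in> A} < card B"
proof (rule ccontr)
  assume "\<not> ?thesis"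
  then have no: "card {x \<in> B. x + e \<in> A} < 2 \<or> card B \<le> card {x \<in> B. x + e \<in> A}" for e
    by (meson not_le)
  have ne: "A \<noteq> {}" "B \<noteq> {}" "C \<noteq> {}" using A B C by auto
  have tight: "card A + card B + card C = CARD('p) + 1"
    using zero_free_card[OF zf ne] crit by simp
  \<comment> \<open>\<open>D\<close> holds the shifts \<open>e\<close> whose transform of
    \<open>B\<close> is nonempty, \<open>Y\<close> those whose transform is all of \<open>B\<close>.
    By \<open>no\<close>, every shift in \<open>D - Y\<close> has a singleton transform.\<close>
  define D where "D = (\<lambda>(a, b). a - b) ` (A \<times> B)"
  define Y where "Y = {e. (\<lambda>x. x + e) ` B \<subseteq> A}"
  have D: "card A + card B \<le> card D + 1"
  proof (cases "D = UNIV")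
    case True
    then show ?thesis using tight C by simp
  next
    case False
    have "card A + card (uminus ` B) + card (- D) \<le> CARD('p) + 1"
      using ne False by (intro cauchy_davenport_triple) (force simp: D_def)+
    then show ?thesis using card_Compl_mod_ring[of D] by (simp add: card_image)
  qed
  have Y: "card Y + card B \<le> card A + 1" if "Y \<noteq> {}"
  proof -
    have "- A \<noteq> {}"
      using card_Compl_mod_ring[of A] tight B C by force
    then have "card Y + card B + card (- A) \<le> CARD('p) + 1"
      using ne that by (intro cauchy_davenport_triple) (auto simp: Y_def add.commute)
    then show ?thesis using card_Compl_mod_ring[of A] by simp
  qed
  have "Y \<subseteq> D"
  proof
    fix e assume "e \<in> Y"
    then obtain b where "b \<in> B" "b + e \<in> A" using ne(2) by (auto simp: Y_def)
    then show "e \<in> D" by (auto simp: D_def intro!: image_eqI[of _ _ "(b + e, b)"])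
  qed
  then have "card (D - Y) = card D - card Y" by (intro card_Diff_subset) auto
  \<comment> \<open>For nonempty \<open>Y\<close> the two bounds leave at least (card A + card B -
    1) - (card A + 1 - card B) = 2 card B - 2 shifts, which exceeds \<open>card B\<close> because
    \<open>card B\<close> is at least 3.\<close>
  then have many: "card B < card (D - Y)"
    using D Y A B by (cases "Y = {}") auto
  define S where "S = - (uminus ` C)"
  have cS: "card S + 1 = card A + card B"
    using card_Compl_mod_ring[of "uminus ` C"] tight by (simp add: S_def card_image)
  have inS: "a + b \<in> S" if "a \<in> A" "b \<in> B" for a b
    using zf that by (force simp: zero_free_def S_def)
  \<comment> \<open>If the transform is \<open>{b}\<close>, then \<open>A + b\<close> and
    \<open>(b + e) + (B - {b})\<close> are disjoint subsets of \<open>S\<close> whose sizes add up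
    to \<open>card S\<close>. So the latter is the complement of the former in \<open>S\<close>,
    which depends on \<open>e\<close> only through \<open>b\<close>; and there are more shifts than
    points \<open>b\<close>.\<close>
  have fibre: "\<exists>b. b \<in> B \<and> b + e \<in> A \<and> (\<lambda>x. b + e + x) ` (B - {b}) = S - (\<lambda>x. x + b) ` A"
    if e: "e \<in> D - Y" for e
  proof -
    obtain a b where ab: "a \<in> A" "b \<in> B" "e = a - b" using e by (auto simp: D_def)
    let ?B = "{x \<in> B. x + e \<in> A}"
    have "?B \<subset> B" using e by (auto simp: Y_def)
    then have "card ?B < card B" by (simp add: psubset_card_mono)
    then have "card ?B \<le> 1" using no[of e] by auto
    moreover have "b \<in> ?B" using ab by simp
    ultimately have only: "y = b" if "y \<in> ?B" for y
      using that card_le_Suc0_iff_eq[of ?B] by simp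
    have disj: "(\<lambda>x. x + b) ` A \<inter> (\<lambda>x. b + e + x) ` (B - {b}) = {}"
    proof (rule ccontr)
      assume "\<not> ?thesis"
      then obtain x y where "x \<in> A" "y \<in> B" "y \<noteq> b" "x + b = b + e + y" by blast
      moreover from this have "y + e = x" by (simp add: algebra_simps)
      ultimately show False using only[of y] by simp
    qed
    have sub: "(\<lambda>x. x + b) ` A \<union> (\<lambda>x. b + e + x) ` (B - {b}) \<subseteq> S"
      using inS ab by (auto simp: ab(3))
    have "card ((\<lambda>x. x + b) ` A \<union> (\<lambda>x. b + e + x) ` (B - {b})) = card A + (card B - 1)"
      using disj ab(2) by (subst card_Un_disjoint) (auto simp: card_image)
    then have "(\<lambda>x. x + b) ` A \<union> (\<lambda>x. b + e + x) ` (B - {b}) = S"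
      using sub cS B by (intro card_subset_eq) auto
    then show ?thesis using ab disj by (intro exI[of _ b]) auto
  qed
  then obtain \<beta> where \<beta>: "\<And>e. e \<in> D - Y \<Longrightarrow> \<beta> e \<in> B"
    "\<And>e. e \<in> D - Y \<Longrightarrow> (\<lambda>x. \<beta> e + e + x) ` (B - {\<beta> e}) = S - (\<lambda>x. x + \<beta> e) ` A"
    by metis
  have "card (\<beta> ` (D - Y)) \<le> card B" using \<beta>(1) by (intro card_mono) auto
  then have "\<not> inj_on \<beta> (D - Y)" using many card_image[of \<beta> "D - Y"] by linarith
  then obtain e e' where ee: "e \<in> D - Y" "e' \<in> D - Y" "\<beta> e = \<beta> e'" "e \<noteq> e'"
    by (auto simp: inj_on_def)
  define T where "T = B - {\<beta> e}"
  have eq: "(\<lambda>x. \<beta> e + e + x) ` T = (\<lambda>x. \<beta> e + e' + x) ` T"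
    using \<beta>(2)[OF ee(1)] \<beta>(2)[OF ee(2)] ee(3) by (simp add: T_def)
  have "t + (e - e') \<in> T" if "t \<in> T" for t
  proof -
    have "\<beta> e + e + t \<in> (\<lambda>x. \<beta> e + e' + x) ` T" using eq that by blast
    then obtain t' where "t' \<in> T" "\<beta> e + e + t = \<beta> e + e' + t'" by auto
    then have "t' = t + (e - e')" by (simp add: algebra_simps)
    then show ?thesis using \<open>t' \<in> T\<close> by simp
  qed
  moreover have "T \<noteq> {}"
  proof
    assume "T = {}"
    then have "card B \<le> card {\<beta> e}" by (intro card_mono) (auto simp: T_def)
    then show False using B by simp
  qed
  ultimately have "T = UNIV" using invariant_imp_UNIV ee(4) by (metis eq_iff_diff_eq_0)
  then show False by (auto simp: T_def)
qed

text \<open>The transform changes \<open>A\<close> and \<open>B\<close> but not \<open>C\<close>.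
  The induction hypothesis is therefore used only to make \<open>C\<close> a progression, and
  \<open>progression_transfer\<close> carries its difference back to the original \<open>A\<close>
  and \<open>B\<close>. A two-element \<open>B\<close> is a progression outright.\<close>

theorem vosper:
  fixes A B C :: "'p::prime_card mod_ring set"
  assumes "zero_free A B C" "2 \<le> card A" "2 \<le> card B" "2 \<le> card C"
    and "CARD('p) + 1 \<le> card A + card B + card C"
  shows "\<exists>d. progression d A \<and> progression d B \<and> progression d C"
  using assms
proof (induction "card B" arbitrary: A B rule: less_induct)
  case less
  have ne: "A \<noteq> {}" "B \<noteq> {}" "C \<noteq> {}" using less.prems by auto
  note zf = less.prems(1)
  show ?case
  proof (cases "card B = 2")
    case True
    then obtain b1 b2 where b: "B = {b1, b2}" "b1 \<noteq> b2" by (auto simp: card_2_iff)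
    have "{..<2::nat} = {0, 1}" by auto
    then have "B = (\<lambda>k. b1 + of_nat k * (b2 - b1)) ` {..<2}" by (simp add: b(1))
    then have d: "progression (b2 - b1) B"
      unfolding progression_def True using b(2) by (metis eq_iff_diff_eq_0)
    have "progression (b2 - b1) A" "progression (b2 - b1) C"
      using progression_transfer[OF zero_free_sym(2)[OF zf] ne(1,3) d less.prems(3)]
        progression_transfer[OF zero_free_sym(1)[OF zero_free_sym(2)[OF zf]] ne(3,1) d less.prems(3)]
        less.prems(5) by linarith+
    then show ?thesis using d by blast
  next
    case False
    then obtain e where e: "2 \<le> card {x \<in> B. x + e \<in> A}" "card {x \<in> B. x + e \<in> A} < card B"
      using exists_proper_dyson_transform[OF zf] less.prems by force
    define A1 where "A1 = A \<union> (\<lambda>x. x + e) ` B"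
    define B1 where "B1 = {x \<in> B. x + e \<in> A}"
    have "card A1 + card (A \<inter> (\<lambda>x. x + e) ` B) = card A + card ((\<lambda>x. x + e) ` B)"
      unfolding A1_def by (simp add: card_Un_Int[symmetric])
    moreover have "A \<inter> (\<lambda>x. x + e) ` B = (\<lambda>x. x + e) ` B1" by (auto simp: B1_def)
    ultimately have sum: "card A1 + card B1 = card A + card B" by (simp add: card_image)
    have "x + y + z \<noteq> 0" if "x \<in> A1" "y \<in> B1" "z \<in> C" for x y z
    proof (cases "x \<in> A")
      case True
      then show ?thesis using zf that by (auto simp: B1_def zero_free_def)
    next
      case False
      then obtain w where "w \<in> B" "x = w + e" using \<open>x \<in> A1\<close> by (auto simp: A1_def)
      moreover have "(y + e) + w + z \<noteq> 0"
        using zf that \<open>w \<in> B\<close> by (auto simp: B1_def zero_free_def)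
      ultimately show ?thesis by (simp add: algebra_simps)
    qed
    then have "zero_free A1 B1 C" by (simp add: zero_free_def)
    moreover have "card A \<le> card A1" by (intro card_mono) (auto simp: A1_def)
    ultimately obtain d where d: "progression d C"
      using less.hyps[of B1 A1] e sum less.prems by (auto simp: B1_def)
    show ?thesis
      using progression_transfer[OF zf ne(1,2) d less.prems(4,5)]
        progression_transfer[OF zero_free_sym(1)[OF zf] ne(2,1) d less.prems(4)] less.prems(5) d
      by (metis add.commute)
  qed
qed

section \<open>Sets avoiding many differences, and the dilated window\<close>

lemma even_card_symmetric:
  fixes S :: "'a::ab_group_add set"
  assumes "finite S" "\<And>s. s \<in> S \<Longrightarrow> - s \<in> S" "\<And>s. s \<in> S \<Longrightarrow> - s \<noteq> s"
  shows "even (card S)"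
  using assms
proof (induction "card S" arbitrary: S rule: less_induct)
  case less
  show ?case
  proof (cases "S = {}")
    case False
    then obtain s where s: "s \<in> S" by auto
    then have "{s, - s} \<subseteq> S" "card {s, - s} = 2" using less.prems(2,3)[of s] by auto
    then have card: "card S = card (S - {s, - s}) + 2"
      using card_mono[OF less.prems(1), of "{s, - s}"] less.prems(1) by (simp add: card_Diff_subset)
    have "even (card (S - {s, - s}))"
    proof (rule less.hyps)
      show "- t \<in> S - {s, - s}" if "t \<in> S - {s, - s}" for t
        using that less.prems(2)[of t] by (auto simp: minus_equation_iff[of t])
    qed (use card less.prems in auto)
    then show ?thesis by (simp add: card)
  qed simp
qed

lemma of_int_mod_ring_cases:
  fixes x :: "'p::prime_card mod_ring"
  obtains i :: int where "a \<le> i" "i < a + int CARD('p)" "x = of_int i"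
proof -
  obtain k where k: "k < CARD('p)" "x - of_int a = of_nat k" using exists_of_nat_mod_ring by blast
  then have "x = of_int (a + int k)" by (simp add: algebra_simps)
  then show ?thesis using that[of "a + int k"] k(1) by simp
qed

text \<open>After division by \<open>d\<close>, the differences of \<open>Y\<close> cover all
  residues from -(2m - 2) to 2m - 2. Modulo p = 6m - 1 this leaves exactly the window from 2m - 1 to
  4m.\<close>

lemma scaled_window_if_avoids_differences:
  fixes Y Z :: "'p::prime_card mod_ring set"
  assumes pm: "CARD('p) = 6 * m - 1" and m: "m \<ge> 1"
    and Y: "progression d Y" "2 * m - 1 \<le> card Y"
    and avoid: "\<And>y y'. y \<in> Y \<Longrightarrow> y' \<in> Y \<Longrightarrow> y - y' \<notin> Z"
    and z: "z \<in> Z"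
  shows "\<exists>i::int. 2 * int m - 1 \<le> i \<and> i \<le> 4 * int m \<and> z = d * of_int i"
proof -
  obtain a where a: "Y = (\<lambda>k. a + of_nat k * d) ` {..<card Y}" and d: "d \<noteq> 0"
    using Y(1) by (auto simp: progression_def)
  obtain i :: int where i: "- (2 * int m - 2) \<le> i" "i < - (2 * int m - 2) + int CARD('p)" "z / d = of_int i"
    using of_int_mod_ring_cases by blast
  have zi: "z = d * of_int i" using i(3) d by (simp add: field_simps)
  have mem: "a + of_nat k * d \<in> Y" if "k < card Y" for k
    by (subst a, rule image_eqI[of _ _ k]) (use that in simp_all)
  have "\<not> i \<le> 2 * int m - 2"
  proof
    assume le: "i \<le> 2 * int m - 2"
    \<comment> \<open>One of \<open>nat i\<close> and \<open>nat (- i)\<close> is 0, so this formula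
      serves both signs of \<open>i\<close>.\<close>
    have zz: "z = (a + of_nat (nat i) * d) - (a + of_nat (nat (- i)) * d)"
      unfolding zi by (cases "0 \<le> i") (simp_all add: mult.commute)
    have "nat i < card Y" "nat (- i) < card Y" using le i(1) Y(2) m by linarith+
    from avoid[OF mem[OF this(1)] mem[OF this(2)]] show False using z by (simp only: zz)
  qed
  moreover have "i \<le> 4 * int m" using i(2) pm m by linarith
  ultimately show ?thesis using zi by (intro exI[of _ i]) auto
qed

text \<open>In a zero sum no summand and the negative of another can both lie in \<open>Y\<close>,
  since their difference would be the negative of the third summand, a point of \<open>S\<close>.
  Every point of \<open>S\<close> except \<open>x\<close> and \<open>- x\<close> lies in
  \<open>Y\<close> together with its negative, so only \<open>x + x + x\<close> and its negative
  remain, and 3 is invertible.\<close>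

lemma zero_free_completion:
  fixes Y :: "'p::prime_card mod_ring set"
  assumes p3: "CARD('p) > 3" and x: "x \<in> Y" "- x \<notin> Y" "S = insert (- x) Y" and sym: "\<And>s. s \<in> S \<Longrightarrow> - s \<in> S"
    and avoid: "\<And>y y'. y \<in> Y \<Longrightarrow> y' \<in> Y \<Longrightarrow> y - y' \<notin> S"
  shows "zero_free S S S"
  unfolding zero_free_def
proof (intro ballI notI)
  fix a b c assume abc: "a \<in> S" "b \<in> S" "c \<in> S" "a + b + c = 0"
  have no: "\<not> (- s \<in> Y \<and> t \<in> Y)" if "s + t + r = 0" "r \<in> S" for s t r
  proof
    assume "- s \<in> Y \<and> t \<in> Y"
    then have "t - (- s) \<notin> S" using avoid by blast
    moreover have "t - (- s) = - r" using that(1) by (simp add: algebra_simps eq_neg_iff_add_eq_0)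
    ultimately show False using sym[OF that(2)] by simp
  qed
  have type: "s \<in> Y \<and> - s \<in> Y \<or> s = x \<or> s = - x" if "s \<in> S" for s
    using that sym[OF that] x by (auto simp: minus_equation_iff)
  have n: "\<not> (- a \<in> Y \<and> b \<in> Y)" "\<not> (- b \<in> Y \<and> a \<in> Y)" "\<not> (- a \<in> Y \<and> c \<in> Y)" "\<not> (- c \<in> Y \<and> a \<in> Y)"
    "\<not> (- b \<in> Y \<and> c \<in> Y)" "\<not> (- c \<in> Y \<and> b \<in> Y)"
    using no[of a b c] no[of b a c] no[of a c b] no[of c a b] no[of b c a] no[of c b a] abc
    by (simp_all add: ac_simps)
  then have "(a = x \<and> b = x \<and> c = x) \<or> (a = - x \<and> b = - x \<and> c = - x)"
    using type[OF abc(1)] type[OF abc(2)] type[OF abc(3)] x(1,2) by (metis minus_minus)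
  then have "x + x + x = 0" using abc(4) by (metis (no_types, opaque_lifting) add.inverse_inverse minus_add_distrib neg_0_equal_iff_equal add.commute)
  then have "of_nat 3 * x = 0" by (simp add: distrib_right numeral_eq_Suc)
  moreover have "(of_nat 3 :: 'p mod_ring) \<noteq> 0"
  proof
    assume "(of_nat 3 :: 'p mod_ring) = 0"
    then have "(of_int_mod_ring 3 :: 'p mod_ring) = 0" by (simp add: of_nat_of_int_mod_ring)
    then have "int CARD('p) dvd 3" by transfer auto
    then show False using p3 zdvd_imp_le[of "int CARD('p)" 3] by simp
  qed
  ultimately have "x = 0" by simp
  then show False using x by simp
qed

text \<open>If \<open>D = Y - Y\<close> has the minimal size \<open>2 card Y - 1\<close>, Vosper's
  theorem applies to \<open>Y\<close>. Otherwise \<open>D\<close> is so large that the symmetric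
  closure \<open>S\<close> of \<open>Z\<close>, which is disjoint from \<open>D\<close>, has at most
  2m + 1 points. Being symmetric without 0, it has an even number of points, hence 2m, one more than
  \<open>Y\<close>. Then \<open>S\<close> has no zero sum of three points, and Vosper's theorem
  applies to it, as 3 * 2m = p + 1.\<close>

lemma scaled_window:
  fixes Y Z :: "'p::prime_card mod_ring set"
  assumes pm: "CARD('p) = 6 * m - 1" and m: "m \<ge> 2"
    and Y: "card Y = 2 * m - 1" "Y \<subseteq> Z"
    and avoid: "\<And>y y'. y \<in> Y \<Longrightarrow> y' \<in> Y \<Longrightarrow> y - y' \<notin> Z"
    and sf: "(\<forall>y\<in>Y. \<forall>y'\<in>Y. y + y' \<notin> Y) \<or> 2 * m + 1 \<le> card Z"
  shows "\<exists>d. d \<noteq> 0 \<and> (\<forall>z\<in>Z. \<exists>i::int. 2 * int m - 1 \<le> i \<and> i \<le> 4 * int m \<and> z = d * of_int i)"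
proof -
  have p11: "CARD('p) \<ge> 11" using pm m by simp
  define D where "D = (\<lambda>(a, b). a - b) ` (Y \<times> Y)"
  define S where "S = Z \<union> uminus ` Z"
  have Y0: "Y \<noteq> {}" using Y(1) m by auto
  have symS: "- s \<in> S" if "s \<in> S" for s using that by (auto simp: S_def)
  have symD: "- s \<in> D" if "s \<in> D" for s
    using that by (auto simp: D_def intro!: image_eqI[of _ _ "(_, _)"])
  have DS: "D \<inter> S = {}"
  proof -
    have "a - b \<noteq> - z" if "a \<in> Y" "b \<in> Y" "z \<in> Z" for a b z
      using avoid[OF that(2,1)] that(3) by (metis minus_diff_eq minus_minus)
    then show ?thesis using avoid by (auto simp: S_def D_def)
  qed
  have "0 \<in> D" using Y0 by (force simp: D_def)
  then have S0: "0 \<notin> S" using DS by auto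
  have zf: "zero_free Y (uminus ` Y) (- D)"
    unfolding zero_free_def
  proof (intro ballI notI)
    fix a b c assume "a \<in> Y" "b \<in> uminus ` Y" "c \<in> - D" "a + b + c = 0"
    then obtain b' where "b' \<in> Y" "c = b' - a" by (auto simp: algebra_simps eq_neg_iff_add_eq_0)
    then show False using \<open>a \<in> Y\<close> \<open>c \<in> - D\<close> by (auto simp: D_def)
  qed
  have "S \<subseteq> - D" using DS by auto
  then have SD: "card S \<le> card (- D)" by (intro card_mono) auto
  have "card Z \<le> card S" "card Y \<le> card Z" using Y(2) by (auto simp: S_def intro!: card_mono)
  show ?thesis
  proof (cases "CARD('p) + 1 \<le> card Y + card (uminus ` Y) + card (- D)")
    case True
    have "2 \<le> card Y" using Y(1) m by linarith
    with True obtain d where d: "progression d Y"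
      using vosper[OF zf] SD \<open>card Z \<le> card S\<close> \<open>card Y \<le> card Z\<close> by (auto simp: card_image)
    then show ?thesis
      using scaled_window_if_avoids_differences[OF pm _ d _ avoid] m Y(1)
      by (auto simp: progression_def)
  next
    case False
    then have "card S \<le> 2 * m + 1" using SD Y(1) pm m by (auto simp: card_image)
    moreover have "even (card S)"
    proof (rule even_card_symmetric)
      show "- s \<noteq> s" if "s \<in> S" for s
      proof
        assume "- s = s"
        then have "2 * s = 0" by (metis add.right_inverse mult_2)
        moreover have "(2 :: 'p mod_ring) \<noteq> 0"
          using of_nat_mod_ring_eq_iff[where 'p = 'p, of 2 0] p11 by simp
        ultimately show False using that S0 by simp
      qed
    qed (use symS in auto)
    ultimately have S2m: "card S \<le> 2 * m" by (auto elim: evenE)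
    have YS: "Y \<subseteq> S" using Y(2) by (auto simp: S_def)
    have oddY: "odd (card Y)" using Y(1) m by simp
    then have "card Y \<noteq> card S" using \<open>even (card S)\<close> by metis
    then have cS: "card S = 2 * m" using card_mono[OF _ YS] S2m Y(1) by auto
    have "card (S - Y) = 1" using card_Diff_subset[OF _ YS] cS Y(1) m by simp
    then obtain s where s: "S - Y = {s}" by (auto simp: card_1_singleton_iff)
    \<comment> \<open>Otherwise \<open>- s = s\<close>, and \<open>Y\<close>, which is
      \<open>S\<close> without \<open>s\<close>, would be symmetric in spite of its odd
      size.\<close>
    have "- s \<in> Y"
    proof (rule ccontr)
      assume "- s \<notin> Y"
      moreover have "- s \<in> S" using s symS by blast
      ultimately have "- s = s" using s by blast
      then have "- y \<in> Y" if "y \<in> Y" for y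
        using that symS[of y] YS s by (metis DiffD2 DiffI equation_minus_iff singletonI singletonD subsetD)
      then have "even (card Y)"
      proof (intro even_card_symmetric)
        fix y assume "y \<in> Y"
        show "- y \<noteq> y"
        proof
          assume "- y = y"
          then have "2 * y = 0" by (metis add.right_inverse mult_2)
          moreover have "(2 :: 'p mod_ring) \<noteq> 0"
            using of_nat_mod_ring_eq_iff[where 'p = 'p, of 2 0] p11 by simp
          ultimately show False using \<open>y \<in> Y\<close> S0 YS by auto
        qed
      qed auto
      then show False using oddY by simp
    qed
    have "S = insert (- (- s)) Y" using s YS by auto
    moreover have "- (- s) \<notin> Y" using s by auto
    moreover have "y - y' \<notin> S" if "y \<in> Y" "y' \<in> Y" for y y'
      using DS that by (auto simp: D_def)
    ultimately have zfS: "zero_free S S S"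
      using zero_free_completion[of "- s" Y S] \<open>- s \<in> Y\<close> symS p11 by auto
    have "2 \<le> card S" using cS m by linarith
    with zfS obtain d where d: "progression d S"
      using vosper[OF zfS] cS pm m by auto
    \<comment> \<open>In a symmetric set without zero sums, \<open>(y - y') + (- y) + y' = 0\<close>
      rules out the difference.\<close>
    have "y - y' \<notin> S" if "y \<in> S" "y' \<in> S" for y y'
    proof
      assume "y - y' \<in> S"
      then have "(y - y') + (- y) + y' \<noteq> 0" using zfS symS that unfolding zero_free_def by blast
      then show False by simp
    qed
    then have "\<forall>z\<in>S. \<exists>i::int. 2 * int m - 1 \<le> i \<and> i \<le> 4 * int m \<and> z = d * of_int i"
      using scaled_window_if_avoids_differences[OF pm _ d, of S] m cS by simp
    then show ?thesis using d by (auto simp: progression_def S_def)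
  qed
qed

section \<open>Profiles of slice sizes\<close>

text \<open>The alternatives of \<open>relative_sizes_missing_sum\<close>: in the second,
  \<open>k\<close> counts the cosets of a subgroup of index p. The values \<open>a\<close> and
  \<open>b\<close> belong to the summands, \<open>c\<close> to the missed set, so the bound is not
  symmetric.\<close>

definition kneser_bound :: "real \<Rightarrow> real \<Rightarrow> real \<Rightarrow> real \<Rightarrow> bool" where
  "kneser_bound p a b c \<longleftrightarrow> a + b + c \<le> p + 1 / p \<or> (\<exists>k::nat. a + b \<le> real k + 1 \<and> c \<le> p - real k)"

lemma kneser_boundD: "kneser_bound p a b c \<Longrightarrow> 1 \<le> p \<Longrightarrow> a + b + c \<le> p + 1"
proof -
  assume "kneser_bound p a b c" "1 \<le> p"
  moreover from \<open>1 \<le> p\<close> have "1 / p \<le> 1" by simp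
  ultimately show ?thesis unfolding kneser_bound_def by (elim disjE exE) linarith+
qed

text \<open>\<open>F x\<close> stands for the size, in units of \<open>card V / p\<close>, of the slice of a sum-free set along the
  coset with index \<open>x\<close> of a hyperplane \<open>V\<close>.\<close>

definition slice_profile :: "('p::prime_card mod_ring \<Rightarrow> real) \<Rightarrow> bool" where
  "slice_profile F \<longleftrightarrow> (\<forall>x. 0 \<le> F x \<and> F x \<le> CARD('p))
    \<and> (\<forall>x y. 0 < F x \<longrightarrow> F y + F (x + y) \<le> CARD('p))
    \<and> (\<forall>x y. 0 < F (x + y) \<longrightarrow> F x + F y \<le> CARD('p))
    \<and> (\<forall>x y. 0 < F x \<longrightarrow> 0 < F y \<longrightarrow> 0 < F (x + y) \<longrightarrow>
          kneser_bound CARD('p) (F x) (F y) (F (x + y)) \<and> kneser_bound CARD('p) (F x) (F (x + y)) (F y))"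

section \<open>Slices ordered by size\<close>

lemma descending_enumeration:
  fixes F :: "'p::prime_card mod_ring \<Rightarrow> real"
  obtains e :: "nat \<Rightarrow> 'p mod_ring" where "bij_betw e {..<CARD('p)} UNIV"
    "\<And>i j. i \<le> j \<Longrightarrow> j < CARD('p) \<Longrightarrow> F (e j) \<le> F (e i)"
proof -
  obtain xs0 where xs0: "set xs0 = (UNIV :: 'p mod_ring set)" "distinct xs0"
    using finite_distinct_list[of "UNIV :: 'p mod_ring set"] by auto
  define xs where "xs = sort_key (\<lambda>x. - F x) xs0"
  have xs: "set xs = UNIV" "distinct xs" "sorted (map (\<lambda>x. - F x) xs)"
    using xs0 by (simp_all add: xs_def)
  have len: "length xs = CARD('p)" using distinct_card[OF xs(2)] xs(1) by simp
  show thesis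
  proof (rule that[of "\<lambda>i. xs ! i"])
    show "bij_betw (\<lambda>i. xs ! i) {..<CARD('p)} UNIV"
      using bij_betw_nth[OF xs(2)] len xs(1) by simp
    show "F (xs ! j) \<le> F (xs ! i)" if "i \<le> j" "j < CARD('p)" for i j
      using sorted_nth_mono[OF xs(3) that(1)] that len by simp
  qed
qed

lemma sum_reflect_le:
  fixes g :: "nat \<Rightarrow> real"
  assumes "\<And>i. a \<le> i \<Longrightarrow> i < b \<Longrightarrow> g i + g (a + b - 1 - i) \<le> c"
  shows "2 * (\<Sum>i\<in>{a..<b}. g i) \<le> real (b - a) * c"
proof -
  have "(\<Sum>i\<in>{a..<b}. g (a + b - 1 - i)) = (\<Sum>i\<in>{a..<b}. g i)"
    by (rule sum.reindex_bij_witness[of _ "\<lambda>i. a + b - 1 - i" "\<lambda>i. a + b - 1 - i"]) auto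
  then have "2 * (\<Sum>i\<in>{a..<b}. g i) = (\<Sum>i\<in>{a..<b}. g i + g (a + b - 1 - i))"
    by (simp add: sum.distrib)
  also have "\<dots> \<le> (\<Sum>i\<in>{a..<b}. c)" using assms by (intro sum_mono) auto
  finally show ?thesis by simp
qed

text \<open>With \<open>e\<close> listing the residues by decreasing \<open>F\<close>, the Cauchy-Davenport theorem turns the
  constraints on additive triples into constraints on ranks.\<close>

locale ranked_profile =
  fixes F :: "'p::prime_card mod_ring \<Rightarrow> real" and e :: "nat \<Rightarrow> 'p mod_ring" and m :: nat
  assumes profile: "slice_profile F" and bij: "bij_betw e {..<CARD('p)} UNIV"
    and anti: "\<And>i j. i \<le> j \<Longrightarrow> j < CARD('p) \<Longrightarrow> F (e j) \<le> F (e i)"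
    and pm: "CARD('p) = 6 * m - 1" and m2: "m \<ge> 2"
    and total: "real ((2 * m - 1) * CARD('p)) \<le> (\<Sum>x\<in>UNIV. F x)"
begin

abbreviation "b \<equiv> card {x. F x > 0}"

lemma nonneg: "0 \<le> F x" and le_p: "F x \<le> CARD('p)"
  using profile by (auto simp: slice_profile_def)

lemma pos_iff: assumes "i < CARD('p)" shows "F (e i) > 0 \<longleftrightarrow> i < b"
proof -
  define I where "I = {i. i < CARD('p) \<and> F (e i) > 0}"
  have fin: "finite I" by (simp add: I_def)
  have down: "j \<in> I" if "i \<in> I" "j \<le> i" for i j
    using anti[OF that(2)] that by (auto simp: I_def)
  have "I = {..<card I}"
  proof (cases "I = {}")
    case False
    have "I = {..<Suc (Max I)}"
    proof (intro equalityI subsetI)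
      fix x assume "x \<in> I"
      then show "x \<in> {..<Suc (Max I)}" using Max_ge[OF fin] by (simp add: less_Suc_eq_le)
    next
      fix x assume "x \<in> {..<Suc (Max I)}"
      then show "x \<in> I" using down[OF Max_in[OF fin False], of x] by simp
    qed
    then have "card I = Suc (Max I)" using card_lessThan[of "Suc (Max I)"] by simp
    then show ?thesis using \<open>I = {..<Suc (Max I)}\<close> by simp
  qed simp
  moreover have "card I = b"
  proof (rule bij_betw_same_card[of e])
    have "x \<in> e ` I" if "F x > 0" for x
    proof -
      have "x \<in> e ` {..<CARD('p)}" using bij by (simp add: bij_betw_def)
      then show ?thesis using that by (auto simp: I_def)
    qed
    then have "e ` I = {x. F x > 0}" by (auto simp: I_def)
    moreover have "I \<subseteq> {..<CARD('p)}" by (auto simp: I_def)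
    ultimately show "bij_betw e I {x. F x > 0}" by (intro bij_betw_subset[OF bij])
  qed
  ultimately show ?thesis using assms by (auto simp: I_def)
qed

lemma b_le: "b \<le> CARD('p)"
  using card_mono[of UNIV "{x. F x > 0}"] by simp

lemma sum_eq: "(\<Sum>x\<in>UNIV. F x) = (\<Sum>i\<in>{0..<b}. F (e i))"
proof -
  have "(\<Sum>x\<in>UNIV. F x) = (\<Sum>i\<in>{..<CARD('p)}. F (e i))"
    using sum.reindex_bij_betw[OF bij, of F] by simp
  also have "\<dots> = (\<Sum>i\<in>{0..<b}. F (e i))"
  proof (intro sum.mono_neutral_right ballI)
    fix i assume "i \<in> {..<CARD('p)} - {0..<b}"
    then have "\<not> F (e i) > 0" using pos_iff[of i] by simp
    then show "F (e i) = 0" using nonneg[of "e i"] by linarith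
  qed (use b_le in auto)
  finally show ?thesis .
qed

lemma rank_triple:
  assumes "i < CARD('p)" "j < CARD('p)" "l < CARD('p)" "CARD('p) \<le> i + j + l + 1"
  obtains x y where "F (e i) \<le> F x" "F (e j) \<le> F y" "F (e l) \<le> F (x + y)"
proof -
  have inj: "inj_on e {..k}" if "k < CARD('p)" for k
    using bij that by (auto simp: bij_betw_def intro: inj_on_subset)
  have card: "card (e ` {..k}) = k + 1" if "k < CARD('p)" for k
    using card_image[OF inj[OF that]] by simp
  have "CARD('p) + 1 < card (e ` {..i}) + card (e ` {..j}) + card (e ` {..l})"
    using assms by (simp add: card)
  then obtain x y where "x \<in> e ` {..i}" "y \<in> e ` {..j}" "x + y \<in> e ` {..l}"
    using cauchy_davenport[of "e ` {..i}" "e ` {..j}" "e ` {..l}"] by auto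
  then show thesis using that anti assms(1-3) by (metis (no_types, lifting) atMost_iff imageE)
qed

text \<open>\<open>b - 1\<close> is the last rank with a positive value; using it for the sum
  ensures \<open>F (x + y) > 0\<close>.\<close>

lemma rank_pair:
  assumes "i < CARD('p)" "j < CARD('p)" "CARD('p) \<le> i + j + b" "0 < b"
  shows "F (e i) + F (e j) \<le> CARD('p)"
proof -
  have lt: "b - 1 < CARD('p)" "CARD('p) \<le> i + j + (b - 1) + 1" using assms b_le by linarith+
  from rank_triple[OF assms(1,2) this] obtain x y
    where xy: "F (e i) \<le> F x" "F (e j) \<le> F y" "F (e (b - 1)) \<le> F (x + y)" .
  have "F (e (b - 1)) > 0" using pos_iff[OF lt(1)] assms(4) by simp
  then have "F (x + y) > 0" using xy(3) by linarith
  then have "F x + F y \<le> CARD('p)" using profile by (simp add: slice_profile_def)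
  then show ?thesis using xy by simp
qed

lemma rank_pair_top:
  assumes "i < b" "j < b" "CARD('p) \<le> i + j + 1"
  shows "F (e 0) + F (e i) + F (e j) \<le> CARD('p) + 1"
proof -
  have p: "0 < CARD('p)" "i < CARD('p)" "j < CARD('p)" using assms b_le by auto
  obtain x y where xy: "F (e 0) \<le> F x" "F (e i) \<le> F y" "F (e j) \<le> F (x + y)"
    using rank_triple[of 0 i j] p assms(3) by auto
  have "0 < F (e 0)" "0 < F (e i)" "0 < F (e j)" using pos_iff p assms by auto
  then have "kneser_bound CARD('p) (F x) (F y) (F (x + y))"
    using profile xy by (auto simp: slice_profile_def)
  then show ?thesis using kneser_boundD p(1) xy by fastforce
qed

text \<open>With q = p - b, two values whose ranks add up to q sum to at most p, and two values
  whose ranks lie below b and add up to p - 1 = q + b - 1 sum to at most p + 1 -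
  \<open>F (e 0)\<close>. Reflecting suitable blocks of ranks then bounds the total from above,
  against \<open>total\<close>. The case q = 0 needs exactly the threshold 2m + 2.\<close>

lemma small_support:
  assumes big: "F (e 0) > real (2 * m + 2)"
  shows "b \<le> 2 * m + 2"
proof (rule ccontr)
  assume "\<not> b \<le> 2 * m + 2"
  then have b: "b \<ge> 2 * m + 3" by simp
  define S where "S = (\<Sum>i\<in>{0..<b}. F (e i))"
  define q where "q = CARD('p) - b"
  have rp: "real CARD('p) = 6 * real m - 1" using pm m2 by simp
  have S: "(2 * real m - 1) * real CARD('p) \<le> S"
    using total m2 by (simp add: sum_eq S_def of_nat_diff)
  have qb: "q + b = CARD('p)" using b_le by (simp add: q_def)
  show False
  proof (cases "b \<le> 3 * m")
    case True
    have "S \<le> (\<Sum>i\<in>{0..<q + 1}. F (e i))"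
      unfolding S_def using nonneg True qb pm m2 by (intro sum_mono2) auto
    moreover have "2 * (\<Sum>i\<in>{0..<q + 1}. F (e i)) \<le> real (q + 1 - 0) * real CARD('p)"
      using qb b by (intro sum_reflect_le rank_pair) auto
    ultimately have "2 * S \<le> real (q + 1 - 0) * real CARD('p)" by linarith
    also have "\<dots> \<le> (4 * real m - 3) * real CARD('p)"
    proof (rule mult_right_mono)
      have "q + 4 \<le> 4 * m" using qb b pm m2 by simp
      then show "real (q + 1 - 0) \<le> 4 * real m - 3" by simp
    qed simp
    finally have "2 * ((2 * real m - 1) * real CARD('p)) \<le> (4 * real m - 3) * real CARD('p)"
      using S by linarith
    then have "real CARD('p) \<le> 0" by (simp add: algebra_simps)
    then show False using rp m2 by simp
  next
    case False
    have qb': "q < b" using False qb pm m2 by simp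
    have split: "S = (\<Sum>i\<in>{0..<q}. F (e i)) + (\<Sum>i\<in>{q..<b}. F (e i))"
      unfolding S_def using qb' by (simp add: sum.atLeastLessThan_concat)
    have hi: "2 * (\<Sum>i\<in>{q..<b}. F (e i)) \<le> real (b - q) * (real CARD('p) + 1 - F (e 0))"
    proof (rule sum_reflect_le)
      fix i assume i: "q \<le> i" "i < b"
      have "F (e 0) + F (e i) + F (e (q + b - 1 - i)) \<le> CARD('p) + 1"
        using i qb by (intro rank_pair_top) auto
      then show "F (e i) + F (e (q + b - 1 - i)) \<le> real CARD('p) + 1 - F (e 0)" by simp
    qed
    have bq: "real (b - q) = real CARD('p) - 2 * real q" using qb qb' by (simp add: of_nat_diff)
    define y where "y = F (e 0) - (2 * real m + 2)"
    have y: "y > 0" using big by (simp add: y_def)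
    show False
    proof (cases "q = 0")
      case True
      then have "2 * S \<le> real CARD('p) * (real CARD('p) + 1 - F (e 0))"
        using split hi bq by simp
      then have "2 * ((2 * real m - 1) * real CARD('p)) \<le> real CARD('p) * (real CARD('p) + 1 - F (e 0))"
        using S by linarith
      then have "real CARD('p) * (2 * (2 * real m - 1)) \<le> real CARD('p) * (real CARD('p) + 1 - F (e 0))"
        by (simp add: algebra_simps)
      then have "2 * (2 * real m - 1) \<le> real CARD('p) + 1 - F (e 0)"
        using rp m2 by (subst (asm) mult_le_cancel_left_pos) auto
      then show False using rp big by simp
    next
      case False
      have "(\<Sum>i\<in>{0..<q}. F (e i)) = F (e 0) + (\<Sum>i\<in>{1..<q}. F (e i))"
        using False by (simp add: sum.atLeast_Suc_lessThan)
      moreover have "2 * (\<Sum>i\<in>{1..<q}. F (e i)) \<le> real (q - 1) * real CARD('p)"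
        using qb b by (intro sum_reflect_le rank_pair) auto
      ultimately have "2 * S \<le> 2 * F (e 0) + (real q - 1) * real CARD('p)
          + (real CARD('p) - 2 * real q) * (real CARD('p) + 1 - F (e 0))"
        using split hi bq False by (simp add: of_nat_diff)
      then have "2 * ((2 * real m - 1) * (6 * real m - 1)) \<le> 2 * (y + 2 * real m + 2) + (real q - 1) * (6 * real m - 1)
          + (6 * real m - 1 - 2 * real q) * (4 * real m - 2 - y)"
        using S rp by (simp add: y_def)
      \<comment> \<open>Here q is at most 3m - 2, so the coefficient of \<open>y\<close> is
        negative, and q is at least 1, so the rest is at most (5 - 2m) + (3 - 2m), which is not
        positive.\<close>
      then have "0 \<le> y * (2 * real q + 3 - 6 * real m) + (5 - 2 * real m) + real q * (3 - 2 * real m)"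
        by (simp add: algebra_simps)
      moreover have "y * (2 * real q + 3 - 6 * real m) < 0"
        using y qb' qb pm m2 \<open>\<not> b \<le> 3 * m\<close> by (intro mult_pos_neg) auto
      moreover have "real q * (3 - 2 * real m) \<le> 1 * (3 - 2 * real m)"
        using False m2 by (intro mult_right_mono_neg) auto
      moreover have False
        if "0 \<le> u + (5 - 2 * real m) + v" "u < 0" "v \<le> 1 * (3 - 2 * real m)" for u v :: real
        using that m2 by simp
      ultimately show False by blast
    qed
  qed
qed

text \<open>\<open>Y\<close> consists of the 2m - 1 residues of largest value. If the values at
  \<open>y\<close> and \<open>y'\<close> sum to more than p, then \<open>F (y - y')\<close> must
  vanish. So the support avoids the differences of \<open>Y\<close> as soon as any two distinct
  points of \<open>Y\<close> have values summing to more than p and the largest value exceeds p/2,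
  which excludes the difference 0.\<close>

lemma support_in_scaled_window:
  assumes b: "b \<le> 2 * m + 2" and half: "\<And>x. F x \<noteq> CARD('p) / 2"
  shows "\<exists>d. d \<noteq> 0 \<and> (\<forall>x. 0 < F x \<longrightarrow> (\<exists>i::int. 2 * int m - 1 \<le> i \<and> i \<le> 4 * int m \<and> x = d * of_int i))"
proof -
  \<comment> \<open>Extension by 0 beyond rank \<open>b\<close> makes 2m + 2 values available
    whatever \<open>b\<close> is.\<close>
  define g where "g i = (if i < b then F (e i) else 0)" for i
  define P where "P = real CARD('p)"
  have P: "P > 0" using pm m2 by (simp add: P_def)
  have g_le: "g i \<le> P" for i using le_p P by (auto simp: g_def P_def)
  have g_anti: "g j \<le> g i" if "i \<le> j" for i j
    using that anti[OF that] b_le nonneg by (auto simp: g_def)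
  have g0: "0 \<le> g i" for i using nonneg by (simp add: g_def)
  have S: "(2 * real m - 1) * P \<le> sum g {0..<2 * m + 2}"
  proof -
    have "(\<Sum>i\<in>{0..<b}. F (e i)) = (\<Sum>i\<in>{0..<2 * m + 2}. g i)"
      using b by (intro sum.mono_neutral_cong_left) (auto simp: g_def)
    then show ?thesis using total m2 by (simp add: sum_eq P_def of_nat_diff)
  qed
  obtain n where n: "m = n + 2" using m2 by (metis add.commute le_iff_add)
  have split: "sum g {0..<2 * m + 2} = sum g {0..<2 * n} + g (2 * n) + g (2 * n + 1) + g (2 * n + 2)
      + g (2 * n + 3) + g (2 * n + 4) + g (2 * n + 5)"
    by (simp add: n numeral_eq_Suc)
  have "sum g {0..<2 * n} \<le> (\<Sum>i\<in>{0..<2 * n}. P)" using g_le by (intro sum_mono) auto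
  then have head: "sum g {0..<2 * n} \<le> 2 * real n * P" by simp
  have rpn: "P = 6 * real n + 11" using pm by (simp add: P_def n)
  have tail: "(2 * real n + 3) * P \<le> 2 * real n * P + g (2 * n) + g (2 * n + 1) + g (2 * n + 2)
      + g (2 * n + 3) + g (2 * n + 4) + g (2 * n + 5)"
  proof -
    have "2 * real m - 1 = 2 * real n + 3" by (simp add: n)
    then have "(2 * real n + 3) * P \<le> sum g {0..<2 * m + 2}" using S by (simp only:)
    then show ?thesis using split head by linarith
  qed
  \<comment> \<open>The 2n = 2m - 4 largest values are at most p each, so the next six sum to at
    least 3p.\<close>
  then have tail': "3 * P \<le> g (2 * n) + g (2 * n + 1) + g (2 * n + 2)
      + g (2 * n + 3) + g (2 * n + 4) + g (2 * n + 5)" by (simp add: distrib_right)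
  have b_gt: "2 * n + 2 < b"
  proof (rule ccontr)
    assume "\<not> 2 * n + 2 < b"
    then have "g (2 * n + 2) = 0" "g (2 * n + 3) = 0" "g (2 * n + 4) = 0" "g (2 * n + 5) = 0" by (auto simp: g_def)
    then show False using tail' g_le[of "2 * n"] g_le[of "2 * n + 1"] P by linarith
  qed
  have pair: "g i + g j \<le> P" if "CARD('p) \<le> i + j + b" for i j
    using rank_pair[of i j] that b_gt b_le le_p nonneg P by (auto simp: g_def P_def)
  \<comment> \<open>If the value at rank 2n + 2 = 2m - 2 is not above p/2, it is strictly below by
    \<open>half\<close>. For \<open>b\<close> at most 2m the six values then sum to less than 3p,
    and so they do for \<open>b = 2m + 2\<close>, where ranks 2n, 2n + 5 and 2n + 1, 2n + 4 pair to
    at most p. Only \<open>b = 2m + 1\<close> survives.\<close>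
  have top: "g (2 * n + 2) > P / 2 \<or>
      b = 2 * m + 1 \<and> g (2 * n + 2) < P / 2 \<and> 2 * P \<le> g (2 * n + 1) + g (2 * n + 2) + g (2 * n + 3) + g (2 * n + 4)"
  proof (rule ccontr)
    assume contra: "\<not> ?thesis"
    have "g (2 * n + 2) \<noteq> P / 2" using half P by (auto simp: g_def P_def)
    then have lt: "g (2 * n + 2) < P / 2" using contra by linarith
    then have lt': "g (2 * n + 3) < P / 2" "g (2 * n + 4) < P / 2"
      using g_anti[of "2 * n + 2" "2 * n + 3"] g_anti[of "2 * n + 2" "2 * n + 4"] by auto
    consider "b \<le> 2 * m" | "b = 2 * m + 1" | "b = 2 * m + 2" using b by linarith
    then show False
    proof cases
      case 1
      then have "g (2 * n + 4) = 0" "g (2 * n + 5) = 0" by (auto simp: g_def n)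
      then show False using tail' g_le[of "2 * n"] g_le[of "2 * n + 1"] lt lt' by linarith
    next
      case 2
      then have "g (2 * n + 5) = 0" by (auto simp: g_def n)
      then show False using tail' g_le[of "2 * n"] contra lt 2 by linarith
    next
      case 3
      then have "g (2 * n) + g (2 * n + 5) \<le> P" "g (2 * n + 1) + g (2 * n + 4) \<le> P"
        using pair[of "2 * n" "2 * n + 5"] pair[of "2 * n + 1" "2 * n + 4"] pm n by auto
      then show False using tail' lt lt' by linarith
    qed
  qed
  define Y where "Y = e ` {..<2 * m - 1}"
  have m1: "2 * m - 1 = 2 * n + 3" by (simp add: n)
  have Y': "Y = e ` {..<2 * n + 3}" unfolding Y_def m1 ..
  have inj: "inj_on e {..<CARD('p)}" using bij by (simp add: bij_betw_def)
  have cY: "card Y = 2 * m - 1"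
  proof -
    have "inj_on e {..<2 * m - 1}" using inj by (rule inj_on_subset) (use pm in auto)
    then show ?thesis by (simp add: Y_def card_image)
  qed
  have eg: "F (e i) = g i" if "i < 2 * n + 3" for i using that b_gt by (simp add: g_def)
  have Ypos: "Y \<subseteq> {x. 0 < F x}"
    unfolding Y_def m1 using pos_iff b_gt b_le by auto
  have K1: "F y + F (x + y) \<le> P" if "0 < F x" for x y
    using profile that by (simp_all add: slice_profile_def P_def)
  have avoid: "y - y' \<notin> {x. 0 < F x}" if y: "y \<in> Y" "y' \<in> Y" for y y'
  proof
    assume "y - y' \<in> {x. 0 < F x}"
    then have F0: "0 < F (y - y')" by simp
    have "F y' + F (y - y' + y') \<le> P" by (rule K1[OF F0])
    then have le: "F y' + F y \<le> P" by simp
    obtain i j where ij: "i < 2 * n + 3" "y = e i" "j < 2 * n + 3" "y' = e j"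
      using y unfolding Y' by blast
    have ge: "g (2 * n + 2) \<le> g i" "g (2 * n + 2) \<le> g j" using ij g_anti by auto
    have le': "g j + g i \<le> P" using le ij eg by simp
    from top show False
    proof
      assume "g (2 * n + 2) > P / 2"
      then show False using ge le' by linarith
    next
      assume t: "b = 2 * m + 1 \<and> g (2 * n + 2) < P / 2 \<and> 2 * P \<le> g (2 * n + 1) + g (2 * n + 2) + g (2 * n + 3) + g (2 * n + 4)"
      then have lt': "g (2 * n + 3) < P / 2" "g (2 * n + 4) < P / 2"
        using g_anti[of "2 * n + 2" "2 * n + 3"] g_anti[of "2 * n + 2" "2 * n + 4"] by auto
      show False
      \<comment> \<open>The ranks 2n + 3 and 2n + 4 together carry less than p, so ranks 2n + 1 and
        2n + 2 carry more than p, and so do any two distinct ranks up to 2n + 2. Equal ranks would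
        mean \<open>F 0 > 0\<close>, hence \<open>2 F (e 0)\<close> at most p.\<close>
      proof (cases "i = j")
        case True
        then have "0 < F 0" using F0 ij by simp
        then have "F (e 0) + F (e 0) \<le> P" using profile by (auto simp: slice_profile_def P_def dest: spec[of _ 0])
        moreover have "g (2 * n + 1) \<le> g 0" by (rule g_anti) simp
        ultimately show False using t lt' eg[of 0] by auto
      next
        case False
        then have "i \<le> 2 * n + 1 \<or> j \<le> 2 * n + 1" using ij by linarith
        then have "g (2 * n + 1) \<le> g i \<or> g (2 * n + 1) \<le> g j" using g_anti by blast
        then show False using ge le' t lt' by linarith
      qed
    qed
  qed
  have sf: "(\<forall>y\<in>Y. \<forall>y'\<in>Y. y + y' \<notin> Y) \<or> 2 * m + 1 \<le> b"
  proof (cases "g (2 * n + 2) > P / 2")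
    case True
    have "y + y' \<notin> Y" if y: "y \<in> Y" "y' \<in> Y" for y y'
    proof
      assume "y + y' \<in> Y"
      then have "0 < F (y + y')" using Ypos by auto
      then have le: "F y + F y' \<le> P" using profile by (simp add: slice_profile_def P_def)
      obtain i j where ij: "i < 2 * n + 3" "y = e i" "j < 2 * n + 3" "y' = e j"
        using y unfolding Y' by blast
      have "g (2 * n + 2) \<le> g i" "g (2 * n + 2) \<le> g j" using ij g_anti by auto
      then show False using le ij eg True by simp
    qed
    then show ?thesis by blast
  qed (use top in auto)
  show ?thesis
    using scaled_window[OF pm m2 cY Ypos avoid sf] by auto
qed

end

lemma profile_window:
  fixes F :: "'p::prime_card mod_ring \<Rightarrow> real"
  assumes "slice_profile F" "CARD('p) = 6 * m - 1" "m \<ge> 2"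
    and "real ((2 * m - 1) * CARD('p)) \<le> (\<Sum>x\<in>UNIV. F x)"
    and big: "\<exists>x. F x > real (2 * m + 2)" and half: "\<And>x. F x \<noteq> CARD('p) / 2"
  shows "\<exists>d. d \<noteq> 0 \<and> (\<forall>x. 0 < F x \<longrightarrow> (\<exists>i::int. 2 * int m - 1 \<le> i \<and> i \<le> 4 * int m \<and> x = d * of_int i))"
proof -
  obtain e :: "nat \<Rightarrow> 'p mod_ring" where e: "bij_betw e {..<CARD('p)} UNIV"
    "\<And>i j. i \<le> j \<Longrightarrow> j < CARD('p) \<Longrightarrow> F (e j) \<le> F (e i)"
    by (rule descending_enumeration[of F]) (rule that)
  interpret ranked_profile F e m using assms(1-4) e by unfold_locales auto
  obtain x where x: "F x > real (2 * m + 2)" using big by blast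
  obtain i where i: "i < CARD('p)" "x = e i" using e(1) by (auto simp: bij_betw_def)
  have "F (e 0) > real (2 * m + 2)" using x e(2)[of 0 i] i by simp
  from support_in_scaled_window[OF small_support[OF this] half] show ?thesis .
qed

section \<open>Fourier analysis\<close>

definition chr :: "'p::prime_card mod_ring \<Rightarrow> complex" where
  "chr x = cis (2 * pi * of_int (to_int_mod_ring x) / CARD('p))"

lemma cis_int_multiple_2pi: "cis (2 * pi * of_int k) = 1"
  by (metis cis_multiple_2pi Ints_of_int)

lemma chr_of_int: "chr (of_int k :: 'p::prime_card mod_ring) = cis (2 * pi * of_int k / CARD('p))"
proof -
  define P where "P = int CARD('p)"
  have P: "P > 0" by (simp add: P_def)
  have "to_int_mod_ring (of_int k :: 'p mod_ring) = k mod P"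
    unfolding of_int_of_int_mod_ring P_def by transfer simp
  moreover have "real_of_int k = real_of_int (k mod P) + real_of_int P * real_of_int (k div P)"
    by (metis mod_mult_div_eq of_int_add of_int_mult)
  then have "2 * pi * real_of_int k / P = 2 * pi * real_of_int (k mod P) / P + 2 * pi * real_of_int (k div P)"
    using P by (simp add: field_simps)
  ultimately show ?thesis
    by (simp add: chr_def P_def cis_mult[symmetric] cis_int_multiple_2pi)
qed

lemma chr_add: "chr (x + y) = chr x * chr y" for x y :: "'p::prime_card mod_ring"
proof -
  have "of_int (to_int_mod_ring z) = z" for z :: "'p mod_ring"
    by (simp add: of_int_of_int_mod_ring)
  then have "x + y = of_int (to_int_mod_ring x + to_int_mod_ring y)" by simp
  then show ?thesis
    by (simp only: chr_of_int) (simp add: chr_def cis_mult add_divide_distrib distrib_left)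
qed

lemma chr_0 [simp]: "chr 0 = 1"
  by (simp add: chr_def)

lemma chr_minus: "chr (- x) = cnj (chr x)" for x :: "'p::prime_card mod_ring"
proof -
  have "chr (- x) * chr x = 1" by (simp flip: chr_add)
  moreover have "cnj (chr x) * chr x = 1" by (simp add: chr_def cis_cnj cis_mult)
  moreover have "chr x \<noteq> 0" by (simp add: chr_def)
  ultimately show ?thesis by (metis mult_right_cancel)
qed

lemma Re_chr_of_nat: "Re (chr (of_nat k :: 'p::prime_card mod_ring)) = cos (2 * real k / CARD('p) * pi)"
  using chr_of_int[of "int k", where 'p = 'p] by (simp add: mult_ac)

lemma chr_1_neq_1: "chr (1 :: 'p::prime_card mod_ring) \<noteq> 1"
proof
  assume *: "chr (1 :: 'p mod_ring) = 1"
  have p2: "CARD('p) \<ge> 2" using prime_card[where 'a = 'p] by (simp add: prime_ge_2_nat)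
  have "cos (2 * pi * 1 / CARD('p)) = 1"
    using * chr_of_int[of 1, where 'p = 'p] by (metis Re_complex_of_real cis.sel(1) of_int_1 one_complex.sel(1))
  then obtain k :: int where "2 * pi * 1 / CARD('p) = of_int k * 2 * pi"
    unfolding cos_one_2pi_int by blast
  then have "1 = of_int k * real CARD('p)" by (simp add: field_simps)
  then have "1 = k * int CARD('p)" by (metis of_int_1 of_int_eq_iff of_int_mult of_int_of_nat_eq)
  then have "int CARD('p) dvd 1" by (metis dvd_triv_right)
  then show False using p2 by simp
qed

lemma sum_chr: "(\<Sum>x\<in>UNIV. chr (x :: 'p::prime_card mod_ring)) = 0"
proof -
  have "(\<Sum>x\<in>UNIV. chr (x :: 'p mod_ring)) = (\<Sum>x\<in>UNIV. chr (1 + x :: 'p mod_ring))"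
    by (rule sum.reindex_bij_witness[of _ "\<lambda>x. 1 + x" "\<lambda>x. x - 1"]) auto
  also have "\<dots> = chr (1 :: 'p mod_ring) * (\<Sum>x\<in>UNIV. chr (x :: 'p mod_ring))"
    by (simp add: chr_add sum_distrib_left)
  finally show ?thesis using chr_1_neq_1[where 'p = 'p] by simp
qed

lemma bij_betw_of_nat_mod_ring: "bij_betw of_nat {..<CARD('p)} (UNIV :: 'p::prime_card mod_ring set)"
  using exists_of_nat_mod_ring[where 'p = 'p] of_nat_mod_ring_eq_iff[where 'p = 'p]
  by (fastforce simp: bij_betw_def inj_on_def)

lemma of_nat_mod_CARD: "(of_nat (k mod CARD('p)) :: 'p::prime_card mod_ring) = of_nat k"
  unfolding of_nat_of_int_mod_ring comp_def by transfer (simp add: zmod_int)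

text \<open>\<open>slice_profile\<close> yields the Kneser bound only where all three values are
  positive. For a flat profile it extends to all triples: the second alternative holds with
  \<open>k = p\<close> if \<open>c = 0\<close>, and with \<open>k = u - 1\<close> if
  \<open>a\<close> or \<open>b\<close> is 0.\<close>

lemma kneser_bound_if_le:
  assumes "0 \<le> a" "0 \<le> b" "0 \<le> c" "a \<le> real u" "b \<le> real u" "c \<le> real u"
    and u: "1 \<le> u" "2 * u \<le> p + 1"
    and pos: "0 < a \<Longrightarrow> 0 < b \<Longrightarrow> 0 < c \<Longrightarrow> kneser_bound (real p) a b c"
  shows "kneser_bound (real p) a b c"
proof -
  have u': "2 * real u \<le> real p + 1" using u(2) by linarith
  consider "0 < a \<and> 0 < b \<and> 0 < c" | "c = 0" | "a = 0 \<or> b = 0" using assms(1-3) by linarith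
  then show ?thesis
  proof cases
    case 2
    then have "a + b \<le> real p + 1 \<and> c \<le> real p - real p" using assms(4,5) u' by linarith
    then show ?thesis unfolding kneser_bound_def by blast
  next
    case 3
    moreover have "real (u - 1) = real u - 1" using u(1) by (simp add: of_nat_diff)
    ultimately have "a + b \<le> real (u - 1) + 1 \<and> c \<le> real p - real (u - 1)"
      using assms(4-6) u' by linarith
    then show ?thesis unfolding kneser_bound_def by blast
  qed (use pos in blast)
qed

text \<open>For \<open>m \<ge> 4\<close> the bound \<open>cos \<le> 1\<close>, applied to \<open>2m + 2 - F\<close>, suffices; \<open>p = 11\<close> and \<open>p = 17\<close>
  also need the Kneser bounds.\<close>

lemma profile_not_flat:
  fixes F :: "'p::prime_card mod_ring \<Rightarrow> real"
  assumes F: "slice_profile F" and pm: "CARD('p) = 6 * m - 1" and m: "m \<ge> 2"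
    and tot: "(\<Sum>x\<in>UNIV. F x) = real ((2 * m - 1) * CARD('p))"
    and corr: "(\<Sum>x\<in>UNIV. F x * Re (chr x)) \<le> - (CARD('p) * (2 * real m - 1)\<^sup>2 / (4 * real m))"
  shows "\<exists>x. F x > real (2 * m + 2)"
proof (rule ccontr)
  assume "\<not> ?thesis"
  then have flat: "F x \<le> real (2 * m + 2)" for x by (meson not_le)
  define f where "f i = F (of_nat i)" for i
  define c where "c i = cos (2 * real i / CARD('p) * pi)" for i
  define P where "P = CARD('p)"
  have P: "P = 6 * m - 1" by (simp add: P_def pm)
  have f0: "0 \<le> f i" and fU: "f i \<le> 2 * m + 2" for i
    using F flat by (simp_all add: f_def slice_profile_def)
  have tot': "(\<Sum>i<P. f i) = real ((2 * m - 1) * P)"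
    using tot sum.reindex_bij_betw[OF bij_betw_of_nat_mod_ring, of F] by (simp add: f_def P_def)
  have corr': "(\<Sum>i<P. f i * c i) \<le> - (P * (2 * real m - 1)\<^sup>2 / (4 * real m))"
    using corr sum.reindex_bij_betw[OF bij_betw_of_nat_mod_ring, of "\<lambda>x::'p mod_ring. F x * Re (chr x)"]
    by (simp add: f_def c_def P_def Re_chr_of_nat)
  have u: "1 \<le> 2 * m + 2" "2 * (2 * m + 2) \<le> CARD('p) + 1" using pm m by simp_all
  have F0: "0 \<le> F x" for x using F by (simp add: slice_profile_def)
  have pos: "kneser_bound CARD('p) (F x) (F y) (F (x + y)) \<and> kneser_bound CARD('p) (F x) (F (x + y)) (F y)"
    if "0 < F x" "0 < F y" "0 < F (x + y)" for x y
    using F that unfolding slice_profile_def by blast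
  have kb1: "kneser_bound CARD('p) (F x) (F y) (F (x + y))" for x y
    by (rule kneser_bound_if_le[OF F0 F0 F0 flat flat flat u]) (use pos in blast)
  have kb2: "kneser_bound CARD('p) (F x) (F (x + y)) (F y)" for x y
    by (rule kneser_bound_if_le[OF F0 F0 F0 flat flat flat u]) (use pos in blast)
  have R: "kneser_bound P (f i) (f j) (f ((i + j) mod P))" for i j
    using kb1[of "of_nat i" "of_nat j"] by (simp add: f_def P_def of_nat_mod_CARD)
  have R': "kneser_bound P (f i) (f ((i + j) mod P)) (f j)" for i j
    using kb2[of "of_nat i" "of_nat j"] by (simp add: f_def P_def of_nat_mod_CARD)
  have K: "f i + f j + f ((i + j) mod P) \<le> P + 1" for i j
    using kneser_boundD[OF R] P m by simp
  consider "m = 2" | "m = 3" | "m \<ge> 4" using m by linarith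
  then show False
  proof cases
    case 1
    then have P11: "P = 11" using P by simp
    have c: "84/100 \<le> c 1" "84/100 \<le> c 10" "41/100 \<le> c 2" "41/100 \<le> c 9" "- 15/100 \<le> c 3" "- 15/100 \<le> c 8"
      "- 66/100 \<le> c 4" "- 66/100 \<le> c 7" "- 96/100 \<le> c 5" "- 96/100 \<le> c 6" "c 0 = 1"
      using cos_elevenths cos_full_period[of "20/11" "2/11"] cos_full_period[of "18/11" "4/11"]
        cos_full_period[of "16/11" "6/11"] cos_full_period[of "14/11" "8/11"] cos_full_period[of "12/11" "10/11"] P11
      by (simp_all add: c_def P_def)
    have "(\<Sum>i<P. f i * c i) = f 0 * c 0 + f 1 * c 1 + f 2 * c 2 + f 3 * c 3 + f 4 * c 4 + f 5 * c 5 + f 6 * c 6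
        + f 7 * c 7 + f 8 * c 8 + f 9 * c 9 + f 10 * c 10"
      by (simp add: P11 numeral_eq_Suc)
    also have "\<dots> \<ge> f 0 * 1 + f 1 * (84/100) + f 2 * (41/100) + f 3 * (- 15/100) + f 4 * (- 66/100)
        + f 5 * (- 96/100) + f 6 * (- 96/100) + f 7 * (- 66/100) + f 8 * (- 15/100) + f 9 * (41/100) + f 10 * (84/100)"
      using c f0 by (intro add_mono mult_left_mono) simp_all
    finally have "2475 \<le> 192 * (f 5 + f 6) + 132 * (f 4 + f 7) + 30 * (f 3 + f 8)
      - 82 * (f 2 + f 9) - 168 * (f 1 + f 10) - 200 * f 0"
      using corr' by (simp add: P11 1 field_simps)
    moreover have w: "a + b + c \<le> 111 / 10 \<or> (\<exists>k::nat. a + b \<le> real k + 1 \<and> c \<le> 11 - real k)"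
      if "kneser_bound P a b c" for a b c
      using that by (auto simp: kneser_bound_def P11)
    ultimately show False
      using f0 fU K tot' w[OF R[of 2 4]] w[OF R[of 3 3]] w[OF R'[of 7 7]] w[OF R[of 2 5]]
      by (intro no_flat_profile_11[of f]) (simp_all add: P11 1)
  next
    case 2
    then have P17: "P = 17" using P by simp
    have c: "9/10 \<le> c 1" "9/10 \<le> c 16" "7/10 \<le> c 2" "7/10 \<le> c 15" "4/10 \<le> c 3" "4/10 \<le> c 14"
      "0 \<le> c 4" "0 \<le> c 13" "- 3/10 \<le> c 5" "- 3/10 \<le> c 12" "- 7/10 \<le> c 6" "- 7/10 \<le> c 11"
      "- 9/10 \<le> c 7" "- 9/10 \<le> c 10" "- 1 \<le> c 8" "- 1 \<le> c 9" "c 0 = 1"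
      using cos_seventeenths cos_full_period[of "32/17" "2/17"] cos_full_period[of "30/17" "4/17"]
        cos_full_period[of "28/17" "6/17"] cos_full_period[of "26/17" "8/17"] cos_full_period[of "24/17" "10/17"]
        cos_full_period[of "22/17" "12/17"] cos_full_period[of "20/17" "14/17"] P17
      by (simp_all add: c_def P_def)
    have "(\<Sum>i<P. f i * c i) = f 0 * c 0 + f 1 * c 1 + f 2 * c 2 + f 3 * c 3 + f 4 * c 4 + f 5 * c 5 + f 6 * c 6
        + f 7 * c 7 + f 8 * c 8 + f 9 * c 9 + f 10 * c 10 + f 11 * c 11 + f 12 * c 12 + f 13 * c 13 + f 14 * c 14
        + f 15 * c 15 + f 16 * c 16"
      by (simp add: P17 numeral_eq_Suc)
    also have "\<dots> \<ge> f 0 * 1 + f 1 * (9/10) + f 2 * (7/10) + f 3 * (4/10) + f 4 * 0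
        + f 5 * (- 3/10) + f 6 * (- 7/10) + f 7 * (- 9/10) + f 8 * (- 1) + f 9 * (- 1) + f 10 * (- 9/10)
        + f 11 * (- 7/10) + f 12 * (- 3/10) + f 13 * 0 + f 14 * (4/10) + f 15 * (7/10) + f 16 * (9/10)"
      using c f0 by (intro add_mono mult_left_mono) simp_all
    finally have "425/12 \<le> f 8 + f 9 + 9/10 * f 7 + 9/10 * f 10 + 7/10 * f 6 + 7/10 * f 11
      + 3/10 * f 5 + 3/10 * f 12 - 4/10 * f 3 - 4/10 * f 14 - 7/10 * f 2 - 7/10 * f 15
      - 9/10 * f 1 - 9/10 * f 16 - f 0"
      using corr' by (simp add: P17 2)
    then show False
      using f0 fU K tot' by (intro no_flat_profile_17[of f]) (simp_all add: P17 2)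
  next
    case 3
    define U where "U = 2 * real m + 2"
    have "(\<Sum>i<P. c i) = 0"
    proof -
      have "(\<Sum>i<P. c i) = (\<Sum>x\<in>UNIV. Re (chr (x :: 'p mod_ring)))"
        using sum.reindex_bij_betw[OF bij_betw_of_nat_mod_ring, of "\<lambda>x::'p mod_ring. Re (chr x)"]
        by (simp add: c_def P_def Re_chr_of_nat)
      also have "\<dots> = Re (\<Sum>x\<in>UNIV. chr (x :: 'p mod_ring))" by (rule Re_sum[symmetric])
      finally show ?thesis by (simp add: sum_chr)
    qed
    then have eq: "(\<Sum>i<P. (U - f i) * c i) = - (\<Sum>i<P. f i * c i)"
      by (simp add: left_diff_distrib sum_subtractf flip: sum_distrib_left)
    have "(\<Sum>i<P. (U - f i) * c i) \<le> (\<Sum>i<P. (U - f i) * 1)"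
    proof (intro sum_mono mult_left_mono)
      show "0 \<le> U - f i" for i using fU[of i] by (simp add: U_def)
    qed (simp add: c_def)
    also have "\<dots> = real P * U - (2 * real m - 1) * real P"
      using tot' m by (simp add: sum_subtractf of_nat_diff)
    also have "\<dots> = 3 * real P" by (simp add: U_def algebra_simps)
    \<comment> \<open>This amounts to 4m(m - 4) + 1 being at most 0, which fails from m = 4
      on.\<close>
    finally have "real P * (2 * real m - 1)\<^sup>2 / (4 * real m) \<le> 3 * real P"
      using corr' eq by linarith
    then have "real P * (2 * real m - 1)\<^sup>2 \<le> real P * (12 * real m)"
      using 3 by (simp add: field_simps)
    then have "(2 * real m - 1)\<^sup>2 \<le> 12 * real m"
      using P 3 by (subst (asm) mult_le_cancel_left_pos) auto
    moreover have "0 \<le> real m * (real m - 4)" using 3 by simp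
    ultimately show False by (simp add: power2_eq_square algebra_simps)
  qed
qed

text \<open>The space \<open>F_p^n\<close> as functions vanishing from \<open>n\<close> on: unlike vectors, whose dimension is not
  part of the type, these form an instance of the additive type classes.\<close>

definition E :: "nat \<Rightarrow> (nat \<Rightarrow> 'p::prime_card mod_ring) set" where
  "E n = {f. \<forall>i\<ge>n. f i = 0}"

definition dotp :: "nat \<Rightarrow> (nat \<Rightarrow> 'p::prime_card mod_ring) \<Rightarrow> (nat \<Rightarrow> 'p mod_ring) \<Rightarrow> 'p mod_ring" where
  "dotp n v x = (\<Sum>i<n. v i * x i)"

definition smul :: "'p::prime_card mod_ring \<Rightarrow> (nat \<Rightarrow> 'p mod_ring) \<Rightarrow> nat \<Rightarrow> 'p mod_ring" where
  "smul c x = (\<lambda>i. c * x i)"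

lemma dotp_add_right: "dotp n v (x + y) = dotp n v x + dotp n v y"
  and dotp_diff_right: "dotp n v (x - y) = dotp n v x - dotp n v y"
  and dotp_add_left: "dotp n (v + w) x = dotp n v x + dotp n w x"
  and dotp_smul_right: "dotp n v (smul c x) = c * dotp n v x"
  and dotp_smul_left: "dotp n (smul c v) x = c * dotp n v x"
  and dotp_0_right: "dotp n v 0 = 0"
  and dotp_0_left: "dotp n 0 x = 0"
  by (simp_all add: dotp_def smul_def distrib_left distrib_right right_diff_distrib sum.distrib sum_subtractf
      sum_distrib_left mult_ac)

lemma dotp_minus_right: "dotp n v (- x) = - dotp n v x"
  by (simp add: dotp_def sum_negf)

lemma add_subgroup_E: "add_subgroup (E n)"
  by (auto simp: E_def intro: add_subgroupI)

lemma smul_E: "x \<in> E n \<Longrightarrow> smul c x \<in> E n"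
  by (simp add: E_def smul_def)

lemma smul_add_left: "smul (c + d) x = smul c x + smul d x"
  by (simp add: smul_def distrib_right fun_eq_iff)

lemma finite_E: "finite (E n :: (nat \<Rightarrow> 'p::prime_card mod_ring) set)"
  and card_E: "card (E n :: (nat \<Rightarrow> 'p::prime_card mod_ring) set) = CARD('p) ^ n"
proof -
  let ?P = "PiE {..<n} (\<lambda>_. UNIV :: 'p mod_ring set)"
  let ?h = "\<lambda>g i. if i < n then g i else (0 :: 'p mod_ring)"
  have img: "?h ` ?P = E n"
  proof (intro equalityI subsetI)
    fix f :: "nat \<Rightarrow> 'p mod_ring" assume "f \<in> E n"
    then show "f \<in> ?h ` ?P"
      by (intro image_eqI[of _ _ "restrict f {..<n}"]) (auto simp: E_def fun_eq_iff)
  next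
    fix f assume "f \<in> ?h ` ?P"
    then obtain g where "f = ?h g" by blast
    then show "f \<in> E n" by (simp add: E_def)
  qed
  have inj: "inj_on ?h ?P"
  proof (rule inj_onI)
    fix f g assume fg: "f \<in> ?P" "g \<in> ?P" "?h f = ?h g"
    show "f = g"
    proof (rule PiE_ext[OF fg(1,2)])
      show "f i = g i" if "i \<in> {..<n}" for i using fun_cong[OF fg(3), of i] that by simp
    qed
  qed
  show "finite (E n :: (nat \<Rightarrow> 'p mod_ring) set)" unfolding img[symmetric] by (intro finite_imageI finite_PiE) auto
  show "card (E n :: (nat \<Rightarrow> 'p mod_ring) set) = CARD('p) ^ n"
    unfolding img[symmetric] by (simp add: card_image[OF inj] card_PiE)
qed

lemma exists_dual_vector:
  assumes "v \<in> E n" "v \<noteq> 0"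
  shows "\<exists>e \<in> E n. dotp n v e = 1 \<and> dotp n e v = 1"
proof -
  obtain i where i: "v i \<noteq> 0" using assms(2) by (auto simp: fun_eq_iff)
  then have "i < n" using assms(1) by (auto simp: E_def not_le[symmetric])
  define e where "e = (\<lambda>j. if j = i then inverse (v i) else 0)"
  have "e \<in> E n" using \<open>i < n\<close> by (auto simp: e_def E_def)
  moreover have "dotp n v e = (\<Sum>j<n. if j = i then 1 else 0)"
    unfolding dotp_def e_def using i by (intro sum.cong) auto
  moreover have "dotp n e v = (\<Sum>j<n. if j = i then 1 else 0)"
    unfolding dotp_def e_def using i by (intro sum.cong) auto
  ultimately show ?thesis using \<open>i < n\<close> by auto
qed

lemma sum_chr_dotp:
  fixes x :: "nat \<Rightarrow> 'p::prime_card mod_ring"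
  assumes x: "x \<in> E n"
  shows "(\<Sum>v\<in>E n. chr (dotp n v x)) = (if x = 0 then of_nat (card (E n :: (nat \<Rightarrow> 'p mod_ring) set)) else 0)"
proof (cases "x = 0")
  case False
  obtain e where e: "e \<in> E n" "dotp n e x = 1" using exists_dual_vector[OF x False] by auto
  have "(\<Sum>v\<in>E n. chr (dotp n v x)) = (\<Sum>v\<in>E n. chr (dotp n (e + v) x))"
    using add_subgroupD(2,4)[OF add_subgroup_E] e(1)
    by (intro sum.reindex_bij_witness[of _ "\<lambda>v. e + v" "\<lambda>v. v - e"]) auto
  also have "\<dots> = chr (1 :: 'p mod_ring) * (\<Sum>v\<in>E n. chr (dotp n v x))"
    by (simp add: dotp_add_left e(2) chr_add sum_distrib_left)
  finally show ?thesis using chr_1_neq_1[where 'p = 'p] False by simp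
qed (simp add: dotp_0_right)

text \<open>Besides the vanishing cubic sum, orthogonality gives the Parseval identity: the |h v|^2
  sum to N k. The value t = k^2/(N - k) is the one for which the sum of |h v|^2 (Re (h v) + t) over
  nonzero v is 0. Were Re (h v) > -t for all of them, every such h v would vanish, contrary to
  Parseval.\<close>

lemma negative_fourier_coefficient:
  fixes A :: "(nat \<Rightarrow> 'p::prime_card mod_ring) set"
  assumes A: "A \<subseteq> E n" "A \<noteq> {}" and small: "card A < CARD('p) ^ n"
    and sf: "\<And>a b. a \<in> A \<Longrightarrow> b \<in> A \<Longrightarrow> a + b \<notin> A"
  shows "\<exists>v\<in>E n. v \<noteq> 0 \<and> (\<Sum>a\<in>A. Re (chr (dotp n v a))) \<le> - ((real (card A))\<^sup>2 / (real CARD('p) ^ n - real (card A)))"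
proof (rule ccontr)
  assume neg: "\<not> ?thesis"
  define N where "N = real CARD('p) ^ n"
  define k where "k = real (card A)"
  define t where "t = k\<^sup>2 / (N - k)"
  define h where "h v = (\<Sum>a\<in>A. chr (dotp n v a))" for v
  have finA: "finite A" using A(1) finite_E finite_subset by blast
  have kN: "k < N" using small unfolding k_def N_def by (metis of_nat_less_iff of_nat_power)
  have k0: "k > 0" using A(2) finA by (simp add: k_def card_gt_0_iff)
  have big: "Re (h v) > - t" if "v \<in> E n" "v \<noteq> 0" for v
    using neg that by (auto simp: h_def t_def k_def N_def not_le)
  have cnj_chr: "cnj (chr (dotp n v c)) = chr (- dotp n v c)" for v c :: "nat \<Rightarrow> 'p mod_ring"
    by (simp add: chr_minus)
  have mem: "a + b - c \<in> E n" "a - c \<in> E n" if "a \<in> A" "b \<in> A" "c \<in> A" for a b c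
    using that A(1) add_subgroupD[OF add_subgroup_E] by (meson subsetD)+
  have "(\<Sum>v\<in>E n. h v * h v * cnj (h v)) = (\<Sum>v\<in>E n. \<Sum>a\<in>A. \<Sum>b\<in>A. \<Sum>c\<in>A. chr (dotp n v (a + b - c)))"
    by (simp add: h_def sum_product sum_distrib_left sum_distrib_right cnj_chr dotp_add_right dotp_minus_right
        diff_conv_add_uminus chr_add mult_ac del: add_uminus_conv_diff)
  also have "\<dots> = (\<Sum>a\<in>A. \<Sum>b\<in>A. \<Sum>c\<in>A. \<Sum>v\<in>E n. chr (dotp n v (a + b - c)))"
    by (simp only: sum.swap[where A = "E n" and B = A])
  also have "\<dots> = (\<Sum>a\<in>A. \<Sum>b\<in>A. \<Sum>c\<in>A. 0)"
  proof (rule sum.cong[OF refl], rule sum.cong[OF refl], rule sum.cong[OF refl])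
    fix a b c assume abc: "a \<in> A" "b \<in> A" "c \<in> A"
    have "a + b - c \<noteq> 0" using sf[OF abc(1,2)] abc(3) by auto
    then show "(\<Sum>v\<in>E n. chr (dotp n v (a + b - c))) = 0" using sum_chr_dotp[OF mem(1)[OF abc]] by simp
  qed
  also have "\<dots> = 0" by simp
  finally have "(\<Sum>v\<in>E n. h v * h v * cnj (h v)) = 0" .
  moreover have "h v * h v * cnj (h v) = complex_of_real ((cmod (h v))\<^sup>2) * h v" for v
    by (simp only: complex_norm_square mult_ac)
  ultimately have "Re (\<Sum>v\<in>E n. complex_of_real ((cmod (h v))\<^sup>2) * h v) = 0" by simp
  then have cubic: "(\<Sum>v\<in>E n. (cmod (h v))\<^sup>2 * Re (h v)) = 0" by simp
  have "(\<Sum>v\<in>E n. h v * cnj (h v)) = (\<Sum>v\<in>E n. \<Sum>a\<in>A. \<Sum>c\<in>A. chr (dotp n v (a - c)))"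
    by (simp add: h_def sum_product cnj_chr dotp_add_right dotp_minus_right
        diff_conv_add_uminus chr_add del: add_uminus_conv_diff)
  also have "\<dots> = (\<Sum>a\<in>A. \<Sum>c\<in>A. \<Sum>v\<in>E n. chr (dotp n v (a - c)))"
    by (simp only: sum.swap[where A = "E n" and B = A])
  also have "\<dots> = (\<Sum>a\<in>A. \<Sum>c\<in>A. if c = a then complex_of_real N else 0)"
    by (intro sum.cong refl) (auto simp: sum_chr_dotp mem card_E N_def)
  also have "\<dots> = complex_of_real (N * k)" using finA by (simp add: k_def)
  finally have "(\<Sum>v\<in>E n. h v * cnj (h v)) = complex_of_real (N * k)" .
  then have "complex_of_real (\<Sum>v\<in>E n. (cmod (h v))\<^sup>2) = complex_of_real (N * k)"
    by (simp only: of_real_sum complex_norm_square)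
  then have square: "(\<Sum>v\<in>E n. (cmod (h v))\<^sup>2) = N * k" by (simp only: of_real_eq_iff)
  have h0: "h 0 = k" by (simp add: h_def dotp_0_left k_def)
  have E0: "0 \<in> (E n :: (nat \<Rightarrow> 'p mod_ring) set)" by (simp add: E_def)
  have square': "(\<Sum>v\<in>E n - {0}. (cmod (h v))\<^sup>2) = N * k - k\<^sup>2"
    using square sum.remove[OF finite_E E0, of "\<lambda>v. (cmod (h v))\<^sup>2"] by (simp add: h0)
  have cubic': "(\<Sum>v\<in>E n - {0}. (cmod (h v))\<^sup>2 * Re (h v)) = - (k ^ 3)"
    using cubic sum.remove[OF finite_E E0, of "\<lambda>v. (cmod (h v))\<^sup>2 * Re (h v)"]
    by (simp add: h0 power3_eq_cube power2_eq_square)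
  have "(\<Sum>v\<in>E n - {0}. (cmod (h v))\<^sup>2 * (Re (h v) + t)) = - (k ^ 3) + t * (N * k - k\<^sup>2)"
    by (simp add: distrib_left sum.distrib cubic' square' flip: sum_distrib_right)
  also have "t * (N * k - k\<^sup>2) = k ^ 3"
    using kN by (simp add: t_def field_simps power2_eq_square power3_eq_cube)
  finally have "(\<Sum>v\<in>E n - {0}. (cmod (h v))\<^sup>2 * (Re (h v) + t)) = 0" by (simp only: add.left_inverse)
  moreover have "0 \<le> (cmod (h v))\<^sup>2 * (Re (h v) + t)" if "v \<in> E n - {0}" for v
    using big[of v] that by (intro mult_nonneg_nonneg) auto
  ultimately have "\<forall>v\<in>E n - {0}. (cmod (h v))\<^sup>2 * (Re (h v) + t) = 0"
    using finite_E by (subst (asm) sum_nonneg_eq_0_iff) auto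
  then have "\<forall>v\<in>E n - {0}. (cmod (h v))\<^sup>2 = 0" using big by fastforce
  then have "N * k - k\<^sup>2 = 0" using square' by simp
  then show False using kN k0 by (simp add: power2_eq_square)
qed

text \<open>A splitting of a group into the cosets \<open>s i + V\<close>, indexed by the residues \<open>i\<close>.\<close>

locale coset_slicing =
  fixes s :: "'p::prime_card mod_ring \<Rightarrow> 'g::ab_group_add" and V :: "'g set" and k :: nat
  assumes V: "add_subgroup V" "finite V" and card_V: "card V = CARD('p) ^ k"
    and s_add: "s (i + j) = s i + s j" and s_V: "s i \<in> V \<Longrightarrow> i = 0"
begin

definition slice :: "'g set \<Rightarrow> 'p mod_ring \<Rightarrow> 'g set" where
  "slice A i = {w \<in> V. s i + w \<in> A}"

lemma slice_subset: "slice A i \<subseteq> V" and finite_slice: "finite (slice A i)"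
  using V(2) by (auto simp: slice_def)

lemma s_0 [simp]: "s 0 = 0" using s_add[of 0 0] by simp

lemma s_minus: "s (- i) = - s i" using s_add[of i "- i"] by (simp add: eq_neg_iff_add_eq_0 add.commute)

lemma card_V_pos: "card V > 0" by (simp add: card_V)

lemma slice_sum_free:
  assumes "\<And>a b. a \<in> A \<Longrightarrow> b \<in> A \<Longrightarrow> a + b \<notin> A" "x \<in> slice A i" "y \<in> slice A j"
  shows "x + y \<notin> slice A (i + j)"
  using assms(1)[of "s i + x" "s j + y"] assms(2,3) by (auto simp: slice_def s_add algebra_simps)

lemma slice_index_unique:
  assumes "w \<in> V" "w' \<in> V" "s i + w = s j + w'"
  shows "i = j \<and> w = w'"
proof -
  have "s i - s j = w' - w" using assms(3) by (simp add: algebra_simps)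
  then have "s (i - j) = w' - w" using s_add[of i "- j"] by (simp add: s_minus)
  then have "i - j = 0" using s_V[of "i - j"] add_subgroupD(2)[OF V(1)] assms(1,2) by simp
  then show ?thesis using assms(3) by simp
qed

lemma sum_over_slices:
  fixes g :: "'g \<Rightarrow> real"
  assumes A: "\<And>a. a \<in> A \<Longrightarrow> \<exists>i. \<exists>w\<in>V. a = s i + w"
  shows "(\<Sum>a\<in>A. g a) = (\<Sum>i\<in>UNIV. \<Sum>w\<in>slice A i. g (s i + w))"
proof -
  have "(\<Sum>i\<in>UNIV. \<Sum>w\<in>slice A i. g (s i + w)) = (\<Sum>(i, w)\<in>Sigma UNIV (slice A). g (s i + w))"
    using finite_slice by (intro sum.Sigma) auto
  also have "\<dots> = (\<Sum>a\<in>A. g a)"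
  proof -
    have inj: "inj_on (\<lambda>(i, w). s i + w) (Sigma UNIV (slice A))"
    proof (rule inj_onI, clarify)
      fix i w j w' assume "w \<in> slice A i" "w' \<in> slice A j" "s i + w = s j + w'"
      then show "i = j \<and> w = w'" using slice_index_unique slice_subset by blast
    qed
    have "(\<lambda>(i, w). s i + w) ` Sigma UNIV (slice A) = A"
    proof (intro equalityI subsetI)
      fix a assume "a \<in> A"
      then obtain i w where "w \<in> V" "a = s i + w" using A by blast
      then show "a \<in> (\<lambda>(i, w). s i + w) ` Sigma UNIV (slice A)"
        using \<open>a \<in> A\<close> by (intro image_eqI[of _ _ "(i, w)"]) (auto simp: slice_def)
    qed (auto simp: slice_def)
    then show ?thesis using sum.reindex[OF inj, of g] by (simp add: case_prod_unfold comp_def)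
  qed
  finally show ?thesis by simp
qed

definition weight :: "'g set \<Rightarrow> 'p mod_ring \<Rightarrow> real" where
  "weight A i = real CARD('p) * real (card (slice A i)) / real (card V)"

lemma weight_pos_iff: "weight A i > 0 \<longleftrightarrow> slice A i \<noteq> {}"
  using card_V_pos finite_slice[of A i] by (auto simp: weight_def zero_less_divide_iff zero_less_mult_iff card_gt_0_iff)

lemma weight_not_half:
  assumes "odd CARD('p)"
  shows "weight A i \<noteq> CARD('p) / 2"
proof
  assume "weight A i = CARD('p) / 2"
  then have "real (card (slice A i)) * 2 = real (card V)"
    using card_V_pos by (simp add: weight_def field_simps)
  then have "card (slice A i) * 2 = card V" by linarith
  then show False using assms card_V by (metis dvd_triv_right even_power)
qed

lemma weight_add_le:
  assumes "card (slice A i) + card (slice A j) \<le> card V"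
  shows "weight A i + weight A j \<le> CARD('p)"
proof -
  have "real (card (slice A i)) + real (card (slice A j)) \<le> real (card V)" using assms by linarith
  then have "real CARD('p) * (real (card (slice A i)) + real (card (slice A j))) \<le> real CARD('p) * real (card V)"
    by (intro mult_left_mono) auto
  then show ?thesis using card_V_pos by (simp add: weight_def field_simps)
qed

text \<open>Sum-freeness is read in two ways: the slices at \<open>x\<close> and \<open>y\<close>
  have sums that miss the slice at \<open>x + y\<close>, and the negated slice at \<open>x\<close>
  plus the slice at \<open>x + y\<close> misses the slice at \<open>y\<close>. Negation preserves
  sizes. As the Kneser bound singles out the missed set, both readings are recorded.\<close>

lemma slice_profile_weight:
  assumes sf: "\<And>a b. a \<in> A \<Longrightarrow> b \<in> A \<Longrightarrow> a + b \<notin> A"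
  shows "slice_profile (weight A)"
  unfolding slice_profile_def
proof (intro conjI allI impI)
  note S = slice_subset[of A]
  have free: "x + y \<notin> slice A (i + j)" if "x \<in> slice A i" "y \<in> slice A j" for x y i j
    using sf that by (rule slice_sum_free)
  have neg: "card (uminus ` X) = card X" for X :: "'g set" by (simp add: card_image)
  fix x y
  show "0 \<le> weight A x" by (simp add: weight_def)
  have "card (slice A x) \<le> card V" using V(2) S by (intro card_mono) auto
  then show "weight A x \<le> CARD('p)" using weight_add_le[of "{}" x x]
    using card_V_pos by (simp add: weight_def field_simps mult_left_mono)
  show "weight A y + weight A (x + y) \<le> CARD('p)" if x: "0 < weight A x"
  proof -
    obtain u where u: "u \<in> slice A x" using x weight_pos_iff by blast
    have "card (uminus ` slice A y) + card (slice A (x + y)) \<le> card V"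
    proof (rule pigeonhole_sum[OF V, of _ _ u])
      fix a b assume "a \<in> uminus ` slice A y" "b \<in> slice A (x + y)"
      then obtain z where z: "z \<in> slice A y" "a = - z" by blast
      show "a + b \<noteq> u"
      proof
        assume "a + b = u"
        then have "b = u + z" using z(2) by (simp add: algebra_simps)
        then show False using free[OF u z(1)] \<open>b \<in> slice A (x + y)\<close> by simp
      qed
    qed (use S u add_subgroupD(3)[OF V(1)] in blast)+
    then show ?thesis by (intro weight_add_le) (simp add: neg)
  qed
  show "weight A x + weight A y \<le> CARD('p)" if xy: "0 < weight A (x + y)"
  proof -
    obtain u where u: "u \<in> slice A (x + y)" using xy weight_pos_iff by blast
    have "card (slice A x) + card (slice A y) \<le> card V"
      using free u S by (intro pigeonhole_sum[OF V, of _ _ u]) blast+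
    then show ?thesis by (rule weight_add_le)
  qed
  assume "0 < weight A x" "0 < weight A y" "0 < weight A (x + y)"
  then have ne: "slice A x \<noteq> {}" "slice A y \<noteq> {}" "slice A (x + y) \<noteq> {}" by (simp_all add: weight_pos_iff)
  show "kneser_bound CARD('p) (weight A x) (weight A y) (weight A (x + y))"
    using relative_sizes_missing_sum[OF V card_V prime_card S ne(1) S ne(2) S ne(3) free]
    by (simp add: kneser_bound_def weight_def)
  have "uminus ` slice A x \<subseteq> V" "uminus ` slice A x \<noteq> {}"
    using S ne(1) add_subgroupD(3)[OF V(1)] by blast+
  moreover have "a + b \<notin> slice A y" if "a \<in> uminus ` slice A x" "b \<in> slice A (x + y)" for a b
    using that free by fastforce
  ultimately show "kneser_bound CARD('p) (weight A x) (weight A (x + y)) (weight A y)"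
    using relative_sizes_missing_sum[OF V card_V prime_card _ _ S ne(3) S ne(2), of "uminus ` slice A x"]
    by (simp add: kneser_bound_def weight_def neg)
qed

end

text \<open>The multiples of \<open>e\<close> form a line complementary to the kernel of
  \<open>dotp (Suc k) v\<close>, so the slice at \<open>c\<close> is the part where the form takes
  the value \<open>c\<close>. The decomposition also counts the kernel.\<close>

lemma coset_slicing_dotp:
  fixes v e :: "nat \<Rightarrow> 'p::prime_card mod_ring"
  assumes e: "e \<in> E (Suc k)" "dotp (Suc k) v e = 1"
  shows "coset_slicing (\<lambda>c. smul c e) {w \<in> E (Suc k). dotp (Suc k) v w = 0} k"
    and "x \<in> E (Suc k) \<Longrightarrow> x - smul (dotp (Suc k) v x) e \<in> {w \<in> E (Suc k). dotp (Suc k) v w = 0}"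
proof -
  let ?V = "{w \<in> E (Suc k). dotp (Suc k) v w = 0}"
  note ED = add_subgroupD[OF add_subgroup_E[where n = "Suc k"]]
  show proj: "x - smul (dotp (Suc k) v x) e \<in> ?V" if "x \<in> E (Suc k)" for x
    using that e by (simp add: ED(2) smul_E dotp_diff_right dotp_smul_right)
  have bij: "bij_betw (\<lambda>(c, w). smul c e + w) (UNIV \<times> ?V) (E (Suc k))"
  proof (rule bij_betwI[where g = "\<lambda>x. (dotp (Suc k) v x, x - smul (dotp (Suc k) v x) e)"])
    show "(\<lambda>(c, w). smul c e + w) \<in> UNIV \<times> ?V \<rightarrow> E (Suc k)"
      using e(1) by (auto intro: ED(4) smul_E)
    show "(\<lambda>x. (dotp (Suc k) v x, x - smul (dotp (Suc k) v x) e)) \<in> E (Suc k) \<rightarrow> UNIV \<times> ?V"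
      using proj by auto
  qed (auto simp: dotp_add_right dotp_smul_right e(2))
  have "CARD('p) * card ?V = CARD('p) * CARD('p) ^ k"
    using bij_betw_same_card[OF bij] by (simp add: card_cartesian_product card_E)
  moreover have "CARD('p) > 0" by simp
  ultimately have card: "card ?V = CARD('p) ^ k" by simp
  show "coset_slicing (\<lambda>c. smul c e) ?V k"
  proof
    show "add_subgroup ?V"
    proof (rule add_subgroupI)
      show "0 \<in> ?V" using ED(1) by (simp add: dotp_0_right)
      show "x - y \<in> ?V" if "x \<in> ?V" "y \<in> ?V" for x y
        using that ED(2)[of x y] by (simp add: dotp_diff_right)
    qed
    show "finite ?V" by (rule finite_subset[OF _ finite_E]) auto
    show "i = 0" if "smul i e \<in> ?V" for i
      using that e(2) by (simp add: dotp_smul_right)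
  qed (use card smul_add_left in auto)
qed

theorem sum_free_in_window:
  fixes A :: "(nat \<Rightarrow> 'p::prime_card mod_ring) set"
  assumes pm: "CARD('p) = 6 * m - 1" and m: "m \<ge> 2" and A: "A \<subseteq> E (Suc k)"
    and card: "(2 * m - 1) * CARD('p) ^ k \<le> card A"
    and sf: "\<And>a b. a \<in> A \<Longrightarrow> b \<in> A \<Longrightarrow> a + b \<notin> A"
  shows "\<exists>v\<in>E (Suc k). v \<noteq> 0
    \<and> (\<forall>a\<in>A. \<exists>i::int. 2 * int m - 1 \<le> i \<and> i \<le> 4 * int m \<and> dotp (Suc k) v a = of_int i)"
proof -
  define N where "N = CARD('p) ^ k"
  have N: "N > 0" by (simp add: N_def)
  \<comment> \<open>The Fourier estimate is evaluated at the exact size required by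
    \<open>profile_not_flat\<close>. A large slice of \<open>A'\<close> lies in a slice of
    \<open>A\<close>, and all later steps use \<open>A\<close> itself.\<close>
  obtain A' where A': "A' \<subseteq> A" "card A' = (2 * m - 1) * N"
    using obtain_subset_with_card_n[OF card] by (metis N_def)
  have rp: "real CARD('p) = 6 * real m - 1" using pm m by simp
  have rc: "real (card A') = (2 * real m - 1) * real N" using A'(2) m by (simp add: of_nat_diff)
  have rP: "real CARD('p) ^ Suc k = real CARD('p) * real N" by (simp add: N_def)
  have "A' \<noteq> {}" using A'(2) m N by auto
  moreover have "card A' < CARD('p) ^ Suc k"
    using A'(2) pm m N by (simp add: N_def)
  ultimately obtain v where v: "v \<in> E (Suc k)" "v \<noteq> 0"
    and corr: "(\<Sum>a\<in>A'. Re (chr (dotp (Suc k) v a)))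
      \<le> - ((real (card A'))\<^sup>2 / (real CARD('p) ^ Suc k - real (card A')))"
    using negative_fourier_coefficient[of A' "Suc k"] A' A sf by (metis subset_eq)
  obtain e where e: "e \<in> E (Suc k)" "dotp (Suc k) v e = 1" using exists_dual_vector[OF v] by auto
  define V where "V = {w \<in> E (Suc k). dotp (Suc k) v w = 0}"
  interpret coset_slicing "\<lambda>c. smul c e" V k
    unfolding V_def by (rule coset_slicing_dotp[OF e])
  have cV: "real (card V) = real N" by (simp add: card_V N_def)
  have cover: "\<exists>i. \<exists>w\<in>V. a = smul i e + w" if "a \<in> A" for a
    using coset_slicing_dotp(2)[OF e, of a] that A
    by (intro exI[of _ "dotp (Suc k) v a"] bexI[of _ "a - smul (dotp (Suc k) v a) e"]) (auto simp: V_def)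
  have val: "dotp (Suc k) v (smul i e + w) = i" if "w \<in> V" for i w
    using that by (simp add: V_def dotp_add_right dotp_smul_right e(2))
  have total: "(\<Sum>i\<in>UNIV. weight B i) = real CARD('p) * real (card B) / real N" if "B \<subseteq> A" for B
  proof -
    have "real (card B) = (\<Sum>i\<in>UNIV. real (card (slice B i)))"
      using sum_over_slices[of B "\<lambda>_. 1"] cover that by auto
    then show ?thesis by (simp add: weight_def cV sum_distrib_left sum_divide_distrib)
  qed
  have "(\<Sum>i\<in>UNIV. weight A' i * Re (chr i))
      = real CARD('p) / real N * (\<Sum>i\<in>UNIV. real (card (slice A' i)) * Re (chr i))"
    by (simp add: weight_def cV sum_distrib_left mult_ac)
  also have "(\<Sum>i\<in>UNIV. real (card (slice A' i)) * Re (chr i))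
      = (\<Sum>i\<in>UNIV. \<Sum>w\<in>slice A' i. Re (chr (dotp (Suc k) v (smul i e + w))))"
    using val slice_subset by (intro sum.cong refl) (simp add: subset_iff)
  also have "\<dots> = (\<Sum>a\<in>A'. Re (chr (dotp (Suc k) v a)))"
    using cover A'(1) by (intro sum_over_slices[symmetric]) auto
  also have "real CARD('p) / real N * \<dots>
      \<le> real CARD('p) / real N * - ((real (card A'))\<^sup>2 / (real CARD('p) ^ Suc k - real (card A')))"
    using corr by (intro mult_left_mono) auto
  also have "\<dots> = - (CARD('p) * (2 * real m - 1)\<^sup>2 / (4 * real m))"
  proof -
    have "real CARD('p) ^ Suc k - real (card A') = real CARD('p) * real N - (2 * real m - 1) * real N"
      by (simp only: rP rc)
    also have "\<dots> = (6 * real m - 1) * real N - (2 * real m - 1) * real N" by (simp only: rp)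
    finally have "real CARD('p) ^ Suc k - real (card A') = 4 * real m * real N"
      by (simp add: algebra_simps)
    then show ?thesis using N m by (simp add: rc power2_eq_square field_simps)
  qed
  finally have corr': "(\<Sum>i\<in>UNIV. weight A' i * Re (chr i)) \<le> - (CARD('p) * (2 * real m - 1)\<^sup>2 / (4 * real m))" .
  have tot': "(\<Sum>i\<in>UNIV. weight A' i) = real ((2 * m - 1) * CARD('p))"
    using total[OF A'(1)] N A'(2) by simp
  have sf': "a + b \<notin> A'" if "a \<in> A'" "b \<in> A'" for a b using sf A'(1) that by blast
  obtain x where x: "weight A' x > real (2 * m + 2)"
    using profile_not_flat[OF slice_profile_weight[OF sf'] pm m tot' corr'] by blast
  have "weight A' x \<le> weight A x"
  proof -
    have "card (slice A' x) \<le> card (slice A x)"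
      using finite_slice A'(1) by (intro card_mono) (auto simp: slice_def)
    then show ?thesis by (simp add: weight_def divide_right_mono mult_left_mono)
  qed
  then have big: "\<exists>x. weight A x > real (2 * m + 2)" using x by (intro exI[of _ x]) linarith
  have tot: "real ((2 * m - 1) * CARD('p)) \<le> (\<Sum>i\<in>UNIV. weight A i)"
  proof -
    have "real ((2 * m - 1) * N) \<le> real (card A)" using card by (simp only: N_def of_nat_le_iff)
    then have "real CARD('p) * real ((2 * m - 1) * N) \<le> real CARD('p) * real (card A)"
      by (intro mult_left_mono) auto
    also have "\<dots> = real N * (\<Sum>i\<in>UNIV. weight A i)" using total[of A] N by simp
    finally have "real N * real ((2 * m - 1) * CARD('p)) \<le> real N * (\<Sum>i\<in>UNIV. weight A i)"
      by (simp add: mult_ac)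
    then show ?thesis using N by (subst (asm) mult_le_cancel_left_pos) auto
  qed
  have odd: "odd CARD('p)" using pm m by simp
  obtain d where d: "d \<noteq> 0"
    "\<And>x. 0 < weight A x \<Longrightarrow> \<exists>i::int. 2 * int m - 1 \<le> i \<and> i \<le> 4 * int m \<and> x = d * of_int i"
    using profile_window[OF slice_profile_weight[OF sf] pm m tot big weight_not_half[OF odd]] by blast
  show ?thesis
  proof (intro bexI conjI ballI)
    \<comment> \<open>The dilation by \<open>d\<close> is absorbed into the linear form.\<close>
    show "smul (inverse d) v \<in> E (Suc k)" using v(1) by (rule smul_E)
    show "smul (inverse d) v \<noteq> 0" using v(2) d(1) by (auto simp: smul_def fun_eq_iff)
    fix a assume a: "a \<in> A"
    obtain i w where iw: "w \<in> V" "a = smul i e + w" using cover[OF a] by blast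
    then have "slice A i \<noteq> {}" using a by (auto simp: slice_def)
    then obtain j :: int where j: "2 * int m - 1 \<le> j" "j \<le> 4 * int m" "i = d * of_int j"
      using d(2)[of i] weight_pos_iff by blast
    then have "dotp (Suc k) (smul (inverse d) v) a = of_int j"
      using iw val d(1) by (simp add: dotp_smul_left)
    then show "\<exists>i::int. 2 * int m - 1 \<le> i \<and> i \<le> 4 * int m \<and> dotp (Suc k) (smul (inverse d) v) a = of_int i"
      using j by blast
  qed
qed

section \<open>Extremal sets\<close>

context coset_slicing
begin

abbreviation X :: "'g set \<Rightarrow> int \<Rightarrow> 'g set" where
  "X A j \<equiv> slice A (of_int j)"

text \<open>Translation by the point with coset part \<open>u\<close> carries slice \<open>j\<close>
  into coset \<open>i + j\<close>, where it must be disjoint from the slice of \<open>A\<close>; if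
  the sizes fill \<open>V\<close>, the two are complementary.\<close>

lemma card_slices_le:
  assumes sf: "\<And>a b. a \<in> A \<Longrightarrow> b \<in> A \<Longrightarrow> a + b \<notin> A" and u: "u \<in> X A i"
  shows "card (X A j) + card (X A (i + j)) \<le> card V"
    and "card (X A j) + card (X A (i + j)) = card V \<Longrightarrow> X A (i + j) = V - (+) u ` X A j"
proof -
  have sub: "(+) u ` X A j \<subseteq> V"
    using u slice_subset add_subgroupD(4)[OF V(1)] by blast
  have disj: "(+) u ` X A j \<inter> X A (i + j) = {}"
    using slice_sum_free[OF _ u, of _ "of_int j"] sf by fastforce
  have "card ((+) u ` X A j \<union> X A (i + j)) = card ((+) u ` X A j) + card (X A (i + j))"
    using disj finite_slice by (intro card_Un_disjoint) auto
  then have card: "card ((+) u ` X A j \<union> X A (i + j)) = card (X A j) + card (X A (i + j))"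
    by (simp add: card_image)
  have sub': "(+) u ` X A j \<union> X A (i + j) \<subseteq> V" using sub slice_subset by blast
  show "card (X A j) + card (X A (i + j)) \<le> card V"
    using card_mono[OF V(2) sub'] card by simp
  assume "card (X A j) + card (X A (i + j)) = card V"
  then have "(+) u ` X A j \<union> X A (i + j) = V"
    using card_subset_eq[OF V(2) sub'] card by simp
  then show "X A (i + j) = V - (+) u ` X A j" using disj by blast
qed

text \<open>If a point lies in the outermost coset, the window \<open>[2m - 1, 4m]\<close> splits into three pairs of
  slices related by its translation, and the size of \<open>A\<close> forces equality in all estimates.\<close>

lemma slices_of_extremal_set:
  assumes pm: "int CARD('p) = 6 * m - 1" and m: "m \<ge> 2"
    and cover: "\<And>a. a \<in> A \<Longrightarrow> \<exists>i. \<exists>w\<in>V. a = s i + w"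
    and sf: "\<And>a b. a \<in> A \<Longrightarrow> b \<in> A \<Longrightarrow> a + b \<notin> A"
    and card: "(2 * m - 1) * int (card V) \<le> int (card A)"
    and window: "\<And>i. slice A i \<noteq> {} \<Longrightarrow> \<exists>j. 2 * m - 1 \<le> j \<and> j \<le> 4 * m \<and> i = of_int j"
    and zero: "0 \<in> X A (2 * m - 1)"
  defines "H \<equiv> X A (2 * m - 1)" and "P \<equiv> X A (4 * m - 1)"
  shows "add_subgroup H" and "X A (2 * m) = V - P" and "\<And>j. 2 * m + 1 \<le> j \<Longrightarrow> j \<le> 4 * m - 3 \<Longrightarrow> X A j = V"
    and "X A (4 * m - 2) = V - H" and "X A (4 * m) = {}"
    and "\<And>x h. x \<in> P \<Longrightarrow> h \<in> H \<Longrightarrow> x + h \<in> P" and "\<And>x y. x \<in> P \<Longrightarrow> y \<in> P \<Longrightarrow> x + y \<notin> H"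
proof -
  define c where "c j = int (card (X A j))" for j
  define N where "N = int (card V)"
  have N: "N > 0" using card_V_pos by (simp add: N_def)
  have cN: "c j \<le> N" for j
    using card_mono[OF V(2) slice_subset] by (simp add: c_def N_def)
  have inj: "inj_on (of_int :: int \<Rightarrow> 'p mod_ring) {2 * m - 1..4 * m}"
  proof (rule inj_onI)
    fix i j assume ij: "i \<in> {2 * m - 1..4 * m}" "j \<in> {2 * m - 1..4 * m}" "(of_int i :: 'p mod_ring) = of_int j"
    have "nat i < CARD('p)" "nat j < CARD('p)" using ij(1,2) pm m by auto
    moreover have "(of_nat (nat i) :: 'p mod_ring) = of_nat (nat j)" using ij m by (simp add: of_nat_nat)
    ultimately have "nat i = nat j" using of_nat_mod_ring_eq_iff by blast
    moreover have "0 \<le> i" "0 \<le> j" using ij(1,2) m by auto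
    ultimately show "i = j" by simp
  qed
  have "int (card A) = (\<Sum>j\<in>{2 * m - 1..4 * m}. c j)"
  proof -
    have "real (card A) = (\<Sum>i\<in>UNIV. real (card (slice A i)))"
      using sum_over_slices[of A "\<lambda>_. 1"] cover by auto
    then have "card A = (\<Sum>i\<in>UNIV. card (slice A i))" by (metis of_nat_eq_iff of_nat_sum)
    also have "\<dots> = (\<Sum>i\<in>of_int ` {2 * m - 1..4 * m}. card (slice A i))"
    proof (rule sum.mono_neutral_right)
      show "\<forall>i\<in>UNIV - of_int ` {2 * m - 1..4 * m}. card (slice A i) = 0"
      proof
        fix i :: "'p mod_ring" assume "i \<in> UNIV - of_int ` {2 * m - 1..4 * m}"
        then have "slice A i = {}" using window[of i] by (metis DiffD2 atLeastAtMost_iff imageI)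
        then show "card (slice A i) = 0" by simp
      qed
    qed auto
    also have "\<dots> = (\<Sum>j\<in>{2 * m - 1..4 * m}. card (X A j))"
      using sum.reindex[OF inj] by (simp add: comp_def)
    finally show ?thesis by (simp add: c_def)
  qed
  \<comment> \<open>Adding 2m - 1 sends 2m - 1, 2m, 2m + 1 to 4m - 2, 4m - 1, 4m. These three pairs
    and the other 2m - 4 slices contribute at most N each, in total (2m - 1) N, so by
    \<open>card\<close> every contribution is exactly N.\<close>
  moreover have "{2 * m - 1..4 * m} = {2 * m - 1, 2 * m, 2 * m + 1, 4 * m - 2, 4 * m - 1, 4 * m} \<union> {2 * m + 2..4 * m - 3}"
    using m by auto
  moreover have "(\<Sum>j\<in>\<dots>. c j) = (c (2 * m - 1) + c (4 * m - 2)) + (c (2 * m) + c (4 * m - 1)) + (c (2 * m + 1) + c (4 * m))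
      + (\<Sum>j\<in>{2 * m + 2..4 * m - 3}. c j)"
    using m by (subst sum.union_disjoint) auto
  ultimately have total: "(2 * m - 1) * N \<le> (c (2 * m - 1) + c (4 * m - 2)) + (c (2 * m) + c (4 * m - 1)) + (c (2 * m + 1) + c (4 * m))
      + (\<Sum>j\<in>{2 * m + 2..4 * m - 3}. c j)"
    using card by (simp add: N_def)
  have pair: "c j + c (2 * m - 1 + j) \<le> N" for j
    using card_slices_le(1)[OF sf zero, of j] by (simp add: c_def N_def)
  have pairs: "c (2 * m - 1) + c (4 * m - 2) \<le> N" "c (2 * m) + c (4 * m - 1) \<le> N" "c (2 * m + 1) + c (4 * m) \<le> N"
    using pair[of "2 * m - 1"] pair[of "2 * m"] pair[of "2 * m + 1"] by simp_all
  have mid: "(\<Sum>j\<in>B. c j) \<le> int (card B) * N" for B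
    using sum_mono[of B c "\<lambda>_. N"] cN by simp
  have cmid: "int (card {2 * m + 2..4 * m - 3}) = 2 * m - 4" using m by simp
  have pairs_eq: "c (2 * m - 1) + c (4 * m - 2) = N" "c (2 * m) + c (4 * m - 1) = N" "c (2 * m + 1) + c (4 * m) = N"
    using total pairs mid[of "{2 * m + 2..4 * m - 3}"] unfolding cmid by (simp_all add: algebra_simps)
  have full_mid: "X A j = V" if "2 * m + 2 \<le> j" "j \<le> 4 * m - 3" for j
  proof -
    have jin: "j \<in> {2 * m + 2..4 * m - 3}" using that by simp
    have "c j = N"
    proof (rule ccontr)
      assume "c j \<noteq> N"
      then have "c j < N" using cN[of j] by simp
      then have "(\<Sum>j\<in>{2 * m + 2..4 * m - 3}. c j) < (\<Sum>j\<in>{2 * m + 2..4 * m - 3}. N)"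
        using cN jin by (intro sum_strict_mono_ex1) auto
      then have "(\<Sum>j\<in>{2 * m + 2..4 * m - 3}. c j) < (2 * m - 4) * N" using cmid by simp
      then show False using total pairs by (simp add: algebra_simps)
    qed
    then show ?thesis using card_subset_eq[OF V(2) slice_subset] by (simp add: c_def N_def)
  qed
  have compl: "X A (4 * m - 2) = V - (+) u ` H" "X A (4 * m - 1) = V - (+) u ` X A (2 * m)"
    "X A (4 * m) = V - (+) u ` X A (2 * m + 1)" if "u \<in> H" for u
    using card_slices_le(2)[OF sf that[unfolded H_def], of "2 * m - 1"]
      card_slices_le(2)[OF sf that[unfolded H_def], of "2 * m"]
      card_slices_le(2)[OF sf that[unfolded H_def], of "2 * m + 1"] pairs_eq
    by (simp_all add: c_def N_def H_def flip: of_nat_add)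
  \<comment> \<open>8m - 2 = (2m - 1) + p, so sums of two points of \<open>P\<close> are compared
    with \<open>H\<close>.\<close>
  have wrap: "(of_int (4 * m - 1) + of_int (4 * m - 1) :: 'p mod_ring) = of_int (2 * m - 1)"
  proof -
    have "(of_int (6 * m - 1) :: 'p mod_ring) = of_nat CARD('p)" by (simp flip: pm)
    also have "\<dots> = 0" using of_nat_mod_CARD[of "CARD('p)", where 'p = 'p] by simp
    finally have "(of_int (6 * m - 1) :: 'p mod_ring) = 0" .
    then have "(of_int (2 * m - 1) + of_int (6 * m - 1) :: 'p mod_ring) = of_int (2 * m - 1)" by simp
    then show ?thesis by (simp flip: of_int_add)
  qed
  have PP: "x + y \<notin> H" if "x \<in> P" "y \<in> P" for x y
    using slice_sum_free[of A x "of_int (4 * m - 1)" y "of_int (4 * m - 1)"] sf that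
    unfolding wrap by (simp add: H_def P_def)
  have H0: "0 \<in> H" using zero by (simp add: H_def)
  \<comment> \<open>A point in the last slice would make the slice at 2m fill at most half of
    \<open>V\<close>. So does \<open>P\<close>, as \<open>P + P\<close> misses 0. These two slices
    together have the size of \<open>V\<close>, which would thus be even.\<close>
  show empty: "X A (4 * m) = {}"
  proof (rule ccontr)
    assume "X A (4 * m) \<noteq> {}"
    then obtain w where w: "w \<in> X A (4 * m)" by blast
    have "card (X A (2 * m)) + card (X A (2 * m)) \<le> card V"
    proof (rule pigeonhole_sum[OF V])
      show "x + y \<noteq> w" if "x \<in> X A (2 * m)" "y \<in> X A (2 * m)" for x y
      proof -
        have "(of_int (2 * m) + of_int (2 * m) :: 'p mod_ring) = of_int (4 * m)" by (simp flip: of_int_add)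
        then show ?thesis
          using slice_sum_free[of A x "of_int (2 * m)" y "of_int (2 * m)"] sf that w by auto
      qed
    qed (use slice_subset w in blast)+
    moreover have "card P + card P \<le> card V"
    proof (rule pigeonhole_sum[OF V])
      show "x + y \<noteq> 0" if "x \<in> P" "y \<in> P" for x y using PP[OF that] H0 by metis
    qed (use slice_subset add_subgroupD(1)[OF V(1)] in \<open>simp_all only: P_def\<close>)
    ultimately have "card V = 2 * card P"
      using pairs_eq(2) by (simp add: c_def N_def P_def flip: of_nat_add)
    then have "even (CARD('p) ^ k)" by (simp add: card_V)
    then have "even (int CARD('p))" by simp
    then show False unfolding pm by simp
  qed
  have id: "(+) 0 ` B = B" for B :: "'g set" by simp
  have "V - X A (2 * m + 1) = {}" using compl(3)[OF H0] empty by (simp only: id)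
  then have "X A (2 * m + 1) = V" using slice_subset by blast
  then show "X A j = V" if "2 * m + 1 \<le> j" "j \<le> 4 * m - 3" for j
    using full_mid[of j] that by (cases "j = 2 * m + 1") auto
  have H_sub: "H \<subseteq> V" and P_sub: "P \<subseteq> V" using slice_subset by (simp_all add: H_def P_def)
  show "X A (4 * m - 2) = V - H" using compl(1)[OF H0] by (simp only: id)
  \<comment> \<open>The slice at 4m - 2 is the complement of \<open>u + H\<close> for every
    \<open>u\<close> in \<open>H\<close>, so all these translates coincide. The same freedom in the
    choice of \<open>u\<close> later makes \<open>P\<close> invariant under
    \<open>H\<close>.\<close>
  have shift: "(+) u ` H = H" if "u \<in> H" for u
  proof -
    have "(+) u ` H \<subseteq> V" using that H_sub add_subgroupD(4)[OF V(1)] by blast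
    moreover have "V - (+) u ` H = V - H" using compl(1)[OF that] compl(1)[OF H0] by (simp only: id)
    ultimately show ?thesis using H_sub by blast
  qed
  show H: "add_subgroup H"
  proof (rule add_subgroupI[OF H0])
    fix x y assume "x \<in> H" "y \<in> H"
    then obtain h where "h \<in> H" "x = y + h" using shift[of y] by blast
    then show "x - y \<in> H" by simp
  qed
  have P_compl: "P = V - X A (2 * m)" using compl(2)[OF H0] by (simp only: id P_def)
  then show "X A (2 * m) = V - P" using slice_subset by blast
  show "x + h \<in> P" if "x \<in> P" "h \<in> H" for x h
  proof (rule ccontr)
    assume "x + h \<notin> P"
    moreover have "x + h \<in> V" using that H_sub P_sub add_subgroupD(4)[OF V(1)] by blast
    ultimately have "x + h \<in> X A (2 * m)" using P_compl by blast
    then have "x \<in> (+) (- h) ` X A (2 * m)" by (intro image_eqI[of _ _ "x + h"]) auto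
    then show False using compl(2)[OF add_subgroupD(3)[OF H that(2)]] that(1) by (simp add: P_def)
  qed
  show "x + y \<notin> H" if "x \<in> P" "y \<in> P" for x y using PP that .
qed

end

section \<open>Coordinates\<close>

interpretation fv: vector_space "smul :: 'p::prime_card mod_ring \<Rightarrow> (nat \<Rightarrow> 'p mod_ring) \<Rightarrow> _"
  by unfold_locales (auto simp: smul_def distrib_left distrib_right mult.assoc fun_eq_iff)

definition comb :: "nat \<Rightarrow> (nat \<Rightarrow> nat \<Rightarrow> 'p::prime_card mod_ring) \<Rightarrow> (nat \<Rightarrow> 'p mod_ring) \<Rightarrow> nat \<Rightarrow> 'p mod_ring" where
  "comb n b x = (\<Sum>i<n. smul (x i) (b i))"

lemma comb_add: "comb n b (x + y) = comb n b x + comb n b y"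
  by (simp add: comb_def smul_add_left sum.distrib)

lemma comb_diff: "comb n b (x - y) = comb n b x - comb n b y"
  using comb_add[of n b "x - y" y] by (simp add: algebra_simps)

lemma comb_0: "comb n b 0 = 0"
  using comb_add[of n b 0 0] by simp

lemma dotp_comb: "dotp n v (comb r b x) = (\<Sum>i<r. x i * dotp n v (b i))"
  unfolding comb_def
  by (induction r) (simp_all only: sum.lessThan_Suc lessThan_0 sum.empty dotp_0_right dotp_add_right dotp_smul_right)

text \<open>Every scalar is a multiple of 1. This opens the basis theorems of linear algebra to the
  subgroup found in the extremal case.\<close>

lemma subspace_of_subgroup:
  assumes "add_subgroup H"
  shows "fv.subspace H"
proof (rule fv.subspaceI)
  note H = add_subgroupD[OF assms]
  show "0 \<in> H" "\<And>x y. x \<in> H \<Longrightarrow> y \<in> H \<Longrightarrow> x + y \<in> H" by (rule H)+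
  fix c x assume x: "x \<in> H"
  have "smul (of_nat k) x \<in> H" for k
  proof (induction k)
    case 0
    have "smul (of_nat 0) x = 0" by (simp add: smul_def fun_eq_iff)
    then show ?case using H(1) by (simp only:)
  next
    case (Suc k)
    have "smul (of_nat (Suc k)) x = x + smul (of_nat k) x"
      by (simp add: smul_def fun_eq_iff distrib_right)
    then show ?case using H(4)[OF x Suc] by (simp only:)
  qed
  then show "smul c x \<in> H" using exists_of_nat_mod_ring[of c] by metis
qed

lemma comb_bij_span:
  fixes b :: "nat \<Rightarrow> nat \<Rightarrow> 'p::prime_card mod_ring"
  assumes inj: "inj_on b {..<r}" and ind: "fv.independent (b ` {..<r})"
  shows "bij_betw (comb r b) (E r) (fv.span (b ` {..<r}))"
  unfolding bij_betw_def
proof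
  have bij: "bij_betw b {..<r} (b ` {..<r})" using inj by (simp add: bij_betw_def)
  have sum: "(\<Sum>z\<in>b ` {..<r}. smul (u z) z) = comb r b (\<lambda>i. if i < r then u (b i) else 0)" for u
    unfolding comb_def by (subst sum.reindex_bij_betw[OF bij, symmetric]) simp
  show "inj_on (comb r b) (E r)"
  proof (rule inj_onI)
    fix x y assume xy: "x \<in> E r" "y \<in> E r" "comb r b x = comb r b y"
    define u where "u z = (x - y) (inv_into {..<r} b z)" for z
    have "(\<lambda>i. if i < r then u (b i) else 0) = x - y"
      using xy(1,2) inj by (auto simp: u_def E_def fun_eq_iff)
    then have "(\<Sum>z\<in>b ` {..<r}. smul (u z) z) = 0"
      using xy(3) sum[of u] comb_diff[of r b x y] by simp
    then have "u z = 0" if "z \<in> b ` {..<r}" for z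
      using ind that unfolding fv.independent_explicit_finite_subsets by blast
    then have "u (b i) = 0" if "i < r" for i using that by blast
    then have "x i = y i" if "i < r" for i
      using that that[THEN \<open>\<And>i. i < r \<Longrightarrow> u (b i) = 0\<close>] inv_into_f_f[OF inj, of i] unfolding u_def by simp
    moreover have "x i = y i" if "\<not> i < r" for i using that xy by (simp add: E_def)
    ultimately show "x = y" by (auto simp: fun_eq_iff)
  qed
  show "comb r b ` E r = fv.span (b ` {..<r})"
  proof (intro equalityI subsetI)
    fix w assume "w \<in> comb r b ` E r"
    then show "w \<in> fv.span (b ` {..<r})"
      unfolding comb_def by (auto intro!: fv.span_sum fv.span_scale intro: fv.span_base)
  next
    fix w assume "w \<in> fv.span (b ` {..<r})"
    then obtain u where "w = (\<Sum>z\<in>b ` {..<r}. smul (u z) z)"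
      by (auto simp: fv.span_finite)
    then show "w \<in> comb r b ` E r"
      unfolding sum by (intro image_eqI) (auto simp: E_def)
  qed
qed

text \<open>The basis starts with \<open>e\<close>, continues with a basis of a complement of
  \<open>H\<close> in the kernel of the form, and ends with a basis of \<open>H\<close>. So
  coordinate 0 is the value of the form, and \<open>l\<close> is the codimension of
  \<open>H\<close>.\<close>

lemma adapted_frame:
  fixes v e :: "nat \<Rightarrow> 'p::prime_card mod_ring"
  assumes e: "e \<in> E n" "dotp n v e = 1"
    and H: "add_subgroup H" "H \<subseteq> {w \<in> E n. dotp n v w = 0}"
  obtains b l where "1 \<le> l" "l \<le> n" "b 0 = e" "bij_betw (comb n b) (E n) (E n)"
    "\<And>x. dotp n v (comb n b x) = x 0"
    "\<And>x. x \<in> E n \<Longrightarrow> comb n b x \<in> H \<longleftrightarrow> (\<forall>i<l. x i = 0)"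
proof -
  define V where "V = {w \<in> E n. dotp n v w = 0}"
  have subE: "fv.subspace (E n :: (nat \<Rightarrow> 'p mod_ring) set)" by (rule subspace_of_subgroup[OF add_subgroup_E])
  have subV: "fv.subspace V"
    using subE by (auto simp: fv.subspace_def V_def dotp_0_right dotp_add_right dotp_smul_right)
  obtain BH where BH: "BH \<subseteq> H" "fv.independent BH" "H \<subseteq> fv.span BH"
    using fv.basis_exists[of H] by metis
  obtain BV where BV: "BH \<subseteq> BV" "BV \<subseteq> V" "fv.independent BV" "V \<subseteq> fv.span BV"
    using fv.maximal_independent_subset_extend[of BH V] BH(1,2) H(2) by (metis V_def order_trans)
  have spanH: "fv.span BH = H" using fv.span_subspace[OF BH(1,3) subspace_of_subgroup[OF H(1)]] .
  have spanV: "fv.span BV = V" using fv.span_subspace[OF BV(2,4) subV] .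
  have eV: "e \<notin> V" using e(2) by (simp add: V_def)
  have finV: "finite BV" using BV(2) finite_E by (auto simp: V_def intro: finite_subset)
  have ind: "fv.independent (insert e BV)"
    using BV(3) eV spanV by (intro fv.independent_insertI) auto
  have spanE: "fv.span (insert e BV) = E n"
  proof (rule fv.span_subspace[OF _ _ subE])
    show "insert e BV \<subseteq> E n" using e(1) BV(2) by (auto simp: V_def)
    show "E n \<subseteq> fv.span (insert e BV)"
    proof
      fix x :: "nat \<Rightarrow> 'p mod_ring" assume x: "x \<in> E n"
      have "x - smul (dotp n v x) e \<in> V"
        using add_subgroupD(2)[OF add_subgroup_E x smul_E[OF e(1)]] e(2)
        by (simp add: V_def dotp_diff_right dotp_smul_right)
      then show "x \<in> fv.span (insert e BV)" unfolding fv.span_insert spanV by blast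
    qed
  qed
  obtain xs where xs: "set xs = BV - BH" "distinct xs" using finV by (metis finite_Diff finite_distinct_list)
  obtain ys where ys: "set ys = BH" "distinct ys" using finV BV(1) by (metis finite_subset finite_distinct_list)
  define zs where "zs = e # xs @ ys"
  define r where "r = length zs"
  define b where "b i = zs ! i" for i
  define l where "l = Suc (length xs)"
  have setzs: "set zs = insert e BV" using xs ys BV(1) by (auto simp: zs_def)
  have dist: "distinct zs" using xs ys eV BV(1,2) by (auto simp: zs_def)
  have img: "b ` {..<r} = insert e BV"
    unfolding setzs[symmetric] by (auto simp: b_def r_def set_conv_nth)
  have inj: "inj_on b {..<r}" using dist by (auto simp: inj_on_def b_def r_def nth_eq_iff_index_eq)
  have bij: "bij_betw (comb r b) (E r) (E n)"
    using comb_bij_span[OF inj] ind spanE by (simp add: img)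
  \<comment> \<open>The number of basis vectors is read off from the cardinality of their
    span.\<close>
  have "CARD('p) ^ r = CARD('p) ^ n"
    using bij_betw_same_card[OF bij] by (simp add: card_E)
  moreover have "1 < CARD('p)" using prime_card[where 'a = 'p] prime_gt_1_nat by blast
  ultimately have rn: "r = n" using power_inject_exp by blast
  have b0: "b 0 = e" by (simp add: b_def zs_def)
  have bV: "b i \<in> V" if "0 < i" "i < r" for i
  proof -
    have "b i \<in> insert e BV" using img that by blast
    moreover have "b i \<noteq> b 0" using inj_onD[OF inj, of i 0] that by auto
    ultimately show ?thesis using b0 BV(2) by auto
  qed
  have dot: "dotp n v (comb n b x) = x 0" for x
  proof -
    have "r > 0" by (simp add: r_def zs_def)
    have "(\<Sum>i<r. x i * dotp n v (b i)) = (\<Sum>i<r. if i = 0 then x 0 else 0)"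
      using bV b0 e(2) by (intro sum.cong refl) (auto simp: V_def)
    then show ?thesis using \<open>r > 0\<close> by (simp add: dotp_comb rn)
  qed
  have lr: "l \<le> r" by (simp add: l_def r_def zs_def)
  have bH: "b i \<in> BH" if "l \<le> i" "i < r" for i
  proof -
    have "b i = ys ! (i - l)" using that by (cases i) (simp_all add: b_def zs_def l_def nth_append)
    moreover have "i - l < length ys" using that by (simp add: r_def zs_def l_def)
    ultimately show ?thesis using ys(1) nth_mem by metis
  qed
  have bH': "b i \<notin> BH" if "i < l" for i
  proof (cases i)
    case 0
    then show ?thesis using b0 eV BV(1,2) by auto
  next
    case (Suc j)
    then have "b i = xs ! j" "j < length xs" using that by (auto simp: b_def zs_def l_def nth_append)
    then show ?thesis using xs(1) nth_mem by fastforce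
  qed
  have HI: "comb n b x \<in> H" if "\<forall>i<l. x i = 0" for x
    unfolding comb_def rn[symmetric] spanH[symmetric]
  proof (rule fv.span_sum)
    fix i assume "i \<in> {..<r}"
    then show "smul (x i) (b i) \<in> fv.span BH"
      using that bH[of i] by (cases "i < l") (auto intro: fv.span_scale fv.span_base fv.span_zero)
  qed
  have HD: "x i = 0" if x: "x \<in> E n" "comb n b x \<in> H" "i < l" for x i
  proof -
    have finH: "finite BH" using ys(1) by auto
    obtain u where u: "comb n b x = (\<Sum>z\<in>BH. smul (u z) z)"
      using x(2) unfolding spanH[symmetric] fv.span_finite[OF finH] by blast
    define y where "y i = (if i < n \<and> b i \<in> BH then u (b i) else 0)" for i
    have "(\<Sum>z\<in>BH. smul (u z) z) = (\<Sum>z\<in>insert e BV. smul (if z \<in> BH then u z else 0) z)"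
      using BV(1) finV by (intro sum.mono_neutral_cong_left) auto
    also have "\<dots> = (\<Sum>i<r. smul (if b i \<in> BH then u (b i) else 0) (b i))"
      using inj unfolding img[symmetric] by (simp add: sum.reindex)
    also have "\<dots> = comb n b y" unfolding comb_def y_def rn[symmetric] by (intro sum.cong) auto
    finally have "comb n b x = comb n b y" using u by simp
    moreover have "y \<in> E n" by (simp add: y_def E_def)
    ultimately have "x = y" using bij x(1) unfolding rn bij_betw_def inj_on_def by blast
    then show ?thesis using bH'[OF x(3)] by (simp add: y_def)
  qed
  show thesis
    by (rule that[of l b]) (use lr rn b0 bij dot HI HD in \<open>auto simp: l_def\<close>)
qed

section \<open>From functions back to vectors\<close>

definition of_vec :: "'p::prime_card mod_ring vec \<Rightarrow> nat \<Rightarrow> 'p mod_ring" where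
  "of_vec u = (\<lambda>i. if i < dim_vec u then u $ i else 0)"

lemma of_vec_E: "u \<in> carrier_vec n \<Longrightarrow> of_vec u \<in> E n"
  by (auto simp: of_vec_def E_def)

lemma vec_of_vec: "u \<in> carrier_vec n \<Longrightarrow> vec n (of_vec u) = u"
  by (auto simp: of_vec_def)

lemma of_vec_vec: "f \<in> E n \<Longrightarrow> of_vec (vec n f) = f"
  by (auto simp: of_vec_def E_def fun_eq_iff)

lemma of_vec_add: "u \<in> carrier_vec n \<Longrightarrow> w \<in> carrier_vec n \<Longrightarrow> of_vec (u + w) = of_vec u + of_vec w"
  by (auto simp: of_vec_def fun_eq_iff)

text \<open>The automorphism sends a vector to its coordinates in the basis \<open>b\<close>. Its
  image of \<open>A\<close> is written as a preimage under \<open>comb\<close>, so that membership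
  can be tested slice by slice.\<close>

lemma isomorphic_subsets_comb:
  fixes b :: "nat \<Rightarrow> nat \<Rightarrow> 'p::prime_card mod_ring"
  assumes bij: "bij_betw (comb n b) (E n) (E n)" and A: "A \<subseteq> carrier_vec n"
  shows "isomorphic_subsets (FV n) A (vec n ` {f \<in> E n. comb n b f \<in> of_vec ` A})"
proof -
  define \<psi> where "\<psi> = inv_into (E n) (comb n b)"
  define \<phi> where "\<phi> u = vec n (\<psi> (of_vec u))" for u
  have inv: "\<psi> x \<in> E n" "comb n b (\<psi> x) = x" if "x \<in> E n" for x
    using that bij inv_into_into[of x "comb n b" "E n"] bij_betw_inv_into_right[OF bij]
    by (simp_all add: \<psi>_def bij_betw_def)
  have inv': "\<psi> (comb n b x) = x" if "x \<in> E n" for x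
    using bij_betw_inv_into_left[OF bij that] by (simp add: \<psi>_def)
  have comb_E: "comb n b x \<in> E n" if "x \<in> E n" for x using bij that by (auto simp: bij_betw_def)
  have \<psi>_add: "\<psi> (x + y) = \<psi> x + \<psi> y" if "x \<in> E n" "y \<in> E n" for x y
    using inv'[OF add_subgroupD(4)[OF add_subgroup_E inv(1)[OF that(1)] inv(1)[OF that(2)]]] inv(2)[OF that(1)] inv(2)[OF that(2)]
    by (simp only: comb_add)
  have hom: "\<phi> \<in> hom (FV n) (FV n)"
  proof (rule homI)
    show "\<phi> x \<in> carrier (FV n)" for x by (simp add: \<phi>_def monoid_vec_simps)
    fix x y :: "'p mod_ring vec" assume xy: "x \<in> carrier (FV n)" "y \<in> carrier (FV n)"
    then have "\<psi> (of_vec (x + y)) = \<psi> (of_vec x) + \<psi> (of_vec y)"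
      by (simp add: monoid_vec_simps of_vec_add \<psi>_add of_vec_E)
    then show "\<phi> (x \<otimes>\<^bsub>FV n\<^esub> y) = \<phi> x \<otimes>\<^bsub>FV n\<^esub> \<phi> y"
      by (auto simp: \<phi>_def monoid_vec_simps)
  qed
  have "bij_betw \<phi> (carrier_vec n) (carrier_vec n)"
  proof (rule bij_betwI[where g = "\<lambda>u. vec n (comb n b (of_vec u))"])
    show "vec n (comb n b (of_vec (\<phi> u))) = u" if "u \<in> carrier_vec n" for u
      using that by (simp add: \<phi>_def of_vec_vec inv of_vec_E vec_of_vec)
    show "\<phi> (vec n (comb n b (of_vec u))) = u" if "u \<in> carrier_vec n" for u
      using that by (simp add: \<phi>_def of_vec_vec comb_E inv' of_vec_E vec_of_vec)
  qed (auto simp: \<phi>_def)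
  then have iso: "\<phi> \<in> iso (FV n) (FV n)" using hom by (simp add: iso_def monoid_vec_simps)
  have "\<phi> ` A = vec n ` {f \<in> E n. comb n b f \<in> of_vec ` A}"
  proof (intro equalityI subsetI)
    fix w assume "w \<in> \<phi> ` A"
    then obtain u where u: "u \<in> A" "w = \<phi> u" by blast
    then have "of_vec u \<in> E n" using A of_vec_E by blast
    then show "w \<in> vec n ` {f \<in> E n. comb n b f \<in> of_vec ` A}"
      using u inv by (auto simp: \<phi>_def)
  next
    fix w assume "w \<in> vec n ` {f \<in> E n. comb n b f \<in> of_vec ` A}"
    then obtain f u where f: "f \<in> E n" "comb n b f = of_vec u" "u \<in> A" "w = vec n f" by auto
    then have "\<phi> u = w" using inv'[OF f(1)] by (simp add: \<phi>_def)
    then show "w \<in> \<phi> ` A" using f(3) by blast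
  qed
  then show ?thesis
    using A iso unfolding isomorphic_subsets_def by (auto simp: monoid_vec_simps)
qed

lemma isomorphic_subsets_refl: "A \<subseteq> carrier_vec n \<Longrightarrow> isomorphic_subsets (FV n) A A"
proof -
  have "(\<lambda>x. x) \<in> iso (FV n) (FV n)" by (auto simp: iso_def hom_def bij_betw_def)
  then show "A \<subseteq> carrier_vec n \<Longrightarrow> isomorphic_subsets (FV n) A A"
    unfolding isomorphic_subsets_def by (auto simp: monoid_vec_simps)
qed

lemma vec_Suc_in_cons_times:
  "vec (Suc k) f \<in> C \<times>\<^sub>c W \<longleftrightarrow> f 0 \<in> C \<and> vec k (f \<circ> Suc) \<in> W"
  unfolding cons_times_def vec_Suc by auto

lemma vec_Suc_in_model_set:
  "vec (Suc k) f \<in> model_set m k P \<longleftrightarrow>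
     f 0 = of_int (2 * m - 1) \<and> vec k (f \<circ> Suc) = 0\<^sub>v k
     \<or> f 0 = of_int (2 * m) \<and> vec k (f \<circ> Suc) \<notin> P
     \<or> f 0 \<in> residue_interval (2 * m + 1) (4 * m - 3)
     \<or> f 0 = of_int (4 * m - 2) \<and> vec k (f \<circ> Suc) \<noteq> 0\<^sub>v k
     \<or> f 0 = of_int (4 * m - 1) \<and> vec k (f \<circ> Suc) \<in> P"
proof -
  have "vec (Suc k) f \<in> {vCons (of_int (2 * m - 1)) (0\<^sub>v k)} \<longleftrightarrow>
      f 0 = of_int (2 * m - 1) \<and> vec k (f \<circ> Suc) = 0\<^sub>v k"
    by (simp add: vec_Suc)
  then show ?thesis
    unfolding model_set_def Un_iff vec_Suc_in_cons_times by auto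
qed

lemma model_set_subset: "P \<subseteq> carrier_vec k \<Longrightarrow> model_set m k P \<subseteq> carrier_vec (Suc k)"
  unfolding model_set_def cons_times_def by auto

lemma comb_Suc:
  "comb (Suc k) b f = smul (f 0) (b 0) + comb (Suc k) b (f(0 := 0))"
proof -
  have "smul 0 (b 0) = 0" by (simp add: smul_def fun_eq_iff)
  then show ?thesis
    unfolding comb_def sum.lessThan_Suc_shift by (simp only: fun_upd_same) simp
qed

text \<open>In coordinates adapted to \<open>H\<close>, the first is the form, the next l - 1
  describe a point of the hyperplane modulo \<open>H\<close>, and the rest are free because every
  slice is a union of cosets of \<open>H\<close>. The set \<open>P\<close>, being invariant under
  \<open>H\<close>, is determined by the middle coordinates.\<close>

lemma structured_of_extremal_point:
  fixes A :: "'p::prime_card mod_ring vec set"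
  assumes pm: "int CARD('p) = 6 * m - 1" and m: "m \<ge> 2" and A: "A \<subseteq> carrier_vec (Suc k)"
    and sf: "\<And>a b. a \<in> of_vec ` A \<Longrightarrow> b \<in> of_vec ` A \<Longrightarrow> a + b \<notin> of_vec ` A"
    and card: "(2 * m - 1) * int (CARD('p) ^ k) \<le> int (card (of_vec ` A))"
    and window: "\<And>a. a \<in> of_vec ` A \<Longrightarrow> \<exists>i. 2 * m - 1 \<le> i \<and> i \<le> 4 * m \<and> dotp (Suc k) v a = of_int i"
    and a: "a \<in> of_vec ` A" "dotp (Suc k) v a = of_int (2 * m - 1)"
  shows "structured (Suc k) A"
proof -
  define n where "n = Suc k"
  define A0 where "A0 = of_vec ` A"
  define c :: "'p mod_ring" where "c = of_int (2 * m - 1)"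
  have A0: "A0 \<subseteq> E n" using A of_vec_E by (auto simp: A0_def n_def)
  have c: "c \<noteq> 0"
  proof
    assume "c = 0"
    then have "(of_nat (nat (2 * m - 1)) :: 'p mod_ring) = of_nat 0" using m by (simp add: c_def of_nat_nat)
    moreover have "nat (2 * m - 1) < CARD('p)" "0 < CARD('p)" using pm m by auto
    ultimately have "nat (2 * m - 1) = 0" using of_nat_mod_ring_eq_iff by blast
    then show False using m by simp
  qed
  \<comment> \<open>Scaling \<open>a\<close> to form value 1 makes \<open>a\<close> the origin of
    its own coset, which is the hypothesis \<open>zero\<close> of
    \<open>slices_of_extremal_set\<close>.\<close>
  define e where "e = smul (inverse c) a"
  have "a \<in> E n" "dotp n v a = c" using a A0 by (auto simp: A0_def n_def c_def)
  then have e: "e \<in> E n" "dotp n v e = 1"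
    using c by (simp_all add: e_def smul_E dotp_smul_right)
  have ce: "smul c e = a" using c by (simp add: e_def smul_def fun_eq_iff)
  define V where "V = {w \<in> E n. dotp n v w = 0}"
  interpret coset_slicing "\<lambda>c. smul c e" V k
    unfolding V_def n_def by (rule coset_slicing_dotp[OF e[unfolded n_def]])
  have cover: "\<exists>i. \<exists>w\<in>V. x = smul i e + w" if "x \<in> A0" for x
    using coset_slicing_dotp(2)[OF e[unfolded n_def], of x] that A0
    by (intro exI[of _ "dotp (Suc k) v x"] bexI[of _ "x - smul (dotp (Suc k) v x) e"]) (auto simp: V_def n_def)
  have win: "\<exists>j. 2 * m - 1 \<le> j \<and> j \<le> 4 * m \<and> i = of_int j" if ne: "slice A0 i \<noteq> {}" for i
  proof -
    obtain w where w: "w \<in> V" "smul i e + w \<in> A0" using ne by (auto simp: slice_def)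
    then have "dotp n v (smul i e + w) = i" by (simp add: V_def dotp_add_right dotp_smul_right e(2))
    then show ?thesis using window[of "smul i e + w"] w(2) by (simp add: A0_def n_def)
  qed
  have "smul c e + 0 \<in> A0" using a(1) by (simp only: ce A0_def add.right_neutral)
  then have zero: "0 \<in> X A0 (2 * m - 1)"
    using add_subgroupD(1)[OF V(1)] unfolding slice_def c_def by blast
  have card': "(2 * m - 1) * int (card V) \<le> int (card A0)" using card by (simp add: card_V A0_def)
  define H where "H = X A0 (2 * m - 1)"
  define P where "P = X A0 (4 * m - 1)"
  note ext = slices_of_extremal_set[OF pm m cover sf[folded A0_def] card' win zero, folded H_def P_def]
  have H_group: "add_subgroup H" by (rule ext(1))
  have X1: "X A0 (2 * m) = V - P" by (rule ext(2))
  have X2: "X A0 j = V" if "2 * m + 1 \<le> j" "j \<le> 4 * m - 3" for j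
    using that by (intro ext(3))
  have X3: "X A0 (4 * m - 2) = V - H" by (rule ext(4))
  have X4: "X A0 (4 * m) = {}" by (rule ext(5))
  have P_add_H: "x + h \<in> P" if "x \<in> P" "h \<in> H" for x h
    using that by (intro ext(6))
  have P_add_P: "x + y \<notin> H" if "x \<in> P" "y \<in> P" for x y
    using that by (intro ext(7))
  have H_sub: "H \<subseteq> {w \<in> E n. dotp n v w = 0}" using slice_subset by (simp only: H_def flip: V_def)
  obtain b l where b: "1 \<le> l" "l \<le> n" "b 0 = e" "bij_betw (comb n b) (E n) (E n)"
    "\<And>x. dotp n v (comb n b x) = x 0"
    "\<And>x. x \<in> E n \<Longrightarrow> comb n b x \<in> H \<longleftrightarrow> (\<forall>i<l. x i = 0)"
    by (rule adapted_frame[OF e H_group H_sub]) (rule that)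
  obtain l' where l': "l = Suc l'" using b(1) by (cases l) auto
  \<comment> \<open>A vector of middle coordinates is padded by 0 in front, and by the default value
    0 of \<open>of_vec\<close> in the coordinates along \<open>H\<close>.\<close>
  define lift :: "'p mod_ring vec \<Rightarrow> nat \<Rightarrow> 'p mod_ring" where "lift q = of_vec (vCons 0 q)" for q
  have lift_E: "lift q \<in> E n" if "q \<in> carrier_vec l'" for q
    using that b(2) unfolding lift_def l' by (auto simp: of_vec_def E_def)
  define P' where "P' = {q \<in> carrier_vec l'. comb n b (lift q) \<in> P}"
  have comb_V: "comb n b f \<in> V" if "f \<in> E n" "f 0 = 0" for f
    using that b(4,5) by (auto simp: V_def bij_betw_def)
  have H_iff: "comb n b f \<in> H \<longleftrightarrow> vec l' (f \<circ> Suc) = 0\<^sub>v l'" if "f \<in> E n" "f 0 = 0" for f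
  proof -
    have "(\<forall>i<l. f i = 0) \<longleftrightarrow> (\<forall>i<l'. f (Suc i) = 0)"
      unfolding l' using that(2) by (metis Suc_less_eq not0_implies_Suc)
    also have "\<dots> \<longleftrightarrow> vec l' (f \<circ> Suc) = 0\<^sub>v l'" by (auto simp: vec_eq_iff)
    finally show ?thesis using b(6)[OF that(1)] by simp
  qed
  \<comment> \<open>Resetting the coordinates along \<open>H\<close> to 0 changes the point by an
    element of \<open>H\<close>, and \<open>P\<close> does not notice.\<close>
  have P_iff: "comb n b f \<in> P \<longleftrightarrow> vec l' (f \<circ> Suc) \<in> P'" if f: "f \<in> E n" "f 0 = 0" for f
  proof -
    define g where "g = lift (vec l' (f \<circ> Suc))"
    have g: "g \<in> E n" unfolding g_def by (rule lift_E) simp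
    have eq: "f i = g i" if "i < l" for i
      using that f(2) by (cases i) (auto simp: g_def lift_def of_vec_def l')
    have "f - g \<in> E n" "g - f \<in> E n" using add_subgroupD(2)[OF add_subgroup_E] f(1) g by blast+
    then have "comb n b (f - g) \<in> H" "comb n b (g - f) \<in> H" using b(6) eq by simp_all
    then have d: "comb n b f - comb n b g \<in> H" "comb n b g - comb n b f \<in> H" by (simp_all only: comb_diff)
    have "comb n b f \<in> P \<longleftrightarrow> comb n b g \<in> P"
      using P_add_H[OF _ d(1), of "comb n b g"] P_add_H[OF _ d(2), of "comb n b f"] by auto
    then show ?thesis by (simp add: P'_def g_def)
  qed
  have mem: "comb n b f \<in> A0 \<longleftrightarrow> vec l f \<in> model_set m l' P'" if f: "f \<in> E n" for f
  proof -
    define g where "g = f(0 := 0)"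
    have g: "g \<in> E n" "g 0 = 0" "vec l' (f \<circ> Suc) = vec l' (g \<circ> Suc)"
      using f by (auto simp: g_def E_def)
    define w where "w = comb n b g"
    have wV: "w \<in> V" unfolding w_def using g(1,2) by (rule comb_V)
    have "comb n b f = smul (f 0) e + w"
      using comb_Suc[of k b f] b(3) by (simp add: w_def g_def n_def)
    then have "comb n b f \<in> A0 \<longleftrightarrow> w \<in> slice A0 (f 0)" using wV by (simp add: slice_def)
    also have "\<dots> \<longleftrightarrow> vec l f \<in> model_set m l' P'"
      unfolding l' vec_Suc_in_model_set g(3) H_iff[OF g(1,2), folded w_def, symmetric]
        P_iff[OF g(1,2), folded w_def, symmetric]
    proof
      assume w: "w \<in> slice A0 (f 0)"
      then obtain j where j: "2 * m - 1 \<le> j" "j \<le> 4 * m" "f 0 = of_int j" using win by blast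
      then consider "j = 2 * m - 1" | "j = 2 * m" | "2 * m + 1 \<le> j" "j \<le> 4 * m - 3"
        | "j = 4 * m - 2" | "j = 4 * m - 1" | "j = 4 * m" by linarith
      then show "f 0 = of_int (2 * m - 1) \<and> w \<in> H \<or> f 0 = of_int (2 * m) \<and> w \<notin> P
          \<or> f 0 \<in> residue_interval (2 * m + 1) (4 * m - 3)
          \<or> f 0 = of_int (4 * m - 2) \<and> w \<notin> H \<or> f 0 = of_int (4 * m - 1) \<and> w \<in> P"
      proof cases
        case 1 then show ?thesis using w j(3) by (simp only: H_def) simp
      next
        case 2 then show ?thesis using w j(3) X1 by (simp only:) simp
      next
        case 3 then show ?thesis using j(3) by (auto simp: residue_interval_def)
      next
        case 4 then show ?thesis using w j(3) X3 by (simp only:) simp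
      next
        case 5 then show ?thesis using w j(3) by (simp only: P_def) simp
      next
        case 6 then show ?thesis using w j(3) X4 by (simp only:) simp
      qed
    next
      assume "f 0 = of_int (2 * m - 1) \<and> w \<in> H \<or> f 0 = of_int (2 * m) \<and> w \<notin> P
          \<or> f 0 \<in> residue_interval (2 * m + 1) (4 * m - 3)
          \<or> f 0 = of_int (4 * m - 2) \<and> w \<notin> H \<or> f 0 = of_int (4 * m - 1) \<and> w \<in> P"
      then show "w \<in> slice A0 (f 0)"
        unfolding residue_interval_def
      proof (elim disjE conjE imageE)
        assume "f 0 = of_int (2 * m - 1)" "w \<in> H"
        then show ?thesis by (simp only: H_def)
      next
        assume "f 0 = of_int (2 * m)" "w \<notin> P"
        then show ?thesis using X1 wV by (simp only: Diff_iff) simp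
      next
        fix j assume "f 0 = of_int j" "j \<in> {2 * m + 1..4 * m - 3}"
        then show ?thesis using X2[of j] wV by simp
      next
        assume "f 0 = of_int (4 * m - 2)" "w \<notin> H"
        then show ?thesis using X3 wV by (simp only: Diff_iff) simp
      next
        assume "f 0 = of_int (4 * m - 1)" "w \<in> P"
        then show ?thesis by (simp only: P_def)
      qed
    qed
    finally show ?thesis .
  qed
  have P'_sub: "P' \<subseteq> carrier_vec l'" by (auto simp: P'_def)
  note model_sub = model_set_subset[OF P'_sub, of m]
  have image: "vec n ` {f \<in> E n. comb n b f \<in> A0} = model_set m l' P' \<times>\<^sub>v carrier_vec (n - l)"
  proof (intro equalityI subsetI)
    fix u assume "u \<in> vec n ` {f \<in> E n. comb n b f \<in> A0}"
    then obtain f where f: "f \<in> E n" "comb n b f \<in> A0" "u = vec n f" by blast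
    have "u = vec l f @\<^sub>v vec (n - l) (\<lambda>i. f (i + l))" unfolding f(3) using b(2) by (intro eq_vecI) auto
    then show "u \<in> model_set m l' P' \<times>\<^sub>v carrier_vec (n - l)"
      using f(1,2) mem vec_carrier[of "n - l"] unfolding append_times_def by blast
  next
    fix u assume "u \<in> model_set m l' P' \<times>\<^sub>v carrier_vec (n - l)"
    then obtain x y where xy: "x \<in> model_set m l' P'" "y \<in> carrier_vec (n - l)" "u = x @\<^sub>v y"
      unfolding append_times_def by auto
    have x: "x \<in> carrier_vec l" using xy(1) model_sub l' by blast
    have u: "u \<in> carrier_vec n" using x xy(2,3) b(2) append_carrier_vec[of x l y "n - l"] by simp
    have "vec l (of_vec u) = x" using x xy(2,3) u b(2) by (intro eq_vecI) (auto simp: of_vec_def)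
    then have "comb n b (of_vec u) \<in> A0" using mem[OF of_vec_E[OF u]] xy(1) by simp
    then show "u \<in> vec n ` {f \<in> E n. comb n b f \<in> A0}"
      using of_vec_E[OF u] vec_of_vec[OF u] by (intro image_eqI[of _ _ "of_vec u"]) auto
  qed
  \<comment> \<open>A zero sum in \<open>P'\<close> would lift to two points of \<open>P\<close>
    whose sum is 0, an element of \<open>H\<close>.\<close>
  have PP: "0\<^sub>v l' \<notin> P' <#>\<^bsub>FV l'\<^esub> P'"
  proof
    assume "0\<^sub>v l' \<in> P' <#>\<^bsub>FV l'\<^esub> P'"
    then obtain q r where qr: "q \<in> P'" "r \<in> P'" "q + r = 0\<^sub>v l'"
      by (auto simp: set_mult_def monoid_vec_simps)
    have carrier: "vCons 0 q \<in> carrier_vec l" "vCons 0 r \<in> carrier_vec l"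
      using qr(1,2) by (auto simp: P'_def l')
    have "vCons 0 q + vCons 0 r = 0\<^sub>v l"
    proof (rule eq_vecI)
      fix i assume i: "i < dim_vec (0\<^sub>v l :: 'p mod_ring vec)"
      have dim: "dim_vec q = l'" "dim_vec r = l'" using qr(1,2) by (auto simp: P'_def)
      have "q $ j + r $ j = 0" if "j < l'" for j
        using arg_cong[OF qr(3), of "\<lambda>u. u $ j"] that dim by simp
      then show "(vCons 0 q + vCons 0 r) $ i = 0\<^sub>v l $ i"
        using i dim by (cases i) (simp_all add: l')
    qed (use qr(2) in \<open>auto simp: P'_def l'\<close>)
    then have "lift q + lift r = of_vec (0\<^sub>v l)"
      unfolding lift_def using of_vec_add[OF carrier] by simp
    also have "\<dots> = 0" by (auto simp: of_vec_def fun_eq_iff)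
    finally have "comb n b (lift q) + comb n b (lift r) = 0" using comb_add comb_0 by metis
    then show False
      using P_add_P[of "comb n b (lift q)" "comb n b (lift r)"] qr(1,2) add_subgroupD(1)[OF H_group]
      by (simp add: P'_def)
  qed
  have "very_structured l (model_set m l' P')"
    unfolding very_structured_def l' using pm P'_sub PP isomorphic_subsets_refl[OF model_sub] by auto
  moreover have "isomorphic_subsets (FV n) A (model_set m l' P' \<times>\<^sub>v carrier_vec (n - l))"
    using isomorphic_subsets_comb[OF b(4), of A] A unfolding A0_def[symmetric] image by (simp add: n_def)
  ultimately show ?thesis
    unfolding structured_def n_def[symmetric] using b(1,2) by auto
qed

theorem theorem1p5:
  fixes p n :: nat and A :: "('p :: prime_card) mod_ring vec set"
  assumes "p = CARD('p)" and "prime p" and "p \<ge> 11" and "[p = 2] (mod 3)" and "n \<ge> 1"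
    and "A \<subseteq> carrier_vec n"
    and "sum_free (FV n) A"
    and "real (card A) \<ge> 1/3 * (real p - 2) * real p ^ (n - 1)"
  shows "(\<exists>B \<subseteq> residue_interval ((int p + 1) div 3) ((2 * int p - 1) div 3) \<times>\<^sub>c carrier_vec (n - 1).
            isomorphic_subsets (FV n) A B)
         \<or> structured n A"
proof -
  obtain k where k: "n = Suc k" using assms(5) by (cases n) auto
  define m where "m = (p + 1) div 6"
  have "odd p" using assms(2,3) prime_odd_nat[of p] by simp
  moreover have "p mod 3 = 2" using assms(4) by (simp add: cong_def)
  ultimately have "p mod 6 = 5" by presburger
  then have p6: "p = 6 * m - 1" and m: "m \<ge> 2" using assms(3) unfolding m_def by presburger+
  have pm: "CARD('p) = 6 * m - 1" using p6 assms(1) by simp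
  have ipm: "int CARD('p) = 6 * int m - 1" using pm m by simp
  define A0 where "A0 = of_vec ` A"
  have A: "A \<subseteq> carrier_vec (Suc k)" using assms(6) k by simp
  have A0: "A0 \<subseteq> E (Suc k)" using A of_vec_E by (auto simp: A0_def)
  have inj: "inj_on of_vec A" using A vec_of_vec by (metis inj_onI subsetD)
  have sf: "a + b \<notin> A0" if "a \<in> A0" "b \<in> A0" for a b
  proof
    assume "a + b \<in> A0"
    with that obtain x y z where xyz: "x \<in> A" "y \<in> A" "z \<in> A" "of_vec x + of_vec y = of_vec z"
      unfolding A0_def by auto
    then have carr: "x \<in> carrier_vec (Suc k)" "y \<in> carrier_vec (Suc k)" "z \<in> carrier_vec (Suc k)" using A by auto
    have "of_vec (x + y) = of_vec z" using xyz(4) of_vec_add[OF carr(1,2)] by (simp only:)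
    then have "vec (Suc k) (of_vec (x + y)) = vec (Suc k) (of_vec z)" by (rule arg_cong)
    then have "x + y = z" by (simp only: vec_of_vec[OF add_carrier_vec[OF carr(1,2)]] vec_of_vec[OF carr(3)])
    then show False using assms(7) xyz(1-3) unfolding sum_free_def monoid_vec_simps by blast
  qed
  have card: "(2 * m - 1) * CARD('p) ^ k \<le> card A0"
  proof -
    have "1/3 * (real p - 2) = real (2 * m - 1)" using p6 m by (simp add: of_nat_diff)
    then have "real ((2 * m - 1) * p ^ k) \<le> real (card A)" using assms(8) k by simp
    then have "(2 * m - 1) * p ^ k \<le> card A" by (simp only: of_nat_le_iff)
    then show ?thesis using card_image[OF inj] assms(1) by (simp add: A0_def)
  qed
  have icard: "(2 * int m - 1) * int (CARD('p) ^ k) \<le> int (card A0)"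
  proof -
    have "int ((2 * m - 1) * CARD('p) ^ k) \<le> int (card A0)" using card by (simp only: of_nat_le_iff)
    moreover have "int (2 * m - 1) = 2 * int m - 1" using m by simp
    ultimately show ?thesis by (simp only: of_nat_mult)
  qed
  obtain v where v: "v \<in> E (Suc k)" "v \<noteq> 0"
    and window: "\<And>a. a \<in> A0 \<Longrightarrow> \<exists>i. 2 * int m - 1 \<le> i \<and> i \<le> 4 * int m \<and> dotp (Suc k) v a = of_int i"
    using sum_free_in_window[OF pm m A0 card sf] by blast
  have m': "int m \<ge> 2" using m by simp
  consider (low) a where "a \<in> A0" "dotp (Suc k) v a = of_int (2 * int m - 1)"
    | (high) a where "a \<in> A0" "dotp (Suc k) v a = of_int (4 * int m)"
    | (inner) "\<And>a. a \<in> A0 \<Longrightarrow> dotp (Suc k) v a \<noteq> of_int (2 * int m - 1) \<and> dotp (Suc k) v a \<noteq> of_int (4 * int m)"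
    by blast
  then show ?thesis
  proof cases
    case low
    then have "structured (Suc k) A"
      using structured_of_extremal_point[OF ipm m' A, of v a] sf icard window by (simp add: A0_def)
    then show ?thesis using k by simp
  next
    case high
    \<comment> \<open>Since (2m - 1) + 4m = p, passing from \<open>v\<close> to its negative maps
      the window onto itself and exchanges its ends.\<close>
    have "(of_int (int CARD('p)) :: 'p mod_ring) = of_nat CARD('p)" by simp
    also have "\<dots> = 0" using of_nat_mod_CARD[of "CARD('p)", where 'p = 'p] by simp
    finally have reflect: "(of_int (6 * int m - 1 - i) :: 'p mod_ring) = - of_int i" for i
      unfolding ipm by (simp only: of_int_diff) simp
    have dotp: "dotp (Suc k) (smul (- 1) v) x = - dotp (Suc k) v x" for x
      by (simp only: dotp_smul_left) simp
    have "\<exists>i. 2 * int m - 1 \<le> i \<and> i \<le> 4 * int m \<and> dotp (Suc k) (smul (- 1) v) x = of_int i" if x: "x \<in> A0" for x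
    proof -
      obtain i where "2 * int m - 1 \<le> i" "i \<le> 4 * int m" "dotp (Suc k) v x = of_int i" using window[OF x] by blast
      then show ?thesis using reflect[of i] dotp[of x] by (intro exI[of _ "6 * int m - 1 - i"]) simp
    qed
    moreover have "dotp (Suc k) (smul (- 1) v) a = of_int (2 * int m - 1)"
      using high(2) reflect[of "4 * int m"] dotp[of a] by simp
    ultimately have "structured (Suc k) A"
      using structured_of_extremal_point[OF ipm m' A, of "smul (- 1) v" a] sf icard high(1) by (simp add: A0_def)
    then show ?thesis using k by simp
  next
    case inner
    obtain e where e: "e \<in> E (Suc k)" "dotp (Suc k) v e = 1" using exists_dual_vector[OF v] by auto
    \<comment> \<open>The frame for the trivial subgroup only serves to turn the form into the first
      coordinate.\<close>
    have sub: "add_subgroup {0 :: nat \<Rightarrow> 'p mod_ring}" by (rule add_subgroupI) auto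
    have ker: "{0} \<subseteq> {w \<in> E (Suc k). dotp (Suc k) v w = 0}" by (auto simp: E_def dotp_0_right)
    obtain b l where b: "1 \<le> l" "l \<le> Suc k" "b 0 = e" "bij_betw (comb (Suc k) b) (E (Suc k)) (E (Suc k))"
      "\<And>x. dotp (Suc k) v (comb (Suc k) b x) = x 0"
      "\<And>x. x \<in> E (Suc k) \<Longrightarrow> comb (Suc k) b x \<in> {0} \<longleftrightarrow> (\<forall>i<l. x i = 0)"
      by (rule adapted_frame[OF e sub ker]) (rule that)
    have interval: "(int p + 1) div 3 = 2 * int m" "(2 * int p - 1) div 3 = 4 * int m - 1"
      using p6 m by (simp_all add: of_nat_diff)
    have "vec (Suc k) ` {f \<in> E (Suc k). comb (Suc k) b f \<in> A0}
        \<subseteq> residue_interval (2 * int m) (4 * int m - 1) \<times>\<^sub>c carrier_vec k"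
    proof (rule image_subsetI)
      fix f assume "f \<in> {f \<in> E (Suc k). comb (Suc k) b f \<in> A0}"
      then have f: "comb (Suc k) b f \<in> A0" by simp
      obtain i where i: "2 * int m - 1 \<le> i" "i \<le> 4 * int m" "f 0 = of_int i"
        using window[OF f] b(5) by auto
      moreover have "i \<noteq> 2 * int m - 1" "i \<noteq> 4 * int m" using inner[OF f] i(3) b(5) by auto
      ultimately have "f 0 \<in> residue_interval (2 * int m) (4 * int m - 1)"
        by (auto simp: residue_interval_def)
      then show "vec (Suc k) f \<in> residue_interval (2 * int m) (4 * int m - 1) \<times>\<^sub>c carrier_vec k"
        by (simp add: vec_Suc_in_cons_times)
    qed
    then show ?thesis
      using isomorphic_subsets_comb[OF b(4) A] unfolding A0_def interval k by auto
  qed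
qed

end
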